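(* Let $R$ be a (unital, not necessarily commutative) Cu-semiring, and consider the following statements: (1) $R$ is solid, that is, $\mu_R\colon R\otimes R\to R$ is an isomorphism. (2) The map $\mathrm{e}_{R,R}\colon [\![R,R]\!]\otimes R\to R$ is an isomorphism. (3) The map $\pi_R\otimes\mathrm{id}_R\colon R\otimes R\to[\![R,R]\!]\otimes R$ is an isomorphism. (4) The map $\pi_R\colon R\to[\![R,R]\!]$ is an isomorphism. (5) The map $\varepsilon_R\colon[\![R,R]\!]\to R$ is an isomorphism. Then the following implications hold: $(2)\Rightarrow(1)$, $(2)\Rightarrow(3)$, $(4)\Rightarrow(3)$, and $(4)\Leftrightarrow(5)$. Further, if $R$ satisfies (1) and (3), then it satisfies (2). The Cu-semiring $\overline{\mathbb P}$ satisfies (1), (2) and (3), but not (4). The Cu-semiring $M_1$ satisfies (3) and (4), but neither (1) nor (2).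
   Context: A positively ordered semigroup is a commutative monoid $(S,+,0)$ with a partial order $\le$ compatible with addition such that $0\le a$ for all $a$. For $a,b\in S$, $a\ll b$ (way-below) means: whenever $(c_n)_n$ is an increasing sequence in $S$ whose supremum exists and satisfies $b\le\sup_n c_n$, there is $k$ with $a\le c_k$. An element $a$ is compact if $a\ll a$. A Cu-semigroup is a positively ordered semigroup satisfying: (O1) every increasing sequence has a supremum; (O2) every $a$ is the supremum of a sequence $(a_n)_n$ with $a_n\ll a_{n+1}$ for all $n$; (O3) $a'\ll a$ and $b'\ll b$ imply $a'+b'\ll a+b$; (O4) $\sup_n(a_n+b_n)=\sup_n a_n+\sup_n b_n$ for increasing sequences. A generalized Cu-morphism is a map between Cu-semigroups preserving addition, zero, order and suprema of increasing sequences; a Cu-morphism additionally preserves $\ll$. $\mathrm{Cu}[S,T]$ and $\mathrm{Cu}(S,T)$ denote the sets of generalized Cu-morphisms and of Cu-morphisms $S\to T$, with pointwise order and addition. An isomorphism is a bijective additive order-isomorphism. A Cu-bimorphism $\varphi\colon S\times T\to P$ is a map that is additive, zero- and order-preserving in each variable, satisfies $\sup_k\varphi(a_k,b_k)=\varphi(\sup_k a_k,\sup_k b_k)$ for increasing sequences, and satisfies $\varphi(a',b')\ll\varphi(a,b)$ whenever $a'\ll a$ and $b'\ll b$. $S\otimes T$ denotes the Cu-semigroup with universal Cu-bimorphism $S\times T\to S\otimes T$, $(a,b)\mapsto a\otimes b$: every Cu-bimorphism $S\times T\to P$ factors through a unique Cu-morphism $S\otimes T\to P$, and Cu-morphisms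 $\alpha_1,\alpha_2\colon S\otimes T\to P$ satisfy $\alpha_1\le\alpha_2$ iff $\alpha_1(a\otimes b)\le\alpha_2(a\otimes b)$ for all $a,b$. For Cu-morphisms $\varphi_1,\varphi_2$, $\varphi_1\otimes\varphi_2$ is the Cu-morphism with $(\varphi_1\otimes\varphi_2)(a\otimes b)=\varphi_1(a)\otimes\varphi_2(b)$. Let $I_{\mathbb Q}=\mathbb Q\cap(0,1)$. For $\varphi,\psi\in\mathrm{Cu}[S,T]$ write $\varphi\prec\psi$ if $\varphi(a')\ll\psi(a)$ whenever $a'\ll a$ in $S$. A path in $\mathrm{Cu}[S,T]$ is a family $\mathbf f=(f_\lambda)_{\lambda\in I_{\mathbb Q}}$ with $f_{\lambda'}\prec f_\lambda$ whenever $\lambda'<\lambda$. Write $\mathbf f\lesssim\mathbf g$ if for every $\lambda$ there is $\mu$ with $f_\lambda\prec g_\mu$. The internal hom $[\![S,T]\!]$ is the set of classes $[\mathbf f]$ of paths modulo ($\mathbf f\lesssim\mathbf g$ and $\mathbf g\lesssim\mathbf f$), with $[\mathbf f]+[\mathbf g]=[(f_\lambda+g_\lambda)_\lambda]$ and $[\mathbf f]\le[\mathbf g]$ iff $\mathbf f\lesssim\mathbf g$; it is a Cu-semigroup. The endpoint map $\sigma_{S,T}\colon[\![S,T]\!]\to\mathrm{Cu}[S,T]$ is $\sigma_{S,T}([\mathbf f])(a)=\sup_\lambda f_\lambda(a)$. It is known that for Cu-semigroups $S,T,P$ there is a bijection $\mathrm{Cu}(S,[\![T,P]\!])\cong\mathrm{Cu}(S\otimes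 T,P)$ sending $\alpha$ to the Cu-morphism $a\otimes b\mapsto\sigma_{T,P}(\alpha(a))(b)$. The evaluation (counit) map $\mathrm e_{S,T}\colon[\![S,T]\!]\otimes S\to T$ is the Cu-morphism corresponding to $\mathrm{id}_{[\![S,T]\!]}$. A Cu-semiring is a Cu-semigroup $R$ with a Cu-bimorphism $R\times R\to R$, $(r,s)\mapsto rs$, that is associative, and an element $1_R\in R$ with $r1_R=r=1_Rr$ for all $r$. $\mu_R\colon R\otimes R\to R$ is the Cu-morphism induced by multiplication. $\pi_R\colon R\to[\![R,R]\!]$ is the Cu-morphism corresponding to $\mu_R$ under $\mathrm{Cu}(R,[\![R,R]\!])\cong\mathrm{Cu}(R\otimes R,R)$. $\varepsilon_R\colon[\![R,R]\!]\to R$ is the generalized Cu-morphism $\varepsilon_R([\mathbf f])=\sup_\lambda f_\lambda(1_R)$. $\overline{\mathbb P}=[0,\infty]$ with the usual order, addition and multiplication (with $0\cdot\infty=0$). $M_1=[0,\infty)\sqcup(0,\infty]$, a disjoint union of compact elements $[0,\infty)$ and nonzero soft elements $(0,\infty]$ (the Cuntz semigroup of a $\mathrm{II}_1$-factor): order and addition are the usual ones inside each part; the sum of a compact element of value $a$ and a nonzero soft element of value $b$ is the soft element of value $a+b$; for $a$ compact and $b$ nonzero soft, $a\le b$ iff $a<b$ as values, and $b\le a$ iff $b\le a$ as values. Multiplication on $M_1$ is the usual one on $[0,\infty)$ and on $(0,\infty]$, the product of any element with $0$ is $0$, and the product of a nonzero compact element with a nonzero soft element is the soft element whose value is the product of the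 values. *)

theory Defs
  imports Complex_Main "HOL-Library.FuncSet" "HOL-Library.Extended_Nonnegative_Real"
begin

section \<open>Cu-semigroups\<close>

record 'a cu_sg =
  carrier :: "'a set"
  add :: "'a \<Rightarrow> 'a \<Rightarrow> 'a"  (infixl \<open>\<oplus>\<index>\<close> 65)
  zero :: "'a"  (\<open>\<zero>\<index>\<close>)
  le :: "'a \<Rightarrow> 'a \<Rightarrow> bool"  (infix \<open>\<sqsubseteq>\<index>\<close> 50)

locale pos_ordered_semigroup =
  fixes S :: "('a, 'm) cu_sg_scheme" (structure)
  assumes zero_closed: "\<zero> \<in> carrier S"
    and add_closed: "\<lbrakk>a \<in> carrier S; b \<in> carrier S\<rbrakk> \<Longrightarrow> a \<oplus> b \<in> carrier S"
    and add_assoc: "\<lbrakk>a \<in> carrier S; b \<in> carrier S; c \<in> carrier S\<rbrakk> \<Longrightarrow> (a \<oplus> b) \<oplus> c = a \<oplus> (b \<oplus> c)"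
    and add_comm: "\<lbrakk>a \<in> carrier S; b \<in> carrier S\<rbrakk> \<Longrightarrow> a \<oplus> b = b \<oplus> a"
    and add_zero: "a \<in> carrier S \<Longrightarrow> \<zero> \<oplus> a = a"
    and le_refl: "a \<in> carrier S \<Longrightarrow> a \<sqsubseteq> a"
    and le_antisym: "\<lbrakk>a \<in> carrier S; b \<in> carrier S; a \<sqsubseteq> b; b \<sqsubseteq> a\<rbrakk> \<Longrightarrow> a = b"
    and le_trans: "\<lbrakk>a \<in> carrier S; b \<in> carrier S; c \<in> carrier S; a \<sqsubseteq> b; b \<sqsubseteq> c\<rbrakk> \<Longrightarrow> a \<sqsubseteq> c"
    and add_mono: "\<lbrakk>a \<in> carrier S; b \<in> carrier S; c \<in> carrier S; a \<sqsubseteq> b\<rbrakk> \<Longrightarrow> a \<oplus> c \<sqsubseteq> b \<oplus> c"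
    and zero_le: "a \<in> carrier S \<Longrightarrow> \<zero> \<sqsubseteq> a"

definition incr_seq :: "('a, 'm) cu_sg_scheme \<Rightarrow> (nat \<Rightarrow> 'a) \<Rightarrow> bool" where
  "incr_seq S c \<longleftrightarrow> (\<forall>n. c n \<in> carrier S) \<and> (\<forall>n. c n \<sqsubseteq>\<^bsub>S\<^esub> c (Suc n))"

definition is_sup :: "('a, 'm) cu_sg_scheme \<Rightarrow> 'a set \<Rightarrow> 'a \<Rightarrow> bool" where
  "is_sup S A s \<longleftrightarrow> s \<in> carrier S \<and> (\<forall>x\<in>A. x \<sqsubseteq>\<^bsub>S\<^esub> s) \<and>
     (\<forall>u\<in>carrier S. (\<forall>x\<in>A. x \<sqsubseteq>\<^bsub>S\<^esub> u) \<longrightarrow> s \<sqsubseteq>\<^bsub>S\<^esub> u)"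

definition csup :: "('a, 'm) cu_sg_scheme \<Rightarrow> 'a set \<Rightarrow> 'a" where
  "csup S A = (THE s. is_sup S A s)"

definition way_below :: "('a, 'm) cu_sg_scheme \<Rightarrow> 'a \<Rightarrow> 'a \<Rightarrow> bool"  (\<open>(_/ \<lless>\<index> _)\<close> [51, 51] 50) where
  "a \<lless>\<^bsub>S\<^esub> b \<longleftrightarrow> a \<in> carrier S \<and> b \<in> carrier S \<and>
     (\<forall>c s. incr_seq S c \<and> is_sup S (range c) s \<and> b \<sqsubseteq>\<^bsub>S\<^esub> s \<longrightarrow> (\<exists>k. a \<sqsubseteq>\<^bsub>S\<^esub> c k))"

locale cu_semigroup = pos_ordered_semigroup +
  assumes O1: "incr_seq S c \<Longrightarrow> \<exists>s. is_sup S (range c) s"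
    and O2: "a \<in> carrier S \<Longrightarrow> \<exists>c. (\<forall>n. c n \<lless> c (Suc n)) \<and> is_sup S (range c) a"
    and O3: "\<lbrakk>a' \<lless> a; b' \<lless> b\<rbrakk> \<Longrightarrow> a' \<oplus> b' \<lless> a \<oplus> b"
    and O4: "\<lbrakk>incr_seq S c; incr_seq S d\<rbrakk> \<Longrightarrow>
        csup S (range (\<lambda>n. c n \<oplus> d n)) = csup S (range c) \<oplus> csup S (range d)"

text \<open>Morphisms are extensional functions on the carrier (undefined outside it), so that two
  morphisms are equal as soon as they agree on the carrier.\<close>

definition gcu_mor :: "('a, 'm) cu_sg_scheme \<Rightarrow> ('b, 'n) cu_sg_scheme \<Rightarrow> ('a \<Rightarrow> 'b) set" where
  "gcu_mor S T = {f \<in> carrier S \<rightarrow>\<^sub>E carrier T.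
     (\<forall>a\<in>carrier S. \<forall>b\<in>carrier S. f (a \<oplus>\<^bsub>S\<^esub> b) = f a \<oplus>\<^bsub>T\<^esub> f b) \<and>
     f \<zero>\<^bsub>S\<^esub> = \<zero>\<^bsub>T\<^esub> \<and>
     (\<forall>a\<in>carrier S. \<forall>b\<in>carrier S. a \<sqsubseteq>\<^bsub>S\<^esub> b \<longrightarrow> f a \<sqsubseteq>\<^bsub>T\<^esub> f b) \<and>
     (\<forall>c. incr_seq S c \<longrightarrow> f (csup S (range c)) = csup T (range (\<lambda>n. f (c n))))}"

definition cu_mor :: "('a, 'm) cu_sg_scheme \<Rightarrow> ('b, 'n) cu_sg_scheme \<Rightarrow> ('a \<Rightarrow> 'b) set" where
  "cu_mor S T = {f \<in> gcu_mor S T. \<forall>a b. a \<lless>\<^bsub>S\<^esub> b \<longrightarrow> f a \<lless>\<^bsub>T\<^esub> f b}"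

definition cu_iso :: "('a, 'm) cu_sg_scheme \<Rightarrow> ('b, 'n) cu_sg_scheme \<Rightarrow> ('a \<Rightarrow> 'b) \<Rightarrow> bool" where
  "cu_iso S T f \<longleftrightarrow> bij_betw f (carrier S) (carrier T) \<and>
     (\<forall>a\<in>carrier S. \<forall>b\<in>carrier S. f (a \<oplus>\<^bsub>S\<^esub> b) = f a \<oplus>\<^bsub>T\<^esub> f b) \<and>
     (\<forall>a\<in>carrier S. \<forall>b\<in>carrier S. a \<sqsubseteq>\<^bsub>S\<^esub> b \<longleftrightarrow> f a \<sqsubseteq>\<^bsub>T\<^esub> f b)"

definition cu_bimor :: "('a, 'm) cu_sg_scheme \<Rightarrow> ('b, 'n) cu_sg_scheme \<Rightarrow> ('c, 'k) cu_sg_scheme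
    \<Rightarrow> ('a \<Rightarrow> 'b \<Rightarrow> 'c) \<Rightarrow> bool" where
  "cu_bimor S T P \<phi> \<longleftrightarrow>
     (\<forall>a\<in>carrier S. \<forall>b\<in>carrier T. \<phi> a b \<in> carrier P) \<and>
     (\<forall>a\<in>carrier S. \<forall>a'\<in>carrier S. \<forall>b\<in>carrier T. \<phi> (a \<oplus>\<^bsub>S\<^esub> a') b = \<phi> a b \<oplus>\<^bsub>P\<^esub> \<phi> a' b) \<and>
     (\<forall>a\<in>carrier S. \<forall>b\<in>carrier T. \<forall>b'\<in>carrier T. \<phi> a (b \<oplus>\<^bsub>T\<^esub> b') = \<phi> a b \<oplus>\<^bsub>P\<^esub> \<phi> a b') \<and>
     (\<forall>b\<in>carrier T. \<phi> \<zero>\<^bsub>S\<^esub> b = \<zero>\<^bsub>P\<^esub>) \<and> (\<forall>a\<in>carrier S. \<phi> a \<zero>\<^bsub>T\<^esub> = \<zero>\<^bsub>P\<^esub>) \<and>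
     (\<forall>a\<in>carrier S. \<forall>a'\<in>carrier S. \<forall>b\<in>carrier T. a \<sqsubseteq>\<^bsub>S\<^esub> a' \<longrightarrow> \<phi> a b \<sqsubseteq>\<^bsub>P\<^esub> \<phi> a' b) \<and>
     (\<forall>a\<in>carrier S. \<forall>b\<in>carrier T. \<forall>b'\<in>carrier T. b \<sqsubseteq>\<^bsub>T\<^esub> b' \<longrightarrow> \<phi> a b \<sqsubseteq>\<^bsub>P\<^esub> \<phi> a b') \<and>
     (\<forall>c d. incr_seq S c \<and> incr_seq T d \<longrightarrow>
        csup P (range (\<lambda>k. \<phi> (c k) (d k))) = \<phi> (csup S (range c)) (csup T (range d))) \<and>
     (\<forall>a' a b' b. a' \<lless>\<^bsub>S\<^esub> a \<and> b' \<lless>\<^bsub>T\<^esub> b \<longrightarrow> \<phi> a' b' \<lless>\<^bsub>P\<^esub> \<phi> a b)"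

section \<open>The tensor product\<close>

text \<open>
  The Cu-semigroup with universal Cu-bimorphism is constructed as the Cu-completion of the
  algebraic tensor product of positively ordered semigroups. A formal sum of elementary tensors
  is a list of pairs; \<open>tensor_le\<close> is the pre-order on formal sums that defines the algebraic tensor
  product, \<open>tensor_below\<close> its auxiliary relation, and the completion consists of the round ideals
  generated by sequences that increase for the auxiliary relation. That \<open>tensor S T\<close> is a
  Cu-semigroup and \<open>tens S T\<close> a universal Cu-bimorphism, for test objects over every type, is
  proved at the end of this theory (\<open>tensor_cu_semigroup\<close>, \<open>tens_cu_bimor\<close>, \<open>tensor_universal\<close>,
  \<open>tensor_mor_le_iff\<close>).
\<close>

definition formal_sums :: "('a, 'm) cu_sg_scheme \<Rightarrow> ('b, 'n) cu_sg_scheme \<Rightarrow> ('a \<times> 'b) list set" where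
  "formal_sums S T = lists (carrier S \<times> carrier T)"

inductive tensor_le :: "('a, 'm) cu_sg_scheme \<Rightarrow> ('b, 'n) cu_sg_scheme
    \<Rightarrow> ('a \<times> 'b) list \<Rightarrow> ('a \<times> 'b) list \<Rightarrow> bool" for S T where
  refl: "x \<in> formal_sums S T \<Longrightarrow> tensor_le S T x x"
| trans: "\<lbrakk>tensor_le S T x y; tensor_le S T y z\<rbrakk> \<Longrightarrow> tensor_le S T x z"
| append: "\<lbrakk>tensor_le S T x y; tensor_le S T x' y'\<rbrakk> \<Longrightarrow> tensor_le S T (x @ x') (y @ y')"
| swap: "\<lbrakk>x \<in> formal_sums S T; y \<in> formal_sums S T\<rbrakk> \<Longrightarrow> tensor_le S T (x @ y) (y @ x)"
| mono: "\<lbrakk>a \<in> carrier S; a' \<in> carrier S; b \<in> carrier T; b' \<in> carrier T; a \<sqsubseteq>\<^bsub>S\<^esub> a'; b \<sqsubseteq>\<^bsub>T\<^esub> b'\<rbrakk>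
    \<Longrightarrow> tensor_le S T [(a, b)] [(a', b')]"
| addl1: "\<lbrakk>a \<in> carrier S; a' \<in> carrier S; b \<in> carrier T\<rbrakk>
    \<Longrightarrow> tensor_le S T [(a \<oplus>\<^bsub>S\<^esub> a', b)] [(a, b), (a', b)]"
| addl2: "\<lbrakk>a \<in> carrier S; a' \<in> carrier S; b \<in> carrier T\<rbrakk>
    \<Longrightarrow> tensor_le S T [(a, b), (a', b)] [(a \<oplus>\<^bsub>S\<^esub> a', b)]"
| addr1: "\<lbrakk>a \<in> carrier S; b \<in> carrier T; b' \<in> carrier T\<rbrakk>
    \<Longrightarrow> tensor_le S T [(a, b \<oplus>\<^bsub>T\<^esub> b')] [(a, b), (a, b')]"
| addr2: "\<lbrakk>a \<in> carrier S; b \<in> carrier T; b' \<in> carrier T\<rbrakk>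
    \<Longrightarrow> tensor_le S T [(a, b), (a, b')] [(a, b \<oplus>\<^bsub>T\<^esub> b')]"
| zerol1: "b \<in> carrier T \<Longrightarrow> tensor_le S T [(\<zero>\<^bsub>S\<^esub>, b)] []"
| zerol2: "b \<in> carrier T \<Longrightarrow> tensor_le S T [] [(\<zero>\<^bsub>S\<^esub>, b)]"
| zeror1: "a \<in> carrier S \<Longrightarrow> tensor_le S T [(a, \<zero>\<^bsub>T\<^esub>)] []"
| zeror2: "a \<in> carrier S \<Longrightarrow> tensor_le S T [] [(a, \<zero>\<^bsub>T\<^esub>)]"

definition termwise_below :: "('a, 'm) cu_sg_scheme \<Rightarrow> ('b, 'n) cu_sg_scheme
    \<Rightarrow> ('a \<times> 'b) list \<Rightarrow> ('a \<times> 'b) list \<Rightarrow> bool" where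
  "termwise_below S T = list_all2 (\<lambda>p q. fst p \<lless>\<^bsub>S\<^esub> fst q \<and> snd p \<lless>\<^bsub>T\<^esub> snd q)"

definition tensor_below :: "('a, 'm) cu_sg_scheme \<Rightarrow> ('b, 'n) cu_sg_scheme
    \<Rightarrow> ('a \<times> 'b) list \<Rightarrow> ('a \<times> 'b) list \<Rightarrow> bool" where
  "tensor_below S T x y \<longleftrightarrow>
     (\<exists>x' y'. tensor_le S T x x' \<and> termwise_below S T x' y' \<and> tensor_le S T y' y)"

definition tensor :: "('a, 'm) cu_sg_scheme \<Rightarrow> ('b, 'n) cu_sg_scheme \<Rightarrow> ('a \<times> 'b) list set cu_sg"
  where
  "tensor S T = \<lparr>
     carrier = {I. \<exists>x. (\<forall>n. tensor_below S T (x n) (x (Suc n))) \<and>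
                       I = {y. \<exists>n::nat. tensor_below S T y (x n)}},
     add = (\<lambda>I J. {z. \<exists>x\<in>I. \<exists>y\<in>J. tensor_le S T z (x @ y)}),
     zero = {z. tensor_le S T z []},
     le = (\<subseteq>)\<rparr>"

definition tens :: "('a, 'm) cu_sg_scheme \<Rightarrow> ('b, 'n) cu_sg_scheme \<Rightarrow> 'a \<Rightarrow> 'b \<Rightarrow> ('a \<times> 'b) list set"
  where "tens S T a b = {y. tensor_below S T y [(a, b)]}"

text \<open>The Cu-morphism on the tensor product induced by a Cu-bimorphism.\<close>

definition tensor_lift :: "('a, 'm) cu_sg_scheme \<Rightarrow> ('b, 'n) cu_sg_scheme \<Rightarrow> ('c, 'k) cu_sg_scheme
    \<Rightarrow> ('a \<Rightarrow> 'b \<Rightarrow> 'c) \<Rightarrow> ('a \<times> 'b) list set \<Rightarrow> 'c" where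
  "tensor_lift S T P \<phi> = (THE \<alpha>. \<alpha> \<in> cu_mor (tensor S T) P \<and>
     (\<forall>a\<in>carrier S. \<forall>b\<in>carrier T. \<alpha> (tens S T a b) = \<phi> a b))"

definition tensor_map :: "('a, 'm) cu_sg_scheme \<Rightarrow> ('b, 'n) cu_sg_scheme
    \<Rightarrow> ('c, 'k) cu_sg_scheme \<Rightarrow> ('d, 'l) cu_sg_scheme \<Rightarrow> ('a \<Rightarrow> 'c) \<Rightarrow> ('b \<Rightarrow> 'd)
    \<Rightarrow> ('a \<times> 'b) list set \<Rightarrow> ('c \<times> 'd) list set" where
  "tensor_map S T S' T' \<phi> \<psi> =
     tensor_lift S T (tensor S' T') (\<lambda>a b. tens S' T' (\<phi> a) (\<psi> b))"

section \<open>The internal hom\<close>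

abbreviation I_Q :: "rat set" where "I_Q \<equiv> {0<..<1}"

definition gcu_below :: "('a, 'm) cu_sg_scheme \<Rightarrow> ('b, 'n) cu_sg_scheme
    \<Rightarrow> ('a \<Rightarrow> 'b) \<Rightarrow> ('a \<Rightarrow> 'b) \<Rightarrow> bool" where
  "gcu_below S T \<phi> \<psi> \<longleftrightarrow> (\<forall>a' a. a' \<lless>\<^bsub>S\<^esub> a \<longrightarrow> \<phi> a' \<lless>\<^bsub>T\<^esub> \<psi> a)"

definition paths :: "('a, 'm) cu_sg_scheme \<Rightarrow> ('b, 'n) cu_sg_scheme \<Rightarrow> (rat \<Rightarrow> 'a \<Rightarrow> 'b) set" where
  "paths S T = {f \<in> I_Q \<rightarrow>\<^sub>E gcu_mor S T.
     \<forall>l'\<in>I_Q. \<forall>l\<in>I_Q. l' < l \<longrightarrow> gcu_below S T (f l') (f l)}"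

definition path_le :: "('a, 'm) cu_sg_scheme \<Rightarrow> ('b, 'n) cu_sg_scheme
    \<Rightarrow> (rat \<Rightarrow> 'a \<Rightarrow> 'b) \<Rightarrow> (rat \<Rightarrow> 'a \<Rightarrow> 'b) \<Rightarrow> bool" where
  "path_le S T f g \<longleftrightarrow> (\<forall>l\<in>I_Q. \<exists>m\<in>I_Q. gcu_below S T (f l) (g m))"

definition path_class :: "('a, 'm) cu_sg_scheme \<Rightarrow> ('b, 'n) cu_sg_scheme
    \<Rightarrow> (rat \<Rightarrow> 'a \<Rightarrow> 'b) \<Rightarrow> (rat \<Rightarrow> 'a \<Rightarrow> 'b) set" where
  "path_class S T f = {g \<in> paths S T. path_le S T f g \<and> path_le S T g f}"

definition path_add :: "('a, 'm) cu_sg_scheme \<Rightarrow> ('b, 'n) cu_sg_scheme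
    \<Rightarrow> (rat \<Rightarrow> 'a \<Rightarrow> 'b) \<Rightarrow> (rat \<Rightarrow> 'a \<Rightarrow> 'b) \<Rightarrow> rat \<Rightarrow> 'a \<Rightarrow> 'b" where
  "path_add S T f g = (\<lambda>l\<in>I_Q. \<lambda>a\<in>carrier S. f l a \<oplus>\<^bsub>T\<^esub> g l a)"

definition ihom :: "('a, 'm) cu_sg_scheme \<Rightarrow> ('b, 'n) cu_sg_scheme
    \<Rightarrow> (rat \<Rightarrow> 'a \<Rightarrow> 'b) set cu_sg" where
  "ihom S T = \<lparr>
     carrier = path_class S T ` paths S T,
     add = (\<lambda>X Y. \<Union>f\<in>X. \<Union>g\<in>Y. path_class S T (path_add S T f g)),
     zero = path_class S T (\<lambda>l\<in>I_Q. \<lambda>a\<in>carrier S. \<zero>\<^bsub>T\<^esub>),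
     le = (\<lambda>X Y. \<exists>f\<in>X. \<exists>g\<in>Y. path_le S T f g)\<rparr>"

definition endpoint :: "('a, 'm) cu_sg_scheme \<Rightarrow> ('b, 'n) cu_sg_scheme
    \<Rightarrow> (rat \<Rightarrow> 'a \<Rightarrow> 'b) set \<Rightarrow> 'a \<Rightarrow> 'b" where
  "endpoint S T X = (\<lambda>a\<in>carrier S. csup T ((\<lambda>l. (SOME f. f \<in> X) l a) ` I_Q))"

text \<open>The bijection between the Cu-morphisms from \<open>S\<close> to the internal hom of \<open>T\<close> and \<open>P\<close> and the
  Cu-morphisms from the tensor product of \<open>S\<close> and \<open>T\<close> to \<open>P\<close>.\<close>

definition hom_adj :: "('a, 'm) cu_sg_scheme \<Rightarrow> ('b, 'n) cu_sg_scheme \<Rightarrow> ('c, 'k) cu_sg_scheme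
    \<Rightarrow> ('a \<Rightarrow> (rat \<Rightarrow> 'b \<Rightarrow> 'c) set) \<Rightarrow> ('a \<times> 'b) list set \<Rightarrow> 'c" where
  "hom_adj S T P \<alpha> = tensor_lift S T P (\<lambda>a b. endpoint T P (\<alpha> a) b)"

definition eval_map :: "('a, 'm) cu_sg_scheme \<Rightarrow> ('b, 'n) cu_sg_scheme
    \<Rightarrow> ((rat \<Rightarrow> 'a \<Rightarrow> 'b) set \<times> 'a) list set \<Rightarrow> 'b" where
  "eval_map S T = hom_adj (ihom S T) S T (\<lambda>x\<in>carrier (ihom S T). x)"

section \<open>Cu-semirings\<close>

record 'a cu_sr = "'a cu_sg" +
  mult :: "'a \<Rightarrow> 'a \<Rightarrow> 'a"  (infixl \<open>\<odot>\<index>\<close> 70)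
  one :: "'a"  (\<open>\<one>\<index>\<close>)

locale cu_semiring = cu_semigroup R for R :: "('a, 'm) cu_sr_scheme" (structure) +
  assumes mult_bimor: "cu_bimor R R R (mult R)"
    and mult_assoc: "\<lbrakk>a \<in> carrier R; b \<in> carrier R; c \<in> carrier R\<rbrakk> \<Longrightarrow> (a \<odot> b) \<odot> c = a \<odot> (b \<odot> c)"
    and one_closed: "\<one> \<in> carrier R"
    and mult_one_right: "a \<in> carrier R \<Longrightarrow> a \<odot> \<one> = a"
    and mult_one_left: "a \<in> carrier R \<Longrightarrow> \<one> \<odot> a = a"

definition mu_map :: "('a, 'm) cu_sr_scheme \<Rightarrow> ('a \<times> 'a) list set \<Rightarrow> 'a" where
  "mu_map R = tensor_lift R R R (mult R)"

definition pi_map :: "('a, 'm) cu_sr_scheme \<Rightarrow> 'a \<Rightarrow> (rat \<Rightarrow> 'a \<Rightarrow> 'a) set" where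
  "pi_map R = the_inv_into (cu_mor R (ihom R R)) (hom_adj R R R) (mu_map R)"

definition eps_map :: "('a, 'm) cu_sr_scheme \<Rightarrow> (rat \<Rightarrow> 'a \<Rightarrow> 'a) set \<Rightarrow> 'a" where
  "eps_map R = (\<lambda>X\<in>carrier (ihom R R). csup R ((\<lambda>l. (SOME f. f \<in> X) l \<one>\<^bsub>R\<^esub>) ` I_Q))"

definition solid :: "('a, 'm) cu_sr_scheme \<Rightarrow> bool" where
  "solid R \<longleftrightarrow> cu_iso (tensor R R) R (mu_map R)"

definition eval_iso :: "('a, 'm) cu_sr_scheme \<Rightarrow> bool" where
  "eval_iso R \<longleftrightarrow> cu_iso (tensor (ihom R R) R) R (eval_map R R)"

definition pi_tensor_id_iso :: "('a, 'm) cu_sr_scheme \<Rightarrow> bool" where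
  "pi_tensor_id_iso R \<longleftrightarrow> cu_iso (tensor R R) (tensor (ihom R R) R)
     (tensor_map R R (ihom R R) R (pi_map R) (\<lambda>r\<in>carrier R. r))"

definition pi_iso :: "('a, 'm) cu_sr_scheme \<Rightarrow> bool" where
  "pi_iso R \<longleftrightarrow> cu_iso R (ihom R R) (pi_map R)"

definition eps_iso :: "('a, 'm) cu_sr_scheme \<Rightarrow> bool" where
  "eps_iso R \<longleftrightarrow> cu_iso (ihom R R) R (eps_map R)"

section \<open>The two examples\<close>

definition Pbar :: "ennreal cu_sr" where
  "Pbar = \<lparr>carrier = UNIV, add = (+), zero = 0, le = (\<le>), mult = (*), one = 1\<rparr>"

text \<open>The argument of \<open>Cpt\<close> or \<open>Soft\<close> is the value of the compact or soft element; the carrier of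
  \<open>M1\<close> excludes the compact element of value infinity and the soft element of value 0.\<close>

datatype m1 = Cpt ennreal | Soft ennreal

fun m1_add :: "m1 \<Rightarrow> m1 \<Rightarrow> m1" where
  "m1_add (Cpt a) (Cpt b) = Cpt (a + b)"
| "m1_add (Cpt a) (Soft b) = Soft (a + b)"
| "m1_add (Soft a) (Cpt b) = Soft (a + b)"
| "m1_add (Soft a) (Soft b) = Soft (a + b)"

fun m1_le :: "m1 \<Rightarrow> m1 \<Rightarrow> bool" where
  "m1_le (Cpt a) (Cpt b) \<longleftrightarrow> a \<le> b"
| "m1_le (Cpt a) (Soft b) \<longleftrightarrow> a < b"
| "m1_le (Soft a) (Cpt b) \<longleftrightarrow> a \<le> b"
| "m1_le (Soft a) (Soft b) \<longleftrightarrow> a \<le> b"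

fun m1_mult :: "m1 \<Rightarrow> m1 \<Rightarrow> m1" where
  "m1_mult (Cpt a) (Cpt b) = Cpt (a * b)"
| "m1_mult (Cpt a) (Soft b) = (if a = 0 then Cpt 0 else Soft (a * b))"
| "m1_mult (Soft a) (Cpt b) = (if b = 0 then Cpt 0 else Soft (a * b))"
| "m1_mult (Soft a) (Soft b) = Soft (a * b)"

definition M1 :: "m1 cu_sr" where
  "M1 = \<lparr>carrier = {Cpt a |a. a < \<infinity>} \<union> {Soft a |a. a > 0},
     add = m1_add, zero = Cpt 0, le = m1_le, mult = m1_mult, one = Cpt 1\<rparr>"

section \<open>Proof of the universal property of the tensor product\<close>

context pos_ordered_semigroup
begin

lemma add_mono2:
  assumes "a \<in> carrier S" "b \<in> carrier S" "c \<in> carrier S" "d \<in> carrier S" "a \<sqsubseteq> b" "c \<sqsubseteq> d"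
  shows "a \<oplus> c \<sqsubseteq> b \<oplus> d"
proof -
  have "a \<oplus> c \<sqsubseteq> b \<oplus> c" "c \<oplus> b \<sqsubseteq> d \<oplus> b" using assms add_mono by auto
  moreover have "c \<oplus> b = b \<oplus> c" "d \<oplus> b = b \<oplus> d" using assms add_comm by auto
  ultimately show ?thesis using le_trans[of "a \<oplus> c" "b \<oplus> c" "b \<oplus> d"] assms add_closed by simp
qed

lemma is_sup_unique: "\<lbrakk>is_sup S A s; is_sup S A t\<rbrakk> \<Longrightarrow> s = t"
  unfolding is_sup_def using le_antisym by blast

lemma csup_eq: "is_sup S A s \<Longrightarrow> csup S A = s"
  unfolding csup_def using is_sup_unique by blast

lemma is_sup_const: "a \<in> carrier S \<Longrightarrow> is_sup S (range (\<lambda>n::nat. a)) a"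
  unfolding is_sup_def using le_refl by auto

lemma incr_seq_const: "a \<in> carrier S \<Longrightarrow> incr_seq S (\<lambda>n. a)"
  unfolding incr_seq_def using le_refl by auto

lemma incr_seq_le:
  assumes "incr_seq S c" "m \<le> n" shows "c m \<sqsubseteq> c n"
  using assms(2)
proof (induction n rule: dec_induct)
  case base show ?case using assms(1) le_refl unfolding incr_seq_def by blast
next
  case (step n) then show ?case using assms(1) le_trans[of "c m" "c n" "c (Suc n)"] unfolding incr_seq_def by blast
qed

lemma way_below_le: "a \<lless> b \<Longrightarrow> a \<sqsubseteq> b"
  using is_sup_const[of b] incr_seq_const[of b] le_refl[of b] unfolding way_below_def by blast

lemma way_below_closed: "a \<lless> b \<Longrightarrow> a \<in> carrier S" "a \<lless> b \<Longrightarrow> b \<in> carrier S"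
  unfolding way_below_def by auto

lemma way_below_le_trans:
  assumes "a \<lless> b" "b \<sqsubseteq> c" "c \<in> carrier S" shows "a \<lless> c"
  unfolding way_below_def
proof (intro conjI allI impI; (elim conjE)?)
  show "a \<in> carrier S" "c \<in> carrier S" using assms way_below_closed by auto
  fix d s assume d: "incr_seq S d" "is_sup S (range d) s" "c \<sqsubseteq> s"
  then have "s \<in> carrier S" unfolding is_sup_def by auto
  then have "b \<sqsubseteq> s" using le_trans[of b c s] assms d way_below_closed by auto
  then show "\<exists>k. a \<sqsubseteq> d k" using assms(1) d unfolding way_below_def by auto
qed

lemma le_way_below_trans:
  assumes "a \<sqsubseteq> b" "b \<lless> c" "a \<in> carrier S" shows "a \<lless> c"
  unfolding way_below_def
proof (intro conjI allI impI; (elim conjE)?)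
  show "a \<in> carrier S" "c \<in> carrier S" using assms way_below_closed by auto
  fix d s assume d: "incr_seq S d" "is_sup S (range d) s" "c \<sqsubseteq> s"
  then obtain k where k: "b \<sqsubseteq> d k" using assms(2) unfolding way_below_def by auto
  have "d k \<in> carrier S" using d unfolding incr_seq_def by auto
  then have "a \<sqsubseteq> d k" using le_trans[OF _ _ _ assms(1) k] assms way_below_closed by auto
  then show "\<exists>k. a \<sqsubseteq> d k" by blast
qed

lemma zero_way_below: "a \<in> carrier S \<Longrightarrow> \<zero> \<lless> a"
  unfolding way_below_def incr_seq_def using zero_le zero_closed by blast

lemma incr_seq_way_below: "(\<And>n. c n \<lless> c (Suc n)) \<Longrightarrow> incr_seq S c"
  unfolding incr_seq_def using way_below_le way_below_closed by blast

lemma way_below_seq: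
  assumes "a \<lless> b" "incr_seq S c" "is_sup S (range c) b"
  shows "\<exists>k. a \<sqsubseteq> c k"
  using assms le_refl[of b] unfolding way_below_def by blast

end

context cu_semigroup
begin

lemma is_sup_csup: "incr_seq S c \<Longrightarrow> is_sup S (range c) (csup S (range c))"
  using O1 csup_eq by metis

lemma O2_seq:
  assumes "a \<in> carrier S"
  obtains c where "\<And>n. c n \<lless> c (Suc n)" "\<And>n. c n \<lless> a" "incr_seq S c" "is_sup S (range c) a"
proof -
  from O2[OF assms] obtain c where c: "\<And>n. c n \<lless> c (Suc n)" "is_sup S (range c) a" by blast
  have "c n \<lless> a" for n
    using way_below_le_trans[OF c(1)[of n], of a] c(2) assms unfolding is_sup_def by blast
  then show ?thesis using that c incr_seq_way_below by blast
qed

lemma way_below_directed: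
  assumes "x \<lless> a" "y \<lless> a"
  shows "\<exists>z. z \<lless> a \<and> x \<sqsubseteq> z \<and> y \<sqsubseteq> z"
proof -
  obtain c where c: "\<And>n. c n \<lless> c (Suc n)" "\<And>n. c n \<lless> a" "incr_seq S c" "is_sup S (range c) a"
    by (rule O2_seq[OF way_below_closed(2)[OF assms(1)]]) (rule that)
  obtain i j where "x \<sqsubseteq> c i" "y \<sqsubseteq> c j"
    using way_below_seq[OF assms(1) c(3,4)] way_below_seq[OF assms(2) c(3,4)] by blast
  moreover have "c i \<sqsubseteq> c (max i j)" "c j \<sqsubseteq> c (max i j)"
    using incr_seq_le[OF c(3)] by auto
  ultimately have "x \<sqsubseteq> c (max i j)" "y \<sqsubseteq> c (max i j)"
    using le_trans[of x "c i"] le_trans[of y "c j"] way_below_closed(1)[OF assms(1)]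
      way_below_closed(1)[OF assms(2)] way_below_closed(1)[OF c(2)] by auto
  then show ?thesis using c(2) by blast
qed

lemma way_below_add_split:
  assumes "x \<lless> a \<oplus> b" "a \<in> carrier S" "b \<in> carrier S"
  shows "\<exists>a' b'. a' \<lless> a \<and> b' \<lless> b \<and> x \<sqsubseteq> a' \<oplus> b'"
proof -
  obtain c where c: "\<And>n. c n \<lless> c (Suc n)" "\<And>n. c n \<lless> a" "incr_seq S c"
    "is_sup S (range c) a" by (rule O2_seq[OF assms(2)]) (rule that)
  obtain d where d: "\<And>n. d n \<lless> d (Suc n)" "\<And>n. d n \<lless> b" "incr_seq S d"
    "is_sup S (range d) b" by (rule O2_seq[OF assms(3)]) (rule that)
  have i: "incr_seq S (\<lambda>n. c n \<oplus> d n)"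
    using c(3) d(3) unfolding incr_seq_def by (simp add: add_mono2 add_closed)
  have "csup S (range (\<lambda>n. c n \<oplus> d n)) = a \<oplus> b"
    using O4[OF c(3) d(3)] csup_eq[OF c(4)] csup_eq[OF d(4)] by simp
  then have "is_sup S (range (\<lambda>n. c n \<oplus> d n)) (a \<oplus> b)" using is_sup_csup[OF i] by simp
  from way_below_seq[OF assms(1) i this] show ?thesis using c(2) d(2) by blast
qed

end

lemma formal_sums_simps:
  "[] \<in> formal_sums S T" "x @ y \<in> formal_sums S T \<longleftrightarrow> x \<in> formal_sums S T \<and> y \<in> formal_sums S T"
  "p # x \<in> formal_sums S T \<longleftrightarrow> fst p \<in> carrier S \<and> snd p \<in> carrier T \<and> x \<in> formal_sums S T"
  unfolding formal_sums_def by (auto simp: mem_Times_iff)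

locale cu_pair = S: cu_semigroup S + T: cu_semigroup T
  for S :: "('a, 'm) cu_sg_scheme" and T :: "('b, 'n) cu_sg_scheme"
begin

lemma tle_closed:
  "tensor_le S T x y \<Longrightarrow> x \<in> formal_sums S T \<and> y \<in> formal_sums S T"
  by (induction rule: tensor_le.induct)
    (auto simp: formal_sums_simps S.add_closed T.add_closed S.zero_closed T.zero_closed)

lemma tw_closed:
  "termwise_below S T x y \<Longrightarrow> x \<in> formal_sums S T \<and> y \<in> formal_sums S T"
  unfolding termwise_below_def
  by (induction rule: list_all2_induct)
    (auto simp: formal_sums_simps S.way_below_closed T.way_below_closed)

lemma tw_simps:
  "termwise_below S T [] y \<longleftrightarrow> y = []" "termwise_below S T x [] \<longleftrightarrow> x = []"
  "termwise_below S T (p # x) (q # y) \<longleftrightarrow>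
     fst p \<lless>\<^bsub>S\<^esub> fst q \<and> snd p \<lless>\<^bsub>T\<^esub> snd q \<and> termwise_below S T x y"
  unfolding termwise_below_def by auto

lemma tw_append:
  "\<lbrakk>termwise_below S T x y; termwise_below S T x' y'\<rbrakk> \<Longrightarrow> termwise_below S T (x @ x') (y @ y')"
  unfolding termwise_below_def by (rule list_all2_appendI)

lemma tw_append_split:
  "termwise_below S T z (x @ y) \<Longrightarrow>
     \<exists>x' y'. z = x' @ y' \<and> termwise_below S T x' x \<and> termwise_below S T y' y"
  unfolding termwise_below_def by (auto simp: list_all2_append2)

lemma tw_le: "termwise_below S T x y \<Longrightarrow> tensor_le S T x y"
  unfolding termwise_below_def
proof (induction rule: list_all2_induct)
  case Nil then show ?case by (auto intro: tensor_le.refl simp: formal_sums_simps)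
next
  case (Cons p x q y)
  then have "tensor_le S T [(fst p, snd p)] [(fst q, snd q)]"
    by (intro tensor_le.mono)
      (auto intro: S.way_below_le T.way_below_le S.way_below_closed T.way_below_closed)
  then have "tensor_le S T ([p] @ x) ([q] @ y)" using Cons by (intro tensor_le.append) auto
  then show ?case by simp
qed

lemma nil_le: "x \<in> formal_sums S T \<Longrightarrow> tensor_le S T [] x"
proof (induction x)
  case Nil then show ?case by (auto intro: tensor_le.refl)
next
  case (Cons p x)
  then have p: "fst p \<in> carrier S" "snd p \<in> carrier T" by (auto simp: formal_sums_simps)
  then have "tensor_le S T [(\<zero>\<^bsub>S\<^esub>, snd p)] [(fst p, snd p)]"
    by (intro tensor_le.mono) (auto simp: S.zero_closed S.zero_le T.le_refl)
  with tensor_le.zerol2[OF p(2)] have "tensor_le S T [] [p]" by (auto intro: tensor_le.trans)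
  then have "tensor_le S T ([] @ []) ([p] @ x)"
    using Cons by (intro tensor_le.append) (auto simp: formal_sums_simps)
  then show ?case by simp
qed

lemma tw_single: "termwise_below S T z [(a, b)] \<longleftrightarrow> (\<exists>c d. z = [(c, d)] \<and> c \<lless>\<^bsub>S\<^esub> a \<and> d \<lless>\<^bsub>T\<^esub> b)"
  by (cases z) (auto simp: tw_simps)

lemma tw_double: "termwise_below S T z [(a, b), (a', b')] \<longleftrightarrow>
   (\<exists>c d c' d'. z = [(c, d), (c', d')] \<and> c \<lless>\<^bsub>S\<^esub> a \<and> d \<lless>\<^bsub>T\<^esub> b \<and> c' \<lless>\<^bsub>S\<^esub> a' \<and> d' \<lless>\<^bsub>T\<^esub> b')"
  by (auto simp: termwise_below_def list_all2_Cons2)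

lemma tw_push:
  "tensor_le S T y z \<Longrightarrow> termwise_below S T x y \<Longrightarrow>
     \<exists>w. tensor_le S T x w \<and> termwise_below S T w z"
proof (induction arbitrary: x rule: tensor_le.induct)
  case (refl x) then show ?case using tw_closed tensor_le.refl by blast
next
  case (trans x y z) then show ?case by (meson tensor_le.trans)
next
  case (append x y x' y')
  from tw_append_split[OF append.prems] append.IH show ?case
    by (metis tensor_le.append tw_append)
next
  case (swap x y)
  then show ?case by (metis tw_append_split tw_append tensor_le.swap tw_closed)
next
  case (mono a a' b b')
  then obtain c d where x: "x = [(c, d)]" "c \<lless>\<^bsub>S\<^esub> a" "d \<lless>\<^bsub>T\<^esub> b" by (auto simp: tw_single)
  then have "termwise_below S T x [(a', b')]"
    using mono S.way_below_le_trans[OF x(2)] T.way_below_le_trans[OF x(3)] by (simp add: tw_single)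
  then show ?case using tw_closed tensor_le.refl by blast
next
  case (addl1 a a' b)
  then obtain c d where x: "x = [(c, d)]" "c \<lless>\<^bsub>S\<^esub> a \<oplus>\<^bsub>S\<^esub> a'" "d \<lless>\<^bsub>T\<^esub> b" by (auto simp: tw_single)
  obtain e e' where e: "e \<lless>\<^bsub>S\<^esub> a" "e' \<lless>\<^bsub>S\<^esub> a'" "c \<sqsubseteq>\<^bsub>S\<^esub> e \<oplus>\<^bsub>S\<^esub> e'"
    using S.way_below_add_split x addl1 by blast
  note cl = S.way_below_closed[OF x(2)] S.way_below_closed[OF e(1)] S.way_below_closed[OF e(2)]
    T.way_below_closed[OF x(3)]
  have "tensor_le S T x [(e \<oplus>\<^bsub>S\<^esub> e', d)]"
    unfolding x using cl e by (intro tensor_le.mono) (auto simp: S.add_closed T.le_refl)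
  then have "tensor_le S T x [(e, d), (e', d)]" using cl by (blast intro: tensor_le.trans tensor_le.addl1)
  then show ?case using e x by (auto simp: tw_double)
next
  case (addr1 a b b')
  then obtain c d where x: "x = [(c, d)]" "c \<lless>\<^bsub>S\<^esub> a" "d \<lless>\<^bsub>T\<^esub> b \<oplus>\<^bsub>T\<^esub> b'" by (auto simp: tw_single)
  obtain e e' where e: "e \<lless>\<^bsub>T\<^esub> b" "e' \<lless>\<^bsub>T\<^esub> b'" "d \<sqsubseteq>\<^bsub>T\<^esub> e \<oplus>\<^bsub>T\<^esub> e'"
    using T.way_below_add_split x addr1 by blast
  note cl = T.way_below_closed[OF x(3)] T.way_below_closed[OF e(1)] T.way_below_closed[OF e(2)]
    S.way_below_closed[OF x(2)]
  have "tensor_le S T x [(c, e \<oplus>\<^bsub>T\<^esub> e')]"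
    unfolding x using cl e by (intro tensor_le.mono) (auto simp: T.add_closed S.le_refl)
  then have "tensor_le S T x [(c, e), (c, e')]" using cl by (blast intro: tensor_le.trans tensor_le.addr1)
  then show ?case using e x by (auto simp: tw_double)
next
  case (addl2 a a' b)
  then obtain c d c' d' where x: "x = [(c, d), (c', d')]" "c \<lless>\<^bsub>S\<^esub> a" "d \<lless>\<^bsub>T\<^esub> b" "c' \<lless>\<^bsub>S\<^esub> a'" "d' \<lless>\<^bsub>T\<^esub> b"
    by (auto simp: tw_double)
  obtain e where e: "e \<lless>\<^bsub>T\<^esub> b" "d \<sqsubseteq>\<^bsub>T\<^esub> e" "d' \<sqsubseteq>\<^bsub>T\<^esub> e" using T.way_below_directed x by blast
  note cl = S.way_below_closed[OF x(2)] S.way_below_closed[OF x(4)] T.way_below_closed[OF x(3)]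
    T.way_below_closed[OF x(5)] T.way_below_closed[OF e(1)]
  have "tensor_le S T [(c, d)] [(c, e)]" "tensor_le S T [(c', d')] [(c', e)]"
    using cl e by (auto intro!: tensor_le.mono simp: S.le_refl)
  from tensor_le.append[OF this] have "tensor_le S T x [(c, e), (c', e)]" by (simp add: x)
  then have "tensor_le S T x [(c \<oplus>\<^bsub>S\<^esub> c', e)]" using cl by (blast intro: tensor_le.trans tensor_le.addl2)
  then show ?case using e x S.O3 by (auto simp: tw_single)
next
  case (addr2 a b b')
  then obtain c d c' d' where x: "x = [(c, d), (c', d')]" "c \<lless>\<^bsub>S\<^esub> a" "d \<lless>\<^bsub>T\<^esub> b" "c' \<lless>\<^bsub>S\<^esub> a" "d' \<lless>\<^bsub>T\<^esub> b'"
    by (auto simp: tw_double)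
  obtain e where e: "e \<lless>\<^bsub>S\<^esub> a" "c \<sqsubseteq>\<^bsub>S\<^esub> e" "c' \<sqsubseteq>\<^bsub>S\<^esub> e" using S.way_below_directed x by blast
  note cl = S.way_below_closed[OF x(2)] S.way_below_closed[OF x(4)] T.way_below_closed[OF x(3)]
    T.way_below_closed[OF x(5)] S.way_below_closed[OF e(1)]
  have "tensor_le S T [(c, d)] [(e, d)]" "tensor_le S T [(c', d')] [(e, d')]"
    using cl e by (auto intro!: tensor_le.mono simp: T.le_refl)
  from tensor_le.append[OF this] have "tensor_le S T x [(e, d), (e, d')]" by (simp add: x)
  then have "tensor_le S T x [(e, d \<oplus>\<^bsub>T\<^esub> d')]" using cl by (blast intro: tensor_le.trans tensor_le.addr2)
  then show ?case using e x T.O3 by (auto simp: tw_single)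
next
  case (zerol1 b)
  then obtain c d where x: "x = [(c, d)]" "c \<lless>\<^bsub>S\<^esub> \<zero>\<^bsub>S\<^esub>" "d \<lless>\<^bsub>T\<^esub> b" by (auto simp: tw_single)
  then have "c = \<zero>\<^bsub>S\<^esub>" using S.way_below_le S.zero_le S.le_antisym S.way_below_closed by blast
  then have "tensor_le S T x []" using tensor_le.zerol1[OF T.way_below_closed(1)[OF x(3)]] x by simp
  then show ?case by (auto simp: tw_simps)
next
  case (zeror1 a)
  then obtain c d where x: "x = [(c, d)]" "c \<lless>\<^bsub>S\<^esub> a" "d \<lless>\<^bsub>T\<^esub> \<zero>\<^bsub>T\<^esub>" by (auto simp: tw_single)
  then have "d = \<zero>\<^bsub>T\<^esub>" using T.way_below_le T.zero_le T.le_antisym T.way_below_closed by blast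
  then have "tensor_le S T x []" using tensor_le.zeror1[OF S.way_below_closed(1)[OF x(2)]] x by simp
  then show ?case by (auto simp: tw_simps)
next
  case (zerol2 b)
  then have "termwise_below S T [(\<zero>\<^bsub>S\<^esub>, \<zero>\<^bsub>T\<^esub>)] [(\<zero>\<^bsub>S\<^esub>, b)]"
    by (auto simp: tw_simps S.zero_way_below T.zero_way_below S.zero_closed)
  moreover have "x = []" using zerol2.prems by (simp add: tw_simps)
  ultimately show ?case using tw_closed nil_le by blast
next
  case (zeror2 a)
  then have "termwise_below S T [(\<zero>\<^bsub>S\<^esub>, \<zero>\<^bsub>T\<^esub>)] [(a, \<zero>\<^bsub>T\<^esub>)]"
    by (auto simp: tw_simps S.zero_way_below T.zero_way_below T.zero_closed)
  moreover have "x = []" using zeror2.prems by (simp add: tw_simps)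
  ultimately show ?case using tw_closed nil_le by blast
qed

end

context cu_pair
begin

lemma below_iff: "tensor_below S T x y \<longleftrightarrow> (\<exists>w. tensor_le S T x w \<and> termwise_below S T w y)"
proof
  assume "tensor_below S T x y"
  then obtain x' y' where *: "tensor_le S T x x'" "termwise_below S T x' y'" "tensor_le S T y' y"
    unfolding tensor_below_def by blast
  from tw_push[OF *(3,2)] obtain w where "tensor_le S T x' w" "termwise_below S T w y" by blast
  then show "\<exists>w. tensor_le S T x w \<and> termwise_below S T w y"
    using tensor_le.trans[OF *(1)] by blast
next
  assume "\<exists>w. tensor_le S T x w \<and> termwise_below S T w y"
  then obtain w where w: "tensor_le S T x w" "termwise_below S T w y" by blast
  then have "tensor_le S T y y" using tw_closed tensor_le.refl by blast
  with w show "tensor_below S T x y" unfolding tensor_below_def by blast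
qed

lemma below_closed: "tensor_below S T x y \<Longrightarrow> x \<in> formal_sums S T \<and> y \<in> formal_sums S T"
  unfolding tensor_below_def using tle_closed by blast

lemma le_below_trans: "\<lbrakk>tensor_le S T x y; tensor_below S T y z\<rbrakk> \<Longrightarrow> tensor_below S T x z"
  unfolding below_iff using tensor_le.trans[of S T x y] by blast

lemma below_le_trans: "\<lbrakk>tensor_below S T x y; tensor_le S T y z\<rbrakk> \<Longrightarrow> tensor_below S T x z"
  unfolding tensor_below_def using tensor_le.trans[of S T _ y z] by blast

lemma below_le: "tensor_below S T x y \<Longrightarrow> tensor_le S T x y"
  unfolding below_iff using tensor_le.trans[of S T x _ y] tw_le by blast

lemma below_trans: "\<lbrakk>tensor_below S T x y; tensor_below S T y z\<rbrakk> \<Longrightarrow> tensor_below S T x z"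
  using below_le le_below_trans by blast

lemma tw_below: "termwise_below S T x y \<Longrightarrow> tensor_below S T x y"
  unfolding below_iff using tw_closed tensor_le.refl by blast

lemma below_append:
  assumes "tensor_below S T x y" "tensor_below S T x' y'"
  shows "tensor_below S T (x @ x') (y @ y')"
proof -
  obtain w where w: "tensor_le S T x w" "termwise_below S T w y" using assms(1) below_iff by blast
  obtain w' where w': "tensor_le S T x' w'" "termwise_below S T w' y'" using assms(2) below_iff by blast
  from tensor_le.append[OF w(1) w'(1)] tw_append[OF w(2) w'(2)] show ?thesis using below_iff by blast
qed

lemma below_append_split:
  assumes "tensor_below S T z (x @ y)"
  shows "\<exists>x' y'. tensor_below S T x' x \<and> tensor_below S T y' y \<and> tensor_le S T z (x' @ y')"
proof -
  obtain w where w: "tensor_le S T z w" "termwise_below S T w (x @ y)" using assms below_iff by blast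
  from tw_append_split[OF w(2)] obtain x' y' where
    "w = x' @ y'" "termwise_below S T x' x" "termwise_below S T y' y" by blast
  then show ?thesis using w(1) tw_below by blast
qed

end

context cu_semigroup
begin

definition approx_seq :: "'a \<Rightarrow> nat \<Rightarrow> 'a" where
  "approx_seq a = (SOME c. (\<forall>n. c n \<lless> c (Suc n)) \<and> (\<forall>n. c n \<lless> a) \<and> incr_seq S c \<and> is_sup S (range c) a)"

lemma approx_seq:
  assumes "a \<in> carrier S"
  shows "approx_seq a n \<lless> approx_seq a (Suc n)" "approx_seq a n \<lless> a"
    "incr_seq S (approx_seq a)" "is_sup S (range (approx_seq a)) a"
proof -
  have "\<exists>c. (\<forall>n. c n \<lless> c (Suc n)) \<and> (\<forall>n. c n \<lless> a) \<and> incr_seq S c \<and> is_sup S (range c) a"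
  proof (rule O2_seq[OF assms])
    fix c assume "\<And>n. c n \<lless> c (Suc n)" "\<And>n. c n \<lless> a" "incr_seq S c" "is_sup S (range c) a"
    then show ?thesis by (intro exI[of _ c] conjI allI)
  qed
  from someI_ex[OF this]
  have *: "(\<forall>n. approx_seq a n \<lless> approx_seq a (Suc n)) \<and> (\<forall>n. approx_seq a n \<lless> a) \<and>
    incr_seq S (approx_seq a) \<and> is_sup S (range (approx_seq a)) a"
    unfolding approx_seq_def .
  show "approx_seq a n \<lless> approx_seq a (Suc n)" using conjunct1[OF *] by (rule spec)
  show "approx_seq a n \<lless> a" using conjunct1[OF conjunct2[OF *]] by (rule spec)
  show "incr_seq S (approx_seq a)" "is_sup S (range (approx_seq a)) a"
    using conjunct2[OF conjunct2[OF *]] by (rule conjunct1, rule conjunct2)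
qed

end

context cu_pair
begin

definition approx :: "('a \<times> 'b) list \<Rightarrow> nat \<Rightarrow> ('a \<times> 'b) list" where
  "approx x n = map (\<lambda>p. (S.approx_seq (fst p) n, T.approx_seq (snd p) n)) x"

lemma approx_simps: "approx [] n = []"
  "approx (p # x) n = (S.approx_seq (fst p) n, T.approx_seq (snd p) n) # approx x n"
  unfolding approx_def by auto

lemma approx_tw:
  assumes "x \<in> formal_sums S T"
  shows "termwise_below S T (approx x n) (approx x (Suc n))" "termwise_below S T (approx x n) x"
  using assms by (induction x)
    (auto simp: approx_simps tw_simps formal_sums_simps S.approx_seq T.approx_seq)

lemma approx_closed: "x \<in> formal_sums S T \<Longrightarrow> approx x n \<in> formal_sums S T"
  using approx_tw(2) tw_closed by blast

lemma approx_mono: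
  assumes "x \<in> formal_sums S T" "m \<le> n"
  shows "tensor_le S T (approx x m) (approx x n)"
  using assms(2)
proof (induction n rule: dec_induct)
  case base show ?case using assms(1) approx_closed tensor_le.refl by blast
next
  case (step n) then show ?case using tensor_le.trans[OF step.IH] tw_le approx_tw(1)[OF assms(1)] by blast
qed

lemma approx_cofinal:
  "termwise_below S T w x \<Longrightarrow> \<exists>n. tensor_le S T w (approx x n)"
  unfolding termwise_below_def
proof (induction rule: list_all2_induct)
  case Nil then show ?case by (auto simp: approx_simps formal_sums_simps intro: tensor_le.refl)
next
  case (Cons p w q x)
  then have tw: "termwise_below S T w x" unfolding termwise_below_def by simp
  have cl: "fst p \<in> carrier S" "fst q \<in> carrier S" "snd p \<in> carrier T" "snd q \<in> carrier T"
    using Cons S.way_below_closed T.way_below_closed by blast+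
  have qc: "q # x \<in> formal_sums S T" using tw_closed[OF tw] cl by (simp add: formal_sums_simps)
  note A = S.approx_seq[OF cl(2)] note B = T.approx_seq[OF cl(4)]
  obtain i where i: "tensor_le S T w (approx x i)" using Cons by blast
  obtain j where j: "fst p \<sqsubseteq>\<^bsub>S\<^esub> S.approx_seq (fst q) j"
    using S.way_below_seq[OF _ A(3,4)] Cons by blast
  obtain k where k: "snd p \<sqsubseteq>\<^bsub>T\<^esub> T.approx_seq (snd q) k"
    using T.way_below_seq[OF _ B(3,4)] Cons by blast
  define n where "n = max i (max j k)"
  have Ac: "\<And>n. S.approx_seq (fst q) n \<in> carrier S" using A(2) S.way_below_closed by blast
  have Bc: "\<And>n. T.approx_seq (snd q) n \<in> carrier T" using B(2) T.way_below_closed by blast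
  have "fst p \<sqsubseteq>\<^bsub>S\<^esub> S.approx_seq (fst q) n"
    using S.le_trans[OF cl(1) Ac Ac j] S.incr_seq_le[OF A(3), of j n] by (simp add: n_def)
  moreover have "snd p \<sqsubseteq>\<^bsub>T\<^esub> T.approx_seq (snd q) n"
    using T.le_trans[OF cl(3) Bc Bc k] T.incr_seq_le[OF B(3), of k n] by (simp add: n_def)
  ultimately have "tensor_le S T [(fst p, snd p)] [(S.approx_seq (fst q) n, T.approx_seq (snd q) n)]"
    using cl Ac Bc by (intro tensor_le.mono) auto
  moreover have "tensor_le S T w (approx x n)"
    using tensor_le.trans[OF i] approx_mono[of x i n] qc by (simp add: n_def formal_sums_simps)
  ultimately have "tensor_le S T ([p] @ w) ([(S.approx_seq (fst q) n, T.approx_seq (snd q) n)] @ approx x n)"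
    using tensor_le.append by fastforce
  then show ?case by (auto simp: approx_simps)
qed

lemma below_approx:
  assumes "tensor_below S T x y" shows "\<exists>n. tensor_below S T x (approx y n)"
proof -
  from assms obtain w where w: "tensor_le S T x w" "termwise_below S T w y" using below_iff by blast
  from approx_cofinal[OF w(2)] obtain n where "tensor_le S T w (approx y n)" by blast
  moreover have "tensor_below S T (approx y n) (approx y (Suc n))"
    using approx_tw(1) tw_below below_closed[OF assms] by blast
  ultimately show ?thesis using w(1) le_below_trans by blast
qed

definition down :: "('a \<times> 'b) list \<Rightarrow> ('a \<times> 'b) list set" where
  "down x = {y. tensor_below S T y x}"

definition gen :: "(nat \<Rightarrow> ('a \<times> 'b) list) \<Rightarrow> ('a \<times> 'b) list set" where
  "gen x = {y. \<exists>n. tensor_below S T y (x n)}"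

abbreviation below_seq :: "(nat \<Rightarrow> ('a \<times> 'b) list) \<Rightarrow> bool" where
  "below_seq x \<equiv> \<forall>n. tensor_below S T (x n) (x (Suc n))"

abbreviation ST :: "('a \<times> 'b) list set cu_sg" where "ST \<equiv> tensor S T"

lemma tensor_simps:
  "I \<in> carrier ST \<longleftrightarrow> (\<exists>x. below_seq x \<and> I = gen x)"
  "I \<oplus>\<^bsub>ST\<^esub> J = {z. \<exists>x\<in>I. \<exists>y\<in>J. tensor_le S T z (x @ y)}"
  "\<zero>\<^bsub>ST\<^esub> = {z. tensor_le S T z []}"
  "I \<sqsubseteq>\<^bsub>ST\<^esub> J \<longleftrightarrow> I \<subseteq> J"
  unfolding tensor_def gen_def by auto

lemma below_seq_le: assumes "below_seq x" "m \<le> n" shows "tensor_le S T (x m) (x n)"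
  using assms(2)
proof (induction n rule: dec_induct)
  case base show ?case using assms(1) below_closed tensor_le.refl by blast
next
  case (step n) then show ?case using tensor_le.trans[OF step.IH] below_le assms(1) by blast
qed

lemma below_seq_closed: "below_seq x \<Longrightarrow> x n \<in> formal_sums S T"
  using below_closed by blast

lemma below_seq_le_below:
  "\<lbrakk>below_seq x; m \<le> n; tensor_below S T y (x m)\<rbrakk> \<Longrightarrow> tensor_below S T y (x n)"
  using below_seq_le below_le_trans by blast

lemma ideal_closed: "\<lbrakk>I \<in> carrier ST; y \<in> I\<rbrakk> \<Longrightarrow> y \<in> formal_sums S T"
  unfolding tensor_simps gen_def using below_closed by blast

lemma ideal_down: "\<lbrakk>I \<in> carrier ST; y \<in> I; tensor_le S T z y\<rbrakk> \<Longrightarrow> z \<in> I"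
  unfolding tensor_simps gen_def using le_below_trans by blast

lemma seq_in_gen: "below_seq x \<Longrightarrow> x n \<in> gen x"
  unfolding gen_def by blast

lemma ideal_nonempty: "I \<in> carrier ST \<Longrightarrow> \<exists>y. y \<in> I"
  unfolding tensor_simps using seq_in_gen by blast

lemma ideal_directed:
  assumes "I \<in> carrier ST" "y \<in> I" "z \<in> I"
  shows "\<exists>w\<in>I. tensor_below S T y w \<and> tensor_below S T z w"
proof -
  obtain x where x: "below_seq x" "I = gen x" using assms(1) tensor_simps(1) by blast
  obtain i j where "tensor_below S T y (x i)" "tensor_below S T z (x j)"
    using assms(2,3) unfolding x(2) gen_def by blast
  then have "tensor_below S T y (x (max i j))" "tensor_below S T z (x (max i j))"
    using below_seq_le_below[OF x(1)] max.cobounded1 max.cobounded2 by blast+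
  then show ?thesis using seq_in_gen[OF x(1)] x(2) by blast
qed

lemma nil_in_ideal: "I \<in> carrier ST \<Longrightarrow> [] \<in> I"
  using ideal_nonempty ideal_closed ideal_down nil_le by blast

lemma ideal_cofinal:
  assumes "I \<in> carrier ST"
  shows "\<exists>d::nat \<Rightarrow> _. (\<forall>n. d n \<in> I) \<and> (\<forall>y\<in>I. \<exists>n. tensor_le S T y (d n))"
proof -
  obtain x where x: "below_seq x" "I = gen x" using assms(1) tensor_simps(1) by blast
  then have "(\<forall>n. x n \<in> I) \<and> (\<forall>y\<in>I. \<exists>n. tensor_le S T y (x n))"
    using seq_in_gen below_le unfolding gen_def by blast
  then show ?thesis by blast
qed

lemma ideal_intro:
  assumes dir: "\<And>y z. y \<in> I \<Longrightarrow> z \<in> I \<Longrightarrow> \<exists>w\<in>I. tensor_below S T y w \<and> tensor_below S T z w"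
    and dn: "\<And>y z. y \<in> I \<Longrightarrow> tensor_le S T z y \<Longrightarrow> z \<in> I"
    and d: "\<And>n::nat. d n \<in> I" "\<And>y. y \<in> I \<Longrightarrow> \<exists>n. tensor_le S T y (d n)"
  shows "I \<in> carrier ST"
proof -
  obtain h where h: "\<And>y z. y \<in> I \<Longrightarrow> z \<in> I \<Longrightarrow>
      h y z \<in> I \<and> tensor_below S T y (h y z) \<and> tensor_below S T z (h y z)"
    using dir by metis
  define x where "x = rec_nat (d 0) (\<lambda>n y. h y (d n))"
  have xS: "x (Suc n) = h (x n) (d n)" for n unfolding x_def by simp
  have xI: "x n \<in> I" for n by (induction n) (use xS h d(1) in \<open>auto simp: x_def\<close>)
  have b: "below_seq x" using h[OF xI d(1)] xS by simp
  have "I = gen x"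
  proof
    show "I \<subseteq> gen x"
    proof
      fix y assume "y \<in> I"
      then obtain n where "tensor_le S T y (d n)" using d(2) by blast
      moreover have "tensor_below S T (d n) (x (Suc n))" using h[OF xI d(1)] xS by simp
      ultimately show "y \<in> gen x" unfolding gen_def using le_below_trans by blast
    qed
    show "gen x \<subseteq> I" unfolding gen_def using xI dn below_le by blast
  qed
  then show ?thesis using b tensor_simps(1) by blast
qed

lemma down_eq_gen: "x \<in> formal_sums S T \<Longrightarrow> down x = gen (approx x)"
  unfolding down_def gen_def using below_approx below_trans tw_below approx_tw(2) by blast

lemma approx_below_seq: "x \<in> formal_sums S T \<Longrightarrow> below_seq (approx x)"
  using approx_tw tw_below by blast

lemma down_closed: "x \<in> formal_sums S T \<Longrightarrow> down x \<in> carrier ST"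
  using down_eq_gen approx_below_seq tensor_simps(1) by blast

lemma down_mono: "tensor_le S T x y \<Longrightarrow> down x \<subseteq> down y"
  unfolding down_def using below_le_trans by blast

lemma down_append: "down (x @ y) = down x \<oplus>\<^bsub>ST\<^esub> down y"
proof
  show "down (x @ y) \<subseteq> down x \<oplus>\<^bsub>ST\<^esub> down y"
    unfolding down_def tensor_simps using below_append_split by blast
  show "down x \<oplus>\<^bsub>ST\<^esub> down y \<subseteq> down (x @ y)"
    unfolding down_def tensor_simps using below_append le_below_trans by blast
qed

lemma down_nil: "down [] = \<zero>\<^bsub>ST\<^esub>"
  unfolding down_def tensor_simps below_iff by (simp add: tw_simps)

lemma gen_append:
  assumes "below_seq x" "below_seq y"
  shows "below_seq (\<lambda>n. x n @ y n)" "gen x \<oplus>\<^bsub>ST\<^esub> gen y = gen (\<lambda>n. x n @ y n)"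
proof -
  show b: "below_seq (\<lambda>n. x n @ y n)" using assms below_append by blast
  show "gen x \<oplus>\<^bsub>ST\<^esub> gen y = gen (\<lambda>n. x n @ y n)"
  proof
    show "gen (\<lambda>n. x n @ y n) \<subseteq> gen x \<oplus>\<^bsub>ST\<^esub> gen y"
      unfolding tensor_simps using seq_in_gen[OF assms(1)] seq_in_gen[OF assms(2)] below_le
      unfolding gen_def by blast
    show "gen x \<oplus>\<^bsub>ST\<^esub> gen y \<subseteq> gen (\<lambda>n. x n @ y n)"
    proof
      fix z assume "z \<in> gen x \<oplus>\<^bsub>ST\<^esub> gen y"
      then obtain u v i j where *: "tensor_le S T z (u @ v)" "tensor_below S T u (x i)"
        "tensor_below S T v (y j)" unfolding tensor_simps gen_def by blast
      have "tensor_below S T u (x (max i j))" "tensor_below S T v (y (max i j))"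
        using below_seq_le_below[OF assms(1) _ *(2)] below_seq_le_below[OF assms(2) _ *(3)] by auto
      then have "tensor_below S T z (x (max i j) @ y (max i j))"
        using below_append *(1) le_below_trans by blast
      then show "z \<in> gen (\<lambda>n. x n @ y n)" unfolding gen_def by blast
    qed
  qed
qed

lemma tensor_add_closed:
  assumes "I \<in> carrier ST" "J \<in> carrier ST" shows "I \<oplus>\<^bsub>ST\<^esub> J \<in> carrier ST"
proof -
  obtain x where x: "below_seq x" "I = gen x" using assms(1) tensor_simps(1) by blast
  obtain y where y: "below_seq y" "J = gen y" using assms(2) tensor_simps(1) by blast
  show ?thesis unfolding tensor_simps(1) x(2) y(2)
    by (rule exI[of _ "\<lambda>n. x n @ y n"]) (simp add: gen_append[OF x(1) y(1)])
qed

lemma incr_seq_ST: "incr_seq ST c \<longleftrightarrow> (\<forall>n. c n \<in> carrier ST) \<and> (\<forall>m n. m \<le> n \<longrightarrow> c m \<subseteq> c n)"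
  unfolding incr_seq_def tensor_simps(4)
proof (intro iffI conjI allI impI; (elim conjE)?)
  fix m n :: nat assume *: "\<forall>n. c n \<subseteq> c (Suc n)" "m \<le> n"
  from lift_Suc_mono_le[of c, OF spec[OF *(1)] *(2)] show "c m \<subseteq> c n" .
next
  fix n assume "\<forall>m n. m \<le> n \<longrightarrow> c m \<subseteq> c n"
  then show "c n \<subseteq> c (Suc n)" by simp
qed auto

lemma tensor_union:
  assumes c: "incr_seq ST c"
  shows "(\<Union>n. c n) \<in> carrier ST"
proof -
  have cc: "\<And>n. c n \<in> carrier ST" and cm: "\<And>m n. m \<le> n \<Longrightarrow> c m \<subseteq> c n"
    using c incr_seq_ST by auto
  obtain d where d: "\<And>n m::nat. d n m \<in> c n" "\<And>n y. y \<in> c n \<Longrightarrow> \<exists>m. tensor_le S T y (d n m)"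
    using ideal_cofinal[OF cc] by metis
  show ?thesis
  proof (rule ideal_intro[where d = "\<lambda>k. d (fst (prod_decode k)) (snd (prod_decode k))"])
    fix y z assume "y \<in> (\<Union>n. c n)" "z \<in> (\<Union>n. c n)"
    then obtain i j where "y \<in> c i" "z \<in> c j" by blast
    then have "y \<in> c (max i j)" "z \<in> c (max i j)" using cm[of i "max i j"] cm[of j "max i j"] by auto
    from ideal_directed[OF cc this] show "\<exists>w\<in>\<Union>n. c n. tensor_below S T y w \<and> tensor_below S T z w"
      by blast
  next
    fix y z assume "y \<in> (\<Union>n. c n)" "tensor_le S T z y"
    then show "z \<in> (\<Union>n. c n)" using ideal_down[OF cc] by blast
  next
    fix n show "d (fst (prod_decode n)) (snd (prod_decode n)) \<in> (\<Union>n. c n)" using d(1) by blast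
  next
    fix y assume "y \<in> (\<Union>n. c n)"
    then obtain n m where "tensor_le S T y (d n m)" using d(2) by blast
    then have "tensor_le S T y (d (fst (prod_decode (prod_encode (n, m)))) (snd (prod_decode (prod_encode (n, m)))))"
      by simp
    then show "\<exists>k. tensor_le S T y (d (fst (prod_decode k)) (snd (prod_decode k)))" by blast
  qed
qed

lemma tensor_sup: "incr_seq ST c \<Longrightarrow> is_sup ST (range c) (\<Union>n. c n)"
  unfolding is_sup_def using tensor_union by (auto simp: tensor_simps(4))

lemma tensor_sup_eq:
  assumes "incr_seq ST c" "is_sup ST (range c) s" shows "s = (\<Union>n. c n)"
  using tensor_sup[OF assms(1)] assms(2) unfolding is_sup_def by (simp add: tensor_simps(4)) blast

lemma tensor_csup: "incr_seq ST c \<Longrightarrow> csup ST (range c) = (\<Union>n. c n)"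
  unfolding csup_def using tensor_sup tensor_sup_eq by (intro the_equality) blast+

lemma tensor_way_belowI:
  assumes "I \<in> carrier ST" "J \<in> carrier ST" "f \<in> J" "\<And>g. g \<in> I \<Longrightarrow> tensor_le S T g f"
  shows "I \<lless>\<^bsub>ST\<^esub> J"
  unfolding way_below_def
proof (intro conjI allI impI; (elim conjE)?)
  fix c s assume c: "incr_seq ST c" "is_sup ST (range c) s" "J \<sqsubseteq>\<^bsub>ST\<^esub> s"
  then obtain k where k: "f \<in> c k" using tensor_sup_eq[OF c(1,2)] assms(3) by (auto simp: tensor_simps(4))
  have "c k \<in> carrier ST" using c(1) incr_seq_def by blast
  then have "I \<subseteq> c k" using ideal_down[OF _ k] assms(4) by blast
  then show "\<exists>k. I \<sqsubseteq>\<^bsub>ST\<^esub> c k" by (auto simp: tensor_simps(4))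
qed (use assms in auto)

lemma gen_down:
  assumes "below_seq x"
  shows "incr_seq ST (\<lambda>n. down (x n))" "(\<Union>n. down (x n)) = gen x"
    "down (x n) \<lless>\<^bsub>ST\<^esub> down (x (Suc n))"
proof -
  show "incr_seq ST (\<lambda>n. down (x n))"
    unfolding incr_seq_def tensor_simps(4)
    using down_closed below_seq_closed[OF assms] down_mono below_le assms by blast
  show "(\<Union>n. down (x n)) = gen x" unfolding down_def gen_def by blast
  show "down (x n) \<lless>\<^bsub>ST\<^esub> down (x (Suc n))"
    using assms below_closed below_le
    by (intro tensor_way_belowI[where f = "x n"] down_closed) (auto simp: down_def)
qed

lemma tensor_way_belowD:
  assumes "I \<lless>\<^bsub>ST\<^esub> J"
  shows "\<exists>f\<in>J. \<forall>g\<in>I. tensor_below S T g f"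
proof -
  have J: "J \<in> carrier ST" using assms unfolding way_below_def by blast
  then obtain x where x: "below_seq x" "J = gen x" using tensor_simps(1) by blast
  have "is_sup ST (range (\<lambda>n. down (x n))) J"
    using tensor_sup[OF gen_down(1)[OF x(1)]] gen_down(2)[OF x(1)] x(2) by simp
  then obtain k where "I \<sqsubseteq>\<^bsub>ST\<^esub> down (x k)"
    using assms gen_down(1)[OF x(1)] unfolding way_below_def by (metis subset_refl tensor_simps(4))
  then show ?thesis using seq_in_gen[OF x(1)] x(2) unfolding tensor_simps(4) down_def by blast
qed

lemma tensor_cu_semigroup: "cu_semigroup ST"
proof
  show "\<zero>\<^bsub>ST\<^esub> \<in> carrier ST" using down_closed[of "[]"] by (simp add: down_nil formal_sums_simps)
  show "I \<oplus>\<^bsub>ST\<^esub> J \<in> carrier ST" if "I \<in> carrier ST" "J \<in> carrier ST" for I J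
    using that by (rule tensor_add_closed)
  have assoc1: "(I \<oplus>\<^bsub>ST\<^esub> J) \<oplus>\<^bsub>ST\<^esub> K = {z. \<exists>x\<in>I. \<exists>y\<in>J. \<exists>w\<in>K. tensor_le S T z (x @ y @ w)}"
    if "I \<in> carrier ST" "J \<in> carrier ST" "K \<in> carrier ST" for I J K
  proof (intro set_eqI iffI; simp add: tensor_simps(2); elim bexE exE conjE)
    fix z x' w x y assume *: "w \<in> K" "x \<in> I" "y \<in> J" "tensor_le S T x' (x @ y)" "tensor_le S T z (x' @ w)"
    have "tensor_le S T w w" using ideal_closed[OF that(3) *(1)] tensor_le.refl by blast
    from tensor_le.append[OF *(4) this] *(5) have "tensor_le S T z (x @ y @ w)"
      using tensor_le.trans by fastforce
    then show "\<exists>x\<in>I. \<exists>y\<in>J. \<exists>w\<in>K. tensor_le S T z (x @ y @ w)" using * by blast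
  next
    fix z x y w assume *: "x \<in> I" "y \<in> J" "w \<in> K" "tensor_le S T z (x @ y @ w)"
    have "tensor_le S T (x @ y) (x @ y)"
      using ideal_closed that * by (intro tensor_le.refl) (auto simp: formal_sums_simps)
    then show "\<exists>x. (\<exists>u\<in>I. \<exists>y\<in>J. tensor_le S T x (u @ y)) \<and> (\<exists>y\<in>K. tensor_le S T z (x @ y))"
      using * by (intro exI[of _ "x @ y"]) auto
  qed
  have assoc2: "I \<oplus>\<^bsub>ST\<^esub> (J \<oplus>\<^bsub>ST\<^esub> K) = {z. \<exists>x\<in>I. \<exists>y\<in>J. \<exists>w\<in>K. tensor_le S T z (x @ y @ w)}"
    if "I \<in> carrier ST" "J \<in> carrier ST" "K \<in> carrier ST" for I J K
  proof (intro set_eqI iffI; simp add: tensor_simps(2); elim bexE exE conjE)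
    fix z x y' y w assume *: "x \<in> I" "y \<in> J" "w \<in> K" "tensor_le S T y' (y @ w)" "tensor_le S T z (x @ y')"
    have "tensor_le S T x x" using ideal_closed[OF that(1) *(1)] tensor_le.refl by blast
    from tensor_le.append[OF this *(4)] *(5) have "tensor_le S T z (x @ y @ w)"
      using tensor_le.trans by fastforce
    then show "\<exists>x\<in>I. \<exists>y\<in>J. \<exists>w\<in>K. tensor_le S T z (x @ y @ w)" using * by blast
  next
    fix z x y w assume *: "x \<in> I" "y \<in> J" "w \<in> K" "tensor_le S T z (x @ y @ w)"
    have "tensor_le S T (y @ w) (y @ w)"
      using ideal_closed that * by (intro tensor_le.refl) (auto simp: formal_sums_simps)
    then show "\<exists>x\<in>I. \<exists>y. (\<exists>x\<in>J. \<exists>ya\<in>K. tensor_le S T y (x @ ya)) \<and> tensor_le S T z (x @ y)"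
      using * by blast
  qed
  show "(I \<oplus>\<^bsub>ST\<^esub> J) \<oplus>\<^bsub>ST\<^esub> K = I \<oplus>\<^bsub>ST\<^esub> (J \<oplus>\<^bsub>ST\<^esub> K)"
    if "I \<in> carrier ST" "J \<in> carrier ST" "K \<in> carrier ST" for I J K
    using assoc1[OF that] assoc2[OF that] by simp
  have "I \<oplus>\<^bsub>ST\<^esub> J \<subseteq> J \<oplus>\<^bsub>ST\<^esub> I" if "I \<in> carrier ST" "J \<in> carrier ST" for I J
    unfolding tensor_simps using that tensor_le.trans[OF _ tensor_le.swap] ideal_closed by blast
  then show "I \<oplus>\<^bsub>ST\<^esub> J = J \<oplus>\<^bsub>ST\<^esub> I" if "I \<in> carrier ST" "J \<in> carrier ST" for I J
    using that by blast
  show "\<zero>\<^bsub>ST\<^esub> \<oplus>\<^bsub>ST\<^esub> I = I" if I: "I \<in> carrier ST" for I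
  proof
    show "\<zero>\<^bsub>ST\<^esub> \<oplus>\<^bsub>ST\<^esub> I \<subseteq> I"
    proof
      fix z assume "z \<in> \<zero>\<^bsub>ST\<^esub> \<oplus>\<^bsub>ST\<^esub> I"
      then obtain x y where *: "tensor_le S T x []" "y \<in> I" "tensor_le S T z (x @ y)"
        unfolding tensor_simps by blast
      have "tensor_le S T (x @ y) ([] @ y)"
        using * ideal_closed[OF I] by (intro tensor_le.append tensor_le.refl) auto
      then have "tensor_le S T z y" using *(3) tensor_le.trans by fastforce
      then show "z \<in> I" using ideal_down[OF I *(2)] by blast
    qed
    show "I \<subseteq> \<zero>\<^bsub>ST\<^esub> \<oplus>\<^bsub>ST\<^esub> I"
    proof
      fix z assume z: "z \<in> I"
      then have "tensor_le S T z ([] @ z)" using ideal_closed[OF I] tensor_le.refl by fastforce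
      moreover have "tensor_le S T [] []" by (intro tensor_le.refl) (simp add: formal_sums_simps)
      ultimately show "z \<in> \<zero>\<^bsub>ST\<^esub> \<oplus>\<^bsub>ST\<^esub> I" unfolding tensor_simps using z by blast
    qed
  qed
  show "I \<sqsubseteq>\<^bsub>ST\<^esub> I" for I by (simp add: tensor_simps(4))
  show "I = J" if "I \<sqsubseteq>\<^bsub>ST\<^esub> J" "J \<sqsubseteq>\<^bsub>ST\<^esub> I" for I J using that by (simp add: tensor_simps(4))
  show "I \<sqsubseteq>\<^bsub>ST\<^esub> K" if "I \<sqsubseteq>\<^bsub>ST\<^esub> J" "J \<sqsubseteq>\<^bsub>ST\<^esub> K" for I J K using that by (simp add: tensor_simps(4))
  show "I \<oplus>\<^bsub>ST\<^esub> K \<sqsubseteq>\<^bsub>ST\<^esub> J \<oplus>\<^bsub>ST\<^esub> K" if "I \<sqsubseteq>\<^bsub>ST\<^esub> J" for I J K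
    using that unfolding tensor_simps by blast
  show "\<zero>\<^bsub>ST\<^esub> \<sqsubseteq>\<^bsub>ST\<^esub> I" if "I \<in> carrier ST" for I
    using ideal_down[OF that nil_in_ideal[OF that]] unfolding tensor_simps by blast
  show "\<exists>s. is_sup ST (range c) s" if "incr_seq ST c" for c :: "nat \<Rightarrow> _"
    using tensor_sup[OF that] by blast
  show "\<exists>c. (\<forall>n. c n \<lless>\<^bsub>ST\<^esub> c (Suc n)) \<and> is_sup ST (range c) I" if I: "I \<in> carrier ST" for I
  proof -
    obtain x where x: "below_seq x" "I = gen x" using I tensor_simps(1) by blast
    then have "is_sup ST (range (\<lambda>n. down (x n))) I"
      using tensor_sup[OF gen_down(1)[OF x(1)]] gen_down(2)[OF x(1)] by simp
    then show ?thesis using gen_down(3)[OF x(1)] by (intro exI[of _ "\<lambda>n. down (x n)"]) auto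
  qed
  show "I' \<oplus>\<^bsub>ST\<^esub> J' \<lless>\<^bsub>ST\<^esub> I \<oplus>\<^bsub>ST\<^esub> J" if *: "I' \<lless>\<^bsub>ST\<^esub> I" "J' \<lless>\<^bsub>ST\<^esub> J" for I' I J' J
  proof -
    obtain f where f: "f \<in> I" "\<And>g. g \<in> I' \<Longrightarrow> tensor_below S T g f" using tensor_way_belowD[OF *(1)] by blast
    obtain h where h: "h \<in> J" "\<And>g. g \<in> J' \<Longrightarrow> tensor_below S T g h" using tensor_way_belowD[OF *(2)] by blast
    have cl: "I \<in> carrier ST" "J \<in> carrier ST" "I' \<in> carrier ST" "J' \<in> carrier ST"
      using * unfolding way_below_def by auto
    show ?thesis
    proof (rule tensor_way_belowI[where f = "f @ h"])
      show "I' \<oplus>\<^bsub>ST\<^esub> J' \<in> carrier ST" "I \<oplus>\<^bsub>ST\<^esub> J \<in> carrier ST" using cl tensor_add_closed by auto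
      have "tensor_le S T (f @ h) (f @ h)"
        using f h cl ideal_closed by (intro tensor_le.refl) (auto simp: formal_sums_simps)
      then show "f @ h \<in> I \<oplus>\<^bsub>ST\<^esub> J" unfolding tensor_simps using f h by blast
      show "tensor_le S T g (f @ h)" if "g \<in> I' \<oplus>\<^bsub>ST\<^esub> J'" for g
        using that f(2) h(2) below_append below_le le_below_trans unfolding tensor_simps by blast
    qed
  qed
  show "csup ST (range (\<lambda>n. c n \<oplus>\<^bsub>ST\<^esub> d n)) = csup ST (range c) \<oplus>\<^bsub>ST\<^esub> csup ST (range d)"
    if cd: "incr_seq ST c" "incr_seq ST d" for c d
  proof -
    have c: "\<And>n. c n \<in> carrier ST" "\<And>m n. m \<le> n \<Longrightarrow> c m \<subseteq> c n" using cd(1) incr_seq_ST by auto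
    have d: "\<And>n. d n \<in> carrier ST" "\<And>m n. m \<le> n \<Longrightarrow> d m \<subseteq> d n" using cd(2) incr_seq_ST by auto
    have i: "incr_seq ST (\<lambda>n. c n \<oplus>\<^bsub>ST\<^esub> d n)"
      unfolding incr_seq_ST
    proof (intro conjI allI impI)
      show "c n \<oplus>\<^bsub>ST\<^esub> d n \<in> carrier ST" for n using tensor_add_closed c d by blast
      show "c m \<oplus>\<^bsub>ST\<^esub> d m \<subseteq> c n \<oplus>\<^bsub>ST\<^esub> d n" if "m \<le> n" for m n
        using c(2)[OF that] d(2)[OF that] unfolding tensor_simps by blast
    qed
    have "(\<Union>n. c n \<oplus>\<^bsub>ST\<^esub> d n) = (\<Union>n. c n) \<oplus>\<^bsub>ST\<^esub> (\<Union>n. d n)"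
    proof
      show "(\<Union>n. c n \<oplus>\<^bsub>ST\<^esub> d n) \<subseteq> (\<Union>n. c n) \<oplus>\<^bsub>ST\<^esub> (\<Union>n. d n)"
        unfolding tensor_simps by blast
      show "(\<Union>n. c n) \<oplus>\<^bsub>ST\<^esub> (\<Union>n. d n) \<subseteq> (\<Union>n. c n \<oplus>\<^bsub>ST\<^esub> d n)"
      proof
        fix z assume "z \<in> (\<Union>n. c n) \<oplus>\<^bsub>ST\<^esub> (\<Union>n. d n)"
        then obtain x y i j where *: "x \<in> c i" "y \<in> d j" "tensor_le S T z (x @ y)"
          unfolding tensor_simps by blast
        have "x \<in> c (max i j)" "y \<in> d (max i j)"
          using c(2)[of i "max i j"] d(2)[of j "max i j"] * by auto
        then show "z \<in> (\<Union>n. c n \<oplus>\<^bsub>ST\<^esub> d n)" unfolding tensor_simps using *(3) by blast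
      qed
    qed
    then show ?thesis using tensor_csup[OF i] tensor_csup[OF cd(1)] tensor_csup[OF cd(2)] by simp
  qed
qed

end

context cu_pair
begin

lemma tens_eq_down: "tens S T a b = down [(a, b)]"
  unfolding tens_def down_def ..

lemma single_closed: "\<lbrakk>a \<in> carrier S; b \<in> carrier T\<rbrakk> \<Longrightarrow> [(a, b)] \<in> formal_sums S T"
  by (simp add: formal_sums_simps)

lemma down_eqI: "\<lbrakk>tensor_le S T x y; tensor_le S T y x\<rbrakk> \<Longrightarrow> down x = down y"
  using down_mono by blast

lemma below_single:
  assumes "tensor_below S T f [(a, b)]"
  shows "\<exists>p q. tensor_below S T f [(p, q)] \<and> p \<lless>\<^bsub>S\<^esub> a \<and> q \<lless>\<^bsub>T\<^esub> b"
proof -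
  have cl: "a \<in> carrier S" "b \<in> carrier T"
    using below_closed[OF assms] by (auto simp: formal_sums_simps)
  obtain n where "tensor_below S T f (approx [(a, b)] n)" using below_approx[OF assms] by blast
  then show ?thesis using S.approx_seq(2)[OF cl(1)] T.approx_seq(2)[OF cl(2)]
    by (auto simp: approx_simps)
qed

lemma tens_cu_bimor: "cu_bimor S T ST (tens S T)"
  unfolding cu_bimor_def
proof (intro conjI ballI allI impI; (elim conjE)?)
  fix a b assume "a \<in> carrier S" "b \<in> carrier T"
  then show "tens S T a b \<in> carrier ST" by (simp add: tens_eq_down down_closed single_closed)
next
  fix a a' b assume *: "a \<in> carrier S" "a' \<in> carrier S" "b \<in> carrier T"
  have "down [(a \<oplus>\<^bsub>S\<^esub> a', b)] = down ([(a, b)] @ [(a', b)])"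
    using tensor_le.addl1[OF *] tensor_le.addl2[OF *] by (intro down_eqI) auto
  then show "tens S T (a \<oplus>\<^bsub>S\<^esub> a') b = tens S T a b \<oplus>\<^bsub>ST\<^esub> tens S T a' b"
    unfolding tens_eq_down down_append .
next
  fix a b b' assume *: "a \<in> carrier S" "b \<in> carrier T" "b' \<in> carrier T"
  have "down [(a, b \<oplus>\<^bsub>T\<^esub> b')] = down ([(a, b)] @ [(a, b')])"
    using tensor_le.addr1[OF *] tensor_le.addr2[OF *] by (intro down_eqI) auto
  then show "tens S T a (b \<oplus>\<^bsub>T\<^esub> b') = tens S T a b \<oplus>\<^bsub>ST\<^esub> tens S T a b'"
    unfolding tens_eq_down down_append .
next
  fix b assume "b \<in> carrier T"
  then show "tens S T \<zero>\<^bsub>S\<^esub> b = \<zero>\<^bsub>ST\<^esub>" unfolding tens_eq_down down_nil[symmetric]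
    by (intro down_eqI tensor_le.zerol1 tensor_le.zerol2)
next
  fix a assume "a \<in> carrier S"
  then show "tens S T a \<zero>\<^bsub>T\<^esub> = \<zero>\<^bsub>ST\<^esub>" unfolding tens_eq_down down_nil[symmetric]
    by (intro down_eqI tensor_le.zeror1 tensor_le.zeror2)
next
  fix a a' b assume "a \<in> carrier S" "a' \<in> carrier S" "b \<in> carrier T" "a \<sqsubseteq>\<^bsub>S\<^esub> a'"
  then show "tens S T a b \<sqsubseteq>\<^bsub>ST\<^esub> tens S T a' b" unfolding tens_eq_down tensor_simps(4)
    by (intro down_mono tensor_le.mono) (auto simp: T.le_refl)
next
  fix a b b' assume "a \<in> carrier S" "b \<in> carrier T" "b' \<in> carrier T" "b \<sqsubseteq>\<^bsub>T\<^esub> b'"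
  then show "tens S T a b \<sqsubseteq>\<^bsub>ST\<^esub> tens S T a b'" unfolding tens_eq_down tensor_simps(4)
    by (intro down_mono tensor_le.mono) (auto simp: S.le_refl)
next
  fix c d assume c: "incr_seq S c" and d: "incr_seq T d"
  have cc: "\<And>n. c n \<in> carrier S" and dc: "\<And>n. d n \<in> carrier T"
    using c d unfolding incr_seq_def by auto
  define s t where "s = csup S (range c)" and "t = csup T (range d)"
  have s: "is_sup S (range c) s" and t: "is_sup T (range d) t"
    unfolding s_def t_def using S.is_sup_csup[OF c] T.is_sup_csup[OF d] by auto
  have sc: "s \<in> carrier S" "\<And>n. c n \<sqsubseteq>\<^bsub>S\<^esub> s" using s unfolding is_sup_def by auto
  have tc: "t \<in> carrier T" "\<And>n. d n \<sqsubseteq>\<^bsub>T\<^esub> t" using t unfolding is_sup_def by auto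
  have le: "tensor_le S T [(c m, d m)] [(c n, d n)]" if "m \<le> n" for m n
    by (intro tensor_le.mono cc dc S.incr_seq_le[OF c that] T.incr_seq_le[OF d that])
  have i: "incr_seq ST (\<lambda>k. tens S T (c k) (d k))"
    unfolding incr_seq_ST tens_eq_down using down_closed single_closed cc dc down_mono le by blast
  have "(\<Union>k. down [(c k, d k)]) = down [(s, t)]"
  proof
    have "tensor_le S T [(c k, d k)] [(s, t)]" for k
      by (intro tensor_le.mono cc dc sc tc)
    then show "(\<Union>k. down [(c k, d k)]) \<subseteq> down [(s, t)]" using down_mono by blast
    show "down [(s, t)] \<subseteq> (\<Union>k. down [(c k, d k)])"
    proof
      fix f assume "f \<in> down [(s, t)]"
      then obtain p q where pq: "tensor_below S T f [(p, q)]" "p \<lless>\<^bsub>S\<^esub> s" "q \<lless>\<^bsub>T\<^esub> t"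
        using below_single unfolding down_def by blast
      obtain i where i: "p \<sqsubseteq>\<^bsub>S\<^esub> c i" using S.way_below_seq[OF pq(2) c s] by blast
      obtain j where j: "q \<sqsubseteq>\<^bsub>T\<^esub> d j" using T.way_below_seq[OF pq(3) d t] by blast
      have p: "p \<in> carrier S" and q: "q \<in> carrier T"
        using pq S.way_below_closed T.way_below_closed by blast+
      have "p \<sqsubseteq>\<^bsub>S\<^esub> c (max i j)"
        by (rule S.le_trans[OF p cc cc i]) (rule S.incr_seq_le[OF c], simp)
      moreover have "q \<sqsubseteq>\<^bsub>T\<^esub> d (max i j)"
        by (rule T.le_trans[OF q dc dc j]) (rule T.incr_seq_le[OF d], simp)
      ultimately have "tensor_le S T [(p, q)] [(c (max i j), d (max i j))]"
        by (intro tensor_le.mono p q cc dc)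
      then show "f \<in> (\<Union>k. down [(c k, d k)])" unfolding down_def using below_le_trans[OF pq(1)] by blast
    qed
  qed
  then show "csup ST (range (\<lambda>k. tens S T (c k) (d k))) = tens S T (csup S (range c)) (csup T (range d))"
    unfolding tensor_csup[OF i] unfolding tens_eq_down s_def t_def .
next
  fix a' a b' b assume *: "a' \<lless>\<^bsub>S\<^esub> a" "b' \<lless>\<^bsub>T\<^esub> b"
  then have "tensor_below S T [(a', b')] [(a, b)]" by (intro tw_below) (simp add: tw_simps)
  then show "tens S T a' b' \<lless>\<^bsub>ST\<^esub> tens S T a b" unfolding tens_eq_down
    using below_closed by (intro tensor_way_belowI[where f = "[(a', b')]"] down_closed)
      (auto simp: down_def below_le)
qed

end

locale cu_bimor_loc = cu_pair S T + P: cu_semigroup P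
  for S :: "('a, 'm) cu_sg_scheme" and T :: "('b, 'n) cu_sg_scheme" and P :: "('c, 'k) cu_sg_scheme" +
  fixes \<phi> :: "'a \<Rightarrow> 'b \<Rightarrow> 'c"
  assumes bimor: "cu_bimor S T P \<phi>"
begin

lemmas bimor_unfolded = bimor[unfolded cu_bimor_def]

lemma phi_closed: "\<lbrakk>a \<in> carrier S; b \<in> carrier T\<rbrakk> \<Longrightarrow> \<phi> a b \<in> carrier P"
  and phi_addl: "\<lbrakk>a \<in> carrier S; a' \<in> carrier S; b \<in> carrier T\<rbrakk> \<Longrightarrow> \<phi> (a \<oplus>\<^bsub>S\<^esub> a') b = \<phi> a b \<oplus>\<^bsub>P\<^esub> \<phi> a' b"
  and phi_addr: "\<lbrakk>a \<in> carrier S; b \<in> carrier T; b' \<in> carrier T\<rbrakk> \<Longrightarrow> \<phi> a (b \<oplus>\<^bsub>T\<^esub> b') = \<phi> a b \<oplus>\<^bsub>P\<^esub> \<phi> a b'"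
  and phi_zerol: "b \<in> carrier T \<Longrightarrow> \<phi> \<zero>\<^bsub>S\<^esub> b = \<zero>\<^bsub>P\<^esub>"
  and phi_zeror: "a \<in> carrier S \<Longrightarrow> \<phi> a \<zero>\<^bsub>T\<^esub> = \<zero>\<^bsub>P\<^esub>"
  and phi_monol: "\<lbrakk>a \<in> carrier S; a' \<in> carrier S; b \<in> carrier T; a \<sqsubseteq>\<^bsub>S\<^esub> a'\<rbrakk> \<Longrightarrow> \<phi> a b \<sqsubseteq>\<^bsub>P\<^esub> \<phi> a' b"
  and phi_monor: "\<lbrakk>a \<in> carrier S; b \<in> carrier T; b' \<in> carrier T; b \<sqsubseteq>\<^bsub>T\<^esub> b'\<rbrakk> \<Longrightarrow> \<phi> a b \<sqsubseteq>\<^bsub>P\<^esub> \<phi> a b'"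
  and phi_sup: "\<lbrakk>incr_seq S c; incr_seq T d\<rbrakk> \<Longrightarrow>
        csup P (range (\<lambda>k. \<phi> (c k) (d k))) = \<phi> (csup S (range c)) (csup T (range d))"
  and phi_wb: "\<lbrakk>a' \<lless>\<^bsub>S\<^esub> a; b' \<lless>\<^bsub>T\<^esub> b\<rbrakk> \<Longrightarrow> \<phi> a' b' \<lless>\<^bsub>P\<^esub> \<phi> a b"
  using bimor_unfolded by simp_all

lemma phi_mono:
  assumes "a \<in> carrier S" "a' \<in> carrier S" "b \<in> carrier T" "b' \<in> carrier T" "a \<sqsubseteq>\<^bsub>S\<^esub> a'" "b \<sqsubseteq>\<^bsub>T\<^esub> b'"
  shows "\<phi> a b \<sqsubseteq>\<^bsub>P\<^esub> \<phi> a' b'"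
  by (rule P.le_trans[OF _ _ _ phi_monol[OF assms(1,2,3,5)] phi_monor[OF assms(2,3,4,6)]])
    (intro phi_closed assms)+

definition phat :: "('a \<times> 'b) list \<Rightarrow> 'c" where
  "phat x = foldr (\<lambda>p r. \<phi> (fst p) (snd p) \<oplus>\<^bsub>P\<^esub> r) x \<zero>\<^bsub>P\<^esub>"

lemma phat_simps: "phat [] = \<zero>\<^bsub>P\<^esub>" "phat (p # x) = \<phi> (fst p) (snd p) \<oplus>\<^bsub>P\<^esub> phat x"
  unfolding phat_def by auto

lemma phat_closed: "x \<in> formal_sums S T \<Longrightarrow> phat x \<in> carrier P"
  by (induction x) (auto simp: phat_simps formal_sums_simps P.zero_closed P.add_closed phi_closed)

lemma phat_append:
  "\<lbrakk>x \<in> formal_sums S T; y \<in> formal_sums S T\<rbrakk> \<Longrightarrow> phat (x @ y) = phat x \<oplus>\<^bsub>P\<^esub> phat y"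
  by (induction x) (auto simp: phat_simps formal_sums_simps P.add_zero P.add_assoc phat_closed phi_closed)

lemma P_add_zero_right: "p \<in> carrier P \<Longrightarrow> p \<oplus>\<^bsub>P\<^esub> \<zero>\<^bsub>P\<^esub> = p"
  using P.add_comm[of p "\<zero>\<^bsub>P\<^esub>"] P.add_zero P.zero_closed by simp

lemma phat_single: "\<lbrakk>a \<in> carrier S; b \<in> carrier T\<rbrakk> \<Longrightarrow> phat [(a, b)] = \<phi> a b"
  by (simp add: phat_simps P_add_zero_right phi_closed)

lemma phat_double: "\<lbrakk>a \<in> carrier S; b \<in> carrier T; a' \<in> carrier S; b' \<in> carrier T\<rbrakk> \<Longrightarrow>
   phat [(a, b), (a', b')] = \<phi> a b \<oplus>\<^bsub>P\<^esub> \<phi> a' b'"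
  by (simp add: phat_simps P_add_zero_right phi_closed)

lemma phat_le: "tensor_le S T x y \<Longrightarrow> phat x \<sqsubseteq>\<^bsub>P\<^esub> phat y"
proof (induction rule: tensor_le.induct)
  case (refl x) then show ?case by (simp add: P.le_refl phat_closed)
next
  case (trans x y z)
  then show ?case using P.le_trans[OF _ _ _ trans.IH] tle_closed phat_closed by blast
next
  case (append x y x' y')
  have "x \<in> formal_sums S T" "y \<in> formal_sums S T" "x' \<in> formal_sums S T" "y' \<in> formal_sums S T"
    using append tle_closed by auto
  then show ?case using append.IH by (simp add: phat_append P.add_mono2 phat_closed)
next
  case (swap x y)
  then have "phat (x @ y) = phat (y @ x)"
    using P.add_comm[of "phat x" "phat y"] by (simp add: phat_append phat_closed)
  then show ?case using swap by (simp add: P.le_refl phat_closed formal_sums_simps)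
next
  case (mono a a' b b')
  then show ?case by (simp add: phat_single phi_mono)
qed (simp_all add: phat_single phat_double phat_simps(1) phi_addl phi_addr phi_zerol phi_zeror P.le_refl
      S.add_closed T.add_closed S.zero_closed T.zero_closed P.zero_closed P.add_closed phi_closed)

lemma phat_tw: "termwise_below S T x y \<Longrightarrow> phat x \<lless>\<^bsub>P\<^esub> phat y"
  unfolding termwise_below_def
proof (induction rule: list_all2_induct)
  case Nil show ?case by (simp add: phat_simps P.zero_way_below P.zero_closed)
next
  case (Cons p x q y) then show ?case by (simp add: phat_simps P.O3 phi_wb)
qed

lemma phat_below: assumes "tensor_below S T x y" shows "phat x \<lless>\<^bsub>P\<^esub> phat y"
proof -
  obtain w where w: "tensor_le S T x w" "termwise_below S T w y" using assms below_iff by blast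
  have "x \<in> formal_sums S T" using w tle_closed by blast
  then show ?thesis by (rule P.le_way_below_trans[OF phat_le[OF w(1)] phat_tw[OF w(2)] phat_closed])
qed

lemma phat_below_seq: assumes "below_seq x" shows "incr_seq P (\<lambda>n. phat (x n))"
  using assms phat_below by (intro P.incr_seq_way_below) auto

lemma phat_approx:
  "x \<in> formal_sums S T \<Longrightarrow> csup P (range (\<lambda>n. phat (approx x n))) = phat x"
proof (induction x)
  case Nil
  then show ?case
    using P.csup_eq[OF P.is_sup_const[OF P.zero_closed]] by (simp only: approx_simps phat_simps)
next
  case (Cons p x)
  then have x: "x \<in> formal_sums S T" and p: "fst p \<in> carrier S" "snd p \<in> carrier T"
    by (auto simp: formal_sums_simps)
  let ?a = "S.approx_seq (fst p)" and ?b = "T.approx_seq (snd p)"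
  note A = S.approx_seq[OF p(1)] note B = T.approx_seq[OF p(2)]
  have i1: "incr_seq P (\<lambda>n. \<phi> (?a n) (?b n))"
    using phi_wb[OF A(1) B(1)] by (rule P.incr_seq_way_below)
  have i2: "incr_seq P (\<lambda>n. phat (approx x n))"
    using phat_below_seq[OF approx_below_seq[OF x]] .
  show ?case
    using P.O4[OF i1 i2] Cons.IH[OF x] phi_sup[OF A(3) B(3)] S.csup_eq[OF A(4)] T.csup_eq[OF B(4)]
    by (simp add: phat_simps approx_simps)
qed

definition lft :: "('a \<times> 'b) list set \<Rightarrow> 'c" where
  "lft = (\<lambda>I\<in>carrier ST. csup P (phat ` I))"

lemma gen_sup:
  assumes "below_seq x"
  shows "is_sup P (phat ` gen x) (csup P (range (\<lambda>n. phat (x n))))"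
proof -
  let ?s = "csup P (range (\<lambda>n. phat (x n)))"
  have s: "is_sup P (range (\<lambda>n. phat (x n))) ?s" using P.is_sup_csup[OF phat_below_seq[OF assms]] .
  then have sc: "?s \<in> carrier P" "\<And>n. phat (x n) \<sqsubseteq>\<^bsub>P\<^esub> ?s"
    "\<And>u. \<lbrakk>u \<in> carrier P; \<And>n. phat (x n) \<sqsubseteq>\<^bsub>P\<^esub> u\<rbrakk> \<Longrightarrow> ?s \<sqsubseteq>\<^bsub>P\<^esub> u" unfolding is_sup_def by auto
  show ?thesis unfolding is_sup_def
  proof (intro conjI ballI impI)
    show "?s \<in> carrier P" by fact
    fix p assume "p \<in> phat ` gen x"
    then obtain f n where f: "p = phat f" "tensor_below S T f (x n)" unfolding gen_def by blast
    show "p \<sqsubseteq>\<^bsub>P\<^esub> ?s" unfolding f(1)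
      using P.le_trans[OF _ _ sc(1) P.way_below_le[OF phat_below[OF f(2)]] sc(2)]
        below_closed[OF f(2)] phat_closed by blast
  next
    fix u assume "u \<in> carrier P" "\<forall>p\<in>phat ` gen x. p \<sqsubseteq>\<^bsub>P\<^esub> u"
    then show "?s \<sqsubseteq>\<^bsub>P\<^esub> u" using seq_in_gen[OF assms] by (intro sc(3)) auto
  qed
qed

lemma lft_gen: assumes "below_seq x" shows "lft (gen x) = csup P (range (\<lambda>n. phat (x n)))"
proof -
  have "gen x \<in> carrier ST" using assms tensor_simps(1) by blast
  then show ?thesis unfolding lft_def using P.csup_eq[OF gen_sup[OF assms]] by simp
qed

lemma lft_sup: assumes "I \<in> carrier ST" shows "is_sup P (phat ` I) (lft I)"
proof -
  obtain x where x: "below_seq x" "I = gen x" using assms tensor_simps(1) by blast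
  show ?thesis unfolding x(2) lft_gen[OF x(1)] by (rule gen_sup[OF x(1)])
qed

lemma lft_closed: "I \<in> carrier ST \<Longrightarrow> lft I \<in> carrier P"
  and lft_upper: "\<lbrakk>I \<in> carrier ST; f \<in> I\<rbrakk> \<Longrightarrow> phat f \<sqsubseteq>\<^bsub>P\<^esub> lft I"
  and lft_least: "\<lbrakk>I \<in> carrier ST; u \<in> carrier P; \<And>f. f \<in> I \<Longrightarrow> phat f \<sqsubseteq>\<^bsub>P\<^esub> u\<rbrakk> \<Longrightarrow> lft I \<sqsubseteq>\<^bsub>P\<^esub> u"
  using lft_sup[of I] unfolding is_sup_def by auto

lemma lft_down: assumes "x \<in> formal_sums S T" shows "lft (down x) = phat x"
  unfolding down_eq_gen[OF assms] lft_gen[OF approx_below_seq[OF assms]] by (rule phat_approx[OF assms])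

lemma lft_tens: "\<lbrakk>a \<in> carrier S; b \<in> carrier T\<rbrakk> \<Longrightarrow> lft (tens S T a b) = \<phi> a b"
  unfolding tens_eq_down by (simp add: lft_down single_closed phat_single)

lemma lft_mono:
  assumes "I \<in> carrier ST" "J \<in> carrier ST" "I \<subseteq> J" shows "lft I \<sqsubseteq>\<^bsub>P\<^esub> lft J"
  using assms lft_upper[OF assms(2)] by (intro lft_least lft_closed) auto

lemma lft_add:
  assumes "I \<in> carrier ST" "J \<in> carrier ST" shows "lft (I \<oplus>\<^bsub>ST\<^esub> J) = lft I \<oplus>\<^bsub>P\<^esub> lft J"
proof -
  obtain x where x: "below_seq x" "I = gen x" using assms tensor_simps(1) by blast
  obtain y where y: "below_seq y" "J = gen y" using assms tensor_simps(1) by blast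
  have e: "(\<lambda>n. phat (x n @ y n)) = (\<lambda>n. phat (x n) \<oplus>\<^bsub>P\<^esub> phat (y n))"
    using phat_append below_seq_closed[OF x(1)] below_seq_closed[OF y(1)] by blast
  show ?thesis unfolding x(2) y(2) gen_append(2)[OF x(1) y(1)] lft_gen[OF gen_append(1)[OF x(1) y(1)]]
      lft_gen[OF x(1)] lft_gen[OF y(1)] e
    by (rule P.O4[OF phat_below_seq[OF x(1)] phat_below_seq[OF y(1)]])
qed

lemma lft_cu_mor: "lft \<in> cu_mor ST P"
  unfolding cu_mor_def gcu_mor_def
proof (intro CollectI conjI ballI allI impI; (elim conjE)?)
  show "lft \<in> carrier ST \<rightarrow>\<^sub>E carrier P"
    using lft_closed by (auto simp: lft_def)
  show "lft (I \<oplus>\<^bsub>ST\<^esub> J) = lft I \<oplus>\<^bsub>P\<^esub> lft J" if "I \<in> carrier ST" "J \<in> carrier ST" for I J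
    using lft_add that .
  show "lft \<zero>\<^bsub>ST\<^esub> = \<zero>\<^bsub>P\<^esub>"
    unfolding down_nil[symmetric] by (simp add: lft_down formal_sums_simps phat_simps)
  show "lft I \<sqsubseteq>\<^bsub>P\<^esub> lft J" if "I \<in> carrier ST" "J \<in> carrier ST" "I \<sqsubseteq>\<^bsub>ST\<^esub> J" for I J
    using lft_mono that tensor_simps(4) by blast
  show "lft (csup ST (range c)) = csup P (range (\<lambda>n. lft (c n)))" if c: "incr_seq ST c" for c
  proof -
    have cc: "\<And>n. c n \<in> carrier ST" using c unfolding incr_seq_def by blast
    have "is_sup P (range (\<lambda>n. lft (c n))) (lft (\<Union>n. c n))"
      unfolding is_sup_def
    proof (intro conjI ballI impI)
      show "lft (\<Union>n. c n) \<in> carrier P" by (rule lft_closed[OF tensor_union[OF c]])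
      show "p \<sqsubseteq>\<^bsub>P\<^esub> lft (\<Union>n. c n)" if "p \<in> range (\<lambda>n. lft (c n))" for p
        using that lft_mono[OF cc tensor_union[OF c]] by blast
      fix u assume u: "u \<in> carrier P" "\<forall>p\<in>range (\<lambda>n. lft (c n)). p \<sqsubseteq>\<^bsub>P\<^esub> u"
      show "lft (\<Union>n. c n) \<sqsubseteq>\<^bsub>P\<^esub> u"
      proof (rule lft_least[OF tensor_union[OF c] u(1)])
        fix f assume "f \<in> (\<Union>n. c n)"
        then obtain n where n: "f \<in> c n" by blast
        have "phat f \<in> carrier P" using ideal_closed[OF cc n] phat_closed by blast
        then show "phat f \<sqsubseteq>\<^bsub>P\<^esub> u"
          using P.le_trans[OF _ lft_closed[OF cc] u(1) lft_upper[OF cc n]] u(2) by blast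
      qed
    qed
    then show ?thesis unfolding tensor_csup[OF c] by (rule P.csup_eq[symmetric])
  qed
  show "lft I \<lless>\<^bsub>P\<^esub> lft J" if wb: "I \<lless>\<^bsub>ST\<^esub> J" for I J
  proof -
    have I: "I \<in> carrier ST" and J: "J \<in> carrier ST" using wb unfolding way_below_def by auto
    obtain f where f: "f \<in> J" "\<And>g. g \<in> I \<Longrightarrow> tensor_below S T g f" using tensor_way_belowD[OF wb] by blast
    obtain h where h: "h \<in> J" "tensor_below S T f h" using ideal_directed[OF J f(1) f(1)] by blast
    have fc: "phat f \<in> carrier P" using ideal_closed[OF J f(1)] phat_closed by blast
    have "lft I \<sqsubseteq>\<^bsub>P\<^esub> phat f"
      using f(2) phat_below P.way_below_le by (intro lft_least[OF I fc]) blast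
    moreover have "phat f \<lless>\<^bsub>P\<^esub> lft J"
      by (rule P.way_below_le_trans[OF phat_below[OF h(2)] lft_upper[OF J h(1)] lft_closed[OF J]])
    ultimately show ?thesis using P.le_way_below_trans lft_closed[OF I] by blast
  qed
qed

end

context cu_pair
begin

lemma tensor_gmor_le:
  assumes P: "cu_semigroup P" and \<alpha>: "\<alpha> \<in> gcu_mor ST P" and \<beta>: "\<beta> \<in> gcu_mor ST P"
    and le: "\<And>a b. a \<in> carrier S \<Longrightarrow> b \<in> carrier T \<Longrightarrow> \<alpha> (tens S T a b) \<sqsubseteq>\<^bsub>P\<^esub> \<beta> (tens S T a b)"
    and I: "I \<in> carrier ST"
  shows "\<alpha> I \<sqsubseteq>\<^bsub>P\<^esub> \<beta> I"
proof -
  interpret P: cu_semigroup P by fact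
  have cl: "f J \<in> carrier P" if "f \<in> gcu_mor ST P" "J \<in> carrier ST" for f J
    using that unfolding gcu_mor_def by auto
  have add: "f (J \<oplus>\<^bsub>ST\<^esub> K) = f J \<oplus>\<^bsub>P\<^esub> f K" if "f \<in> gcu_mor ST P" "J \<in> carrier ST" "K \<in> carrier ST" for f J K
    using that unfolding gcu_mor_def by simp
  have mono: "f J \<sqsubseteq>\<^bsub>P\<^esub> f K" if "f \<in> gcu_mor ST P" "J \<in> carrier ST" "K \<in> carrier ST" "J \<subseteq> K" for f J K
    using that unfolding gcu_mor_def by (simp add: tensor_simps(4))
  have d: "\<alpha> (down x) \<sqsubseteq>\<^bsub>P\<^esub> \<beta> (down x)" if "x \<in> formal_sums S T" for x
    using that
  proof (induction x)
    case Nil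
    then show ?case using \<alpha> \<beta> P.le_refl P.zero_closed unfolding down_nil gcu_mor_def by simp
  next
    case (Cons p x)
    obtain a b where p: "p = (a, b)" by (cases p)
    with Cons have c: "x \<in> formal_sums S T" "a \<in> carrier S" "b \<in> carrier T" by (auto simp: formal_sums_simps)
    have "down (p # x) = tens S T a b \<oplus>\<^bsub>ST\<^esub> down x"
      using down_append[of "[p]" x] by (simp add: p tens_eq_down)
    moreover have t: "tens S T a b \<in> carrier ST" "down x \<in> carrier ST"
      using c by (auto simp: tens_eq_down down_closed single_closed)
    ultimately show ?case using P.add_mono2[OF cl[OF \<alpha> t(1)] cl[OF \<beta> t(1)] cl[OF \<alpha> t(2)] cl[OF \<beta> t(2)]
        le[OF c(2,3)] Cons.IH[OF c(1)]] add[OF \<alpha> t] add[OF \<beta> t] by simp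
  qed
  obtain x where x: "below_seq x" "I = gen x" using I tensor_simps(1) by blast
  have xc: "\<And>n. down (x n) \<in> carrier ST" using down_closed below_seq_closed[OF x(1)] by blast
  have i: "incr_seq ST (\<lambda>n. down (x n))" by (rule gen_down(1)[OF x(1)])
  have cs: "csup ST (range (\<lambda>n. down (x n))) = I"
    using tensor_csup[OF i] gen_down(2)[OF x(1)] x(2) by simp
  have "\<alpha> (csup ST (range (\<lambda>n. down (x n)))) = csup P (range (\<lambda>n. \<alpha> (down (x n))))"
    using \<alpha> i unfolding gcu_mor_def by blast
  then have \<alpha>I: "\<alpha> I = csup P (range (\<lambda>n. \<alpha> (down (x n))))" unfolding cs .
  have "incr_seq P (\<lambda>n. \<alpha> (down (x n)))"
    using i cl[OF \<alpha>] mono[OF \<alpha>] unfolding incr_seq_def by (simp add: tensor_simps(4))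
  from P.is_sup_csup[OF this] have "is_sup P (range (\<lambda>n. \<alpha> (down (x n)))) (\<alpha> I)" unfolding \<alpha>I .
  moreover have "\<alpha> (down (x n)) \<sqsubseteq>\<^bsub>P\<^esub> \<beta> I" for n
  proof -
    have "down (x n) \<subseteq> I" using gen_down(2)[OF x(1)] x(2) by blast
    then show ?thesis
      using P.le_trans[OF cl[OF \<alpha> xc] cl[OF \<beta> xc] cl[OF \<beta> I] d[OF below_seq_closed[OF x(1)]]
        mono[OF \<beta> xc I]] by blast
  qed
  ultimately show ?thesis using cl[OF \<beta> I] unfolding is_sup_def by blast
qed

end

theorem tensor_cu_semigroup:
  assumes "cu_semigroup S" "cu_semigroup T" shows "cu_semigroup (tensor S T)"
proof -
  interpret cu_pair S T using assms by (simp add: cu_pair_def)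
  show ?thesis by (rule tensor_cu_semigroup)
qed

theorem tens_cu_bimor:
  assumes "cu_semigroup S" "cu_semigroup T" shows "cu_bimor S T (tensor S T) (tens S T)"
proof -
  interpret cu_pair S T using assms by (simp add: cu_pair_def)
  show ?thesis by (rule tens_cu_bimor)
qed

theorem tensor_mor_le_iff:
  assumes "cu_semigroup S" "cu_semigroup T" "cu_semigroup P"
    and "\<alpha> \<in> gcu_mor (tensor S T) P" "\<beta> \<in> gcu_mor (tensor S T) P"
  shows "(\<forall>x\<in>carrier (tensor S T). \<alpha> x \<sqsubseteq>\<^bsub>P\<^esub> \<beta> x) \<longleftrightarrow>
    (\<forall>a\<in>carrier S. \<forall>b\<in>carrier T. \<alpha> (tens S T a b) \<sqsubseteq>\<^bsub>P\<^esub> \<beta> (tens S T a b))"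
proof -
  interpret cu_pair S T using assms by (simp add: cu_pair_def)
  have "tens S T a b \<in> carrier ST" if "a \<in> carrier S" "b \<in> carrier T" for a b
    unfolding tens_eq_down by (rule down_closed[OF single_closed[OF that]])
  then show ?thesis using tensor_gmor_le[OF assms(3-5)] by auto
qed

theorem tensor_universal:
  assumes "cu_semigroup S" "cu_semigroup T" "cu_semigroup P" and "cu_bimor S T P \<phi>"
  shows "\<exists>!\<alpha>. \<alpha> \<in> cu_mor (tensor S T) P \<and>
    (\<forall>a\<in>carrier S. \<forall>b\<in>carrier T. \<alpha> (tens S T a b) = \<phi> a b)"
proof -
  interpret cu_bimor_loc S T P \<phi>
    using assms by (simp add: cu_pair_def cu_bimor_loc_def cu_bimor_loc_axioms_def)
  show ?thesis
  proof (rule ex1I[of _ lft])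
    show l: "lft \<in> cu_mor ST P \<and> (\<forall>a\<in>carrier S. \<forall>b\<in>carrier T. lft (tens S T a b) = \<phi> a b)"
      using lft_cu_mor lft_tens by blast
    fix \<alpha> assume a: "\<alpha> \<in> cu_mor ST P \<and> (\<forall>a\<in>carrier S. \<forall>b\<in>carrier T. \<alpha> (tens S T a b) = \<phi> a b)"
    have g: "\<alpha> \<in> gcu_mor ST P" "lft \<in> gcu_mor ST P" using a l unfolding cu_mor_def by auto
    show "\<alpha> = lft"
    proof (rule PiE_ext)
      show "\<alpha> \<in> carrier ST \<rightarrow>\<^sub>E carrier P" "lft \<in> carrier ST \<rightarrow>\<^sub>E carrier P"
        using g unfolding gcu_mor_def by auto
      fix I assume I: "I \<in> carrier ST"
      have "\<alpha> I \<sqsubseteq>\<^bsub>P\<^esub> lft I"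
        using a l by (intro tensor_gmor_le[OF assms(3) g _ I]) (simp add: P.le_refl phi_closed)
      moreover have "lft I \<sqsubseteq>\<^bsub>P\<^esub> \<alpha> I"
        using a l by (intro tensor_gmor_le[OF assms(3) g(2,1) _ I]) (simp add: P.le_refl phi_closed)
      moreover have "\<alpha> I \<in> carrier P" using g(1) I unfolding gcu_mor_def by auto
      ultimately show "\<alpha> I = lft I" using P.le_antisym lft_closed[OF I] by blast
    qed
  qed
qed

corollary tensor_lift:
  assumes "cu_semigroup S" "cu_semigroup T" "cu_semigroup P" and "cu_bimor S T P \<phi>"
  shows "tensor_lift S T P \<phi> \<in> cu_mor (tensor S T) P"
    and "\<lbrakk>a \<in> carrier S; b \<in> carrier T\<rbrakk> \<Longrightarrow> tensor_lift S T P \<phi> (tens S T a b) = \<phi> a b"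
  using theI'[OF tensor_universal[OF assms]] unfolding tensor_lift_def by blast+

end

theory Submission
  imports Defs
begin

text \<open>
  Write \<open>e\<close> for the evaluation map, \<open>\<mu>\<close> for the multiplication and \<open>\<sigma>\<close> for the endpoint map. As
  \<open>\<sigma>(\<pi>(a))(b) = a b\<close>, one has \<open>\<epsilon> \<circ> \<pi> = id\<close> and \<open>e \<circ> (\<pi> \<otimes> id) = \<mu>\<close>, and most implications are formal
  consequences. If \<open>e\<close> is injective, then \<open>\<pi>(a) \<otimes> b = \<pi>(a b) \<otimes> 1\<close>, because \<open>e\<close> maps both sides to \<open>a b\<close>;
  applying \<open>\<epsilon>\<close> to formal sums transfers this to \<open>a \<otimes> b = a b \<otimes> 1\<close>, which makes \<open>\<mu>\<close> an isomorphism.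

  Over \<open>[0,\<infinity>]\<close> every generalized Cu-endomorphism is a multiplication, so the internal hom is a copy of
  \<open>M\<^sub>1\<close>. Tensoring with the divisible semigroup \<open>[0,\<infinity>]\<close> identifies compact and soft elements of the same
  value, hence \<open>e\<close> is an isomorphism, while \<open>\<epsilon>\<close> is not injective.

  Over \<open>M\<^sub>1\<close> every generalized Cu-endomorphism is again a multiplication, now with compact unit, so \<open>\<pi>\<close>
  is an isomorphism. But \<open>M\<^sub>1\<close> is not solid: a form on the real numbers that is linear over the rational
  numbers separates \<open>\<surd>2 \<otimes> 1\<close> from \<open>1 \<otimes> \<surd>2\<close>.
\<close>

section \<open>Paths indexed by rationals\<close>

text \<open>\<open>pi_map\<close> and \<open>eval_map\<close> are defined through the adjunction, so
  the Cu-structure of the internal hom and the inverse of \<open>hom_adj\<close> at a given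
  bimorphism have to be built first. The obstacle is that \<open>\<prec>\<close> is not known to
  interpolate, while a supremum of classes must again be represented by a path; this forces a
  stronger relation that does interpolate. The examples differ in the unit. It is compact in
  \<open>M1\<close>, so the values of a path at the unit approximate their supremum and the path can
  be recovered from them. In \<open>Pbar\<close> it is not, and the constant path at the identity
  shares its endpoint with a path of strictly smaller multiplications. Over \<open>Pbar\<close> the
  second factor of a tensor can be shrunk strictly. The gap between the products leaves room for a
  rational factor, which moves across the tensor sign, and a strict gap between endpoints no longer
  sees the difference between compact and soft. Compact elements of \<open>M1\<close> allow no such
  shrinking. The invariant that detects this is additive but not monotone, so it is compared only
  where the values agree and nothing is soft.\<close>

text \<open>The path is the left limit of a chain indexed by dyadic rationals. Taking suprema avoids a
  back-and-forth construction over the rationals.\<close>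

lemma interpolating_path:
  fixes A :: "'a set" and leq lt :: "'a \<Rightarrow> 'a \<Rightarrow> bool" and a :: "nat \<Rightarrow> 'a"
  assumes refl: "\<And>x. x \<in> A \<Longrightarrow> leq x x"
    and trans: "\<And>x y z. \<lbrakk>x \<in> A; y \<in> A; z \<in> A; leq x y; leq y z\<rbrakk> \<Longrightarrow> leq x z"
    and lub: "\<And>c :: nat \<Rightarrow> 'a. \<lbrakk>\<And>n. c n \<in> A; \<And>n. leq (c n) (c (Suc n))\<rbrakk> \<Longrightarrow>
      \<exists>s\<in>A. (\<forall>n. leq (c n) s) \<and> (\<forall>u\<in>A. (\<forall>n. leq (c n) u) \<longrightarrow> leq s u)"
    and ltA: "\<And>x y. lt x y \<Longrightarrow> x \<in> A \<and> y \<in> A"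
    and lt_leq: "\<And>x y. lt x y \<Longrightarrow> leq x y"
    and leq_lt: "\<And>x y z. \<lbrakk>x \<in> A; leq x y; lt y z\<rbrakk> \<Longrightarrow> lt x z"
    and lt_leq_trans: "\<And>x y z. \<lbrakk>lt x y; leq y z; z \<in> A\<rbrakk> \<Longrightarrow> lt x z"
    and interp: "\<And>x y. lt x y \<Longrightarrow> \<exists>z. lt x z \<and> lt z y"
    and a: "\<And>k. lt (a k) (a (Suc k))"
  shows "\<exists>h :: rat \<Rightarrow> 'a. (\<forall>x\<in>I_Q. h x \<in> A) \<and> (\<forall>x\<in>I_Q. \<forall>y\<in>I_Q. x < y \<longrightarrow> lt (h x) (h y)) \<and>
    (\<forall>k. \<exists>x\<in>I_Q. leq (a k) (h x)) \<and> (\<forall>x\<in>I_Q. \<exists>k. leq (h x) (a k))"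
proof -
  obtain mid where mid: "\<And>x y. lt x y \<Longrightarrow> lt x (mid x y) \<and> lt (mid x y) y"
    using interp by metis
  \<comment> \<open>\<open>Z n k\<close> sits at the dyadic point k / 2^n of the half-line. Passing
    to the next level keeps the old points at even positions and puts \<open>mid\<close> between
    neighbours.\<close>
  define Z where "Z = rec_nat a (\<lambda>n z k. if even k then z (k div 2) else mid (z (k div 2)) (z (Suc (k div 2))))"
  have Z0: "Z 0 k = a k" for k unfolding Z_def by simp
  have ZS: "Z (Suc n) k = (if even k then Z n (k div 2) else mid (Z n (k div 2)) (Z n (Suc (k div 2))))"
    for n k unfolding Z_def by simp
  have Zlt: "lt (Z n k) (Z n (Suc k))" for n k
  proof (induction n arbitrary: k)
    case 0 then show ?case using a by (simp add: Z0)
  next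
    case (Suc n) then show ?case using mid by (auto simp: ZS)
  qed
  have ZA: "Z n k \<in> A" for n k using Zlt ltA by blast
  have Zmono: "leq (Z n j) (Z n k)" if "j \<le> k" for n j k
    using that
  proof (induction k rule: dec_induct)
    case base show ?case using refl ZA .
  next
    case (step k) then show ?case using trans[OF ZA ZA ZA step.IH lt_leq[OF Zlt]] by simp
  qed
  have Zshift: "Z (n + m) (k * 2 ^ m) = Z n k" for n m k
    by (induction m arbitrary: k) (simp_all add: ZS mult.left_commute)
  have Zle: "leq (Z m j) (Z n k)" if "j * 2 ^ n \<le> k * 2 ^ m" for m n j k
    using Zmono[OF that, of "m + n"] Zshift[of m n j] Zshift[of n m k] by (simp add: add.commute)
  define fl where "fl y n = nat \<lfloor>y * 2 ^ n\<rfloor>" for y :: rat and n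
  have fl: "of_nat (fl y n) \<le> y * 2 ^ n" "y * 2 ^ n < of_nat (Suc (fl y n))" if "0 \<le> y" for y n
    using that unfolding fl_def by (simp_all add: of_nat_nat) linarith
  have le_nat: "j * 2 ^ n \<le> k * 2 ^ m" if "(of_nat j :: rat) \<le> y * 2 ^ m" "y * 2 ^ n \<le> of_nat k" for j k m n y
  proof -
    have "(of_nat j * 2 ^ n :: rat) \<le> y * 2 ^ m * 2 ^ n" using that by (simp add: mult_right_mono)
    also have "\<dots> = y * 2 ^ n * 2 ^ m" by simp
    also have "\<dots> \<le> of_nat k * 2 ^ m" using that by (simp add: mult_right_mono)
    finally have "(of_nat (j * 2 ^ n) :: rat) \<le> of_nat (k * 2 ^ m)" by simp
    then show ?thesis unfolding of_nat_le_iff .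
  qed
  have fl_step: "fl y n * 2 ^ Suc n \<le> fl y (Suc n) * 2 ^ n" if "0 \<le> y" for y n
  proof -
    have "(of_nat (2 * fl y n) :: rat) < of_nat (Suc (fl y (Suc n)))"
      using fl(1)[OF that, of n] fl(2)[OF that, of "Suc n"] by simp
    then have "2 * fl y n \<le> fl y (Suc n)" unfolding of_nat_less_iff by simp
    then show ?thesis by simp
  qed
  have "\<exists>s\<in>A. (\<forall>n. leq (Z n (fl y n)) s) \<and> (\<forall>u\<in>A. (\<forall>n. leq (Z n (fl y n)) u) \<longrightarrow> leq s u)" if "0 \<le> y" for y
    by (intro lub ZA Zle fl_step that)
  then obtain g where gA: "\<And>y. 0 \<le> y \<Longrightarrow> g y \<in> A" and gu: "\<And>y n. 0 \<le> y \<Longrightarrow> leq (Z n (fl y n)) (g y)"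
    and gl: "\<And>y u. \<lbrakk>0 \<le> y; u \<in> A; \<And>n. leq (Z n (fl y n)) u\<rbrakk> \<Longrightarrow> leq (g y) u"
    by metis
  have g_le: "leq (g y) (Z n k)" if "0 \<le> y" "y * 2 ^ n \<le> of_nat k" for y n k
    using fl(1)[OF that(1)] that(2) by (intro gl that(1) ZA Zle le_nat)
  have le_g: "leq (Z n k) (g y)" if "0 \<le> y" "of_nat k \<le> y * 2 ^ n" for y n k
  proof -
    have "(of_nat k :: rat) < of_nat (Suc (fl y n))" using that fl(2)[of y n] by linarith
    then have "k \<le> fl y n" unfolding of_nat_less_iff by simp
    then show ?thesis using trans[OF ZA ZA gA Zmono gu] that(1) by blast
  qed
  \<comment> \<open>A level n with 2 / 2^n < y - x has two consecutive dyadic points between x and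
    y, so one strict step of the chain separates the two left limits.\<close>
  have g_lt: "lt (g x) (g y)" if "0 \<le> x" "x < y" for x y
  proof -
    obtain n where "2 / (y - x) < of_nat n" using reals_Archimedean2 by blast
    moreover have "of_nat n \<le> (2::rat) ^ n"
      using of_nat_le_iff[of n "2 ^ n", where 'a = rat] less_exp[of n] by simp
    ultimately have "2 / (y - x) < 2 ^ n" by linarith
    then have *: "x * 2 ^ n + 2 < y * 2 ^ n" using that by (simp add: field_simps)
    have "lt (g x) (Z n (Suc (Suc (fl x n))))"
      using fl[OF that(1), of n] by (intro leq_lt[OF gA g_le Zlt] that(1)) simp
    then show ?thesis using fl[OF that(1), of n] that * by (elim lt_leq_trans) (auto intro!: le_g gA)
  qed
  \<comment> \<open>x / (1 - x) maps the rationals in (0,1) in increasing order onto the positive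
    rationals.\<close>
  define h where "h x = g (x / (1 - x))" for x :: rat
  show ?thesis
  proof (intro exI[of _ h] conjI ballI allI impI)
    fix x assume x: "x \<in> I_Q"
    then have p: "0 \<le> x / (1 - x)" by simp
    show "h x \<in> A" unfolding h_def by (rule gA[OF p])
    obtain k where "x / (1 - x) < of_nat k" using reals_Archimedean2 by blast
    then show "\<exists>k. leq (h x) (a k)" using g_le[OF p, of 0 k] unfolding h_def Z0 by auto
    fix y assume y: "y \<in> I_Q" "x < y"
    then have "x / (1 - x) < y / (1 - y)" using x by (simp add: field_simps)
    then show "lt (h x) (h y)" unfolding h_def by (rule g_lt[OF p])
  next
    fix k
    \<comment> \<open>This x corresponds to the point k + 1 of the half-line; the point k itself
      would give x = 0 when k = 0, outside \<open>I_Q\<close>.\<close>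
    define x :: rat where "x = of_nat (Suc k) / of_nat (Suc (Suc k))"
    have x: "x \<in> I_Q" "x / (1 - x) = of_nat (Suc k)" by (auto simp: x_def field_simps)
    have "leq (a k) (Z 0 (Suc k))" using lt_leq[OF Zlt, of 0 k] by (simp add: Z0)
    moreover have "leq (Z 0 (Suc k)) (h x)" unfolding h_def x(2) by (rule le_g) auto
    moreover have "h x \<in> A" unfolding h_def x(2) by (rule gA) simp
    ultimately have "leq (a k) (h x)" using trans[of "a k" "Z 0 (Suc k)" "h x"] ZA[of 0] by (simp add: Z0)
    then show "\<exists>x\<in>I_Q. leq (a k) (h x)" using x(1) by (rule bexI)
  qed
qed

text \<open>(O2) with the index set of paths: composing such a family with the slices of a
  bimorphism gives a path at once. Cofinality is recorded for \<open>\<lless>\<close>, so that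
  families of comparable elements can be matched index by index.\<close>

definition approx_path :: "('a, 'm) cu_sg_scheme \<Rightarrow> 'a \<Rightarrow> (rat \<Rightarrow> 'a) \<Rightarrow> bool" where
  "approx_path S a p \<longleftrightarrow> (\<forall>s\<in>I_Q. \<forall>t\<in>I_Q. s < t \<longrightarrow> p s \<lless>\<^bsub>S\<^esub> p t) \<and> (\<forall>t\<in>I_Q. p t \<lless>\<^bsub>S\<^esub> a) \<and>
    (\<forall>x. x \<lless>\<^bsub>S\<^esub> a \<longrightarrow> (\<exists>t\<in>I_Q. x \<lless>\<^bsub>S\<^esub> p t)) \<and> is_sup S (p ` I_Q) a"

context cu_semigroup
begin

lemma way_below_interpolate:
  assumes "x \<lless> y" shows "\<exists>z. x \<lless> z \<and> z \<lless> y"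
proof -
  obtain c where c: "\<And>n. c n \<lless> c (Suc n)" "\<And>n. c n \<lless> y" "incr_seq S c" "is_sup S (range c) y"
    by (rule O2_seq[OF way_below_closed(2)[OF assms]]) (rule that)
  obtain k where k: "x \<sqsubseteq> c k" using way_below_seq[OF assms c(3,4)] by blast
  show ?thesis using le_way_below_trans[OF k c(1) way_below_closed(1)[OF assms]] c(2) by blast
qed

lemma approx_path_exists:
  assumes "a \<in> carrier S" shows "\<exists>p. approx_path S a p"
proof -
  obtain c where c: "\<And>n. c n \<lless> c (Suc n)" "\<And>n. c n \<lless> a" "incr_seq S c" "is_sup S (range c) a"
    by (rule O2_seq[OF assms]) (rule that)
  have cc: "c n \<in> carrier S" for n using c(2) way_below_closed by blast
  have "\<exists>h :: rat \<Rightarrow> 'a. (\<forall>x\<in>I_Q. h x \<in> carrier S) \<and> (\<forall>x\<in>I_Q. \<forall>y\<in>I_Q. x < y \<longrightarrow> h x \<lless> h y) \<and>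
    (\<forall>k. \<exists>x\<in>I_Q. c k \<sqsubseteq> h x) \<and> (\<forall>x\<in>I_Q. \<exists>k. h x \<sqsubseteq> c k)"
  proof (rule interpolating_path)
    fix d :: "nat \<Rightarrow> 'a" assume "\<And>n. d n \<in> carrier S" "\<And>n. d n \<sqsubseteq> d (Suc n)"
    then have "\<exists>s. is_sup S (range d) s" by (intro O1) (simp add: incr_seq_def)
    then show "\<exists>s\<in>carrier S. (\<forall>n. d n \<sqsubseteq> s) \<and> (\<forall>u\<in>carrier S. (\<forall>n. d n \<sqsubseteq> u) \<longrightarrow> s \<sqsubseteq> u)"
      unfolding is_sup_def by auto
  qed (rule c(1) | (rule le_refl le_trans way_below_le le_way_below_trans way_below_le_trans
        way_below_interpolate; assumption) | use way_below_closed in blast)+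
  then obtain h where h: "\<And>x. x \<in> I_Q \<Longrightarrow> h x \<in> carrier S"
    "\<And>x y. \<lbrakk>x \<in> I_Q; y \<in> I_Q; x < y\<rbrakk> \<Longrightarrow> h x \<lless> h y"
    "\<And>k. \<exists>x\<in>I_Q. c k \<sqsubseteq> h x" "\<And>x. x \<in> I_Q \<Longrightarrow> \<exists>k. h x \<sqsubseteq> c k" by blast
  have wb: "h t \<lless> a" if t: "t \<in> I_Q" for t
    using h(4)[OF t] le_way_below_trans[OF _ c(2) h(1)[OF t]] by blast
  have cof: "\<exists>t\<in>I_Q. x \<lless> h t" if x: "x \<lless> a" for x
  proof -
    obtain k where k: "x \<sqsubseteq> c k" using way_below_seq[OF x c(3,4)] by blast
    then have "x \<lless> c (Suc k)" using le_way_below_trans c(1) way_below_closed(1)[OF x] by blast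
    then show ?thesis using h(3)[of "Suc k"] h(1) way_below_le_trans by blast
  qed
  have "is_sup S (h ` I_Q) a" unfolding is_sup_def
  proof (intro conjI ballI impI assms)
    show "x \<sqsubseteq> a" if "x \<in> h ` I_Q" for x using that wb way_below_le by blast
    fix u assume u: "u \<in> carrier S" "\<forall>x\<in>h ` I_Q. x \<sqsubseteq> u"
    have "c k \<sqsubseteq> u" for k using h(3)[of k] u le_trans[OF cc h(1) u(1)] by blast
    then show "a \<sqsubseteq> u" using c(4) u(1) unfolding is_sup_def by blast
  qed
  then show ?thesis unfolding approx_path_def using h(2) wb cof by blast
qed

end

section \<open>Generalized Cu-morphisms\<close>

lemma I_Q_mid: "\<lbrakk>s < t; s \<in> I_Q; t \<in> I_Q\<rbrakk> \<Longrightarrow> \<exists>u\<in>I_Q. s < u \<and> u < (t :: rat)"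
  using dense[of s t] by auto

lemma I_Q_above: "s \<in> I_Q \<Longrightarrow> \<exists>u\<in>I_Q. s < (u :: rat)"
  using dense[of s 1] by auto

lemma I_Q_above2: "\<lbrakk>s \<in> I_Q; t \<in> I_Q\<rbrakk> \<Longrightarrow> \<exists>u\<in>I_Q. s < u \<and> t < (u :: rat)"
  using I_Q_above[of s] I_Q_above[of t] by (meson le_less_trans less_trans linear)

lemma I_Q_mult: "\<lbrakk>s \<in> I_Q; t \<in> I_Q\<rbrakk> \<Longrightarrow> s * t \<in> (I_Q :: rat set) \<and> s * t < s"
  using mult_strict_left_mono[of t 1 s] mult_strict_mono[of s 1 t 1] by auto

text \<open>A cofinal sequence in \<open>I_Q\<close>: it turns suprema over paths into suprema over
  sequences, to which (O1) and (O4) apply. The offset 2 keeps \<open>uq 0\<close> = 1/2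
  positive.\<close>

definition uq :: "nat \<Rightarrow> rat" where "uq n = 1 - 1 / of_nat (n + 2)"

lemma uq_I_Q: "uq n \<in> I_Q"
  unfolding uq_def by (auto simp: field_simps)

lemma uq_less: "m < n \<Longrightarrow> uq m < uq n"
  unfolding uq_def by (simp add: frac_less2)

lemma uq_cofinal: assumes "t \<in> I_Q" shows "\<exists>n. t < uq n"
proof -
  obtain n where n: "1 / (1 - t) < of_nat n" using reals_Archimedean2 by blast
  then have "1 < of_nat (n + 2) * (1 - t)" using assms by (simp add: field_simps)
  then have "t < uq n" unfolding uq_def by (simp add: field_simps)
  then show ?thesis ..
qed

context cu_pair
begin

abbreviation G :: "('a \<Rightarrow> 'b) set" where "G \<equiv> gcu_mor S T"

abbreviation gmor_prec (infix \<open>\<prec>\<close> 50) where "f \<prec> g \<equiv> gcu_below S T f g"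

definition gmor_le (infix \<open>\<preceq>\<close> 50) where "f \<preceq> g \<longleftrightarrow> (\<forall>a\<in>carrier S. f a \<sqsubseteq>\<^bsub>T\<^esub> g a)"

lemma gmor_closed: "\<lbrakk>f \<in> G; a \<in> carrier S\<rbrakk> \<Longrightarrow> f a \<in> carrier T"
  and gmor_add: "\<lbrakk>f \<in> G; a \<in> carrier S; b \<in> carrier S\<rbrakk> \<Longrightarrow> f (a \<oplus>\<^bsub>S\<^esub> b) = f a \<oplus>\<^bsub>T\<^esub> f b"
  and gmor_zero: "f \<in> G \<Longrightarrow> f \<zero>\<^bsub>S\<^esub> = \<zero>\<^bsub>T\<^esub>"
  and gmor_mono: "\<lbrakk>f \<in> G; a \<in> carrier S; b \<in> carrier S; a \<sqsubseteq>\<^bsub>S\<^esub> b\<rbrakk> \<Longrightarrow> f a \<sqsubseteq>\<^bsub>T\<^esub> f b"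
  and gmor_csup: "\<lbrakk>f \<in> G; incr_seq S c\<rbrakk> \<Longrightarrow> f (csup S (range c)) = csup T (range (\<lambda>n. f (c n)))"
  and gmor_ext: "f \<in> G \<Longrightarrow> f \<in> extensional (carrier S)"
  unfolding gcu_mor_def by (auto simp: PiE_def)

lemma gmor_incr: "\<lbrakk>f \<in> G; incr_seq S c\<rbrakk> \<Longrightarrow> incr_seq T (\<lambda>n. f (c n))"
  unfolding incr_seq_def using gmor_closed gmor_mono by blast

lemma gmor_sup:
  assumes "f \<in> G" "incr_seq S c" "is_sup S (range c) s"
  shows "is_sup T (range (\<lambda>n. f (c n))) (f s)"
  using T.is_sup_csup[OF gmor_incr[OF assms(1,2)]] gmor_csup[OF assms(1,2)] S.csup_eq[OF assms(3)] by simp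

lemma gmorI:
  assumes "f \<in> extensional (carrier S)" "\<And>a. a \<in> carrier S \<Longrightarrow> f a \<in> carrier T"
    "\<And>a b. \<lbrakk>a \<in> carrier S; b \<in> carrier S\<rbrakk> \<Longrightarrow> f (a \<oplus>\<^bsub>S\<^esub> b) = f a \<oplus>\<^bsub>T\<^esub> f b" "f \<zero>\<^bsub>S\<^esub> = \<zero>\<^bsub>T\<^esub>"
    "\<And>a b. \<lbrakk>a \<in> carrier S; b \<in> carrier S; a \<sqsubseteq>\<^bsub>S\<^esub> b\<rbrakk> \<Longrightarrow> f a \<sqsubseteq>\<^bsub>T\<^esub> f b"
    "\<And>c s. \<lbrakk>incr_seq S c; is_sup S (range c) s\<rbrakk> \<Longrightarrow> is_sup T (range (\<lambda>n. f (c n))) (f s)"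
  shows "f \<in> G"
  unfolding gcu_mor_def
proof (intro CollectI conjI ballI allI impI)
  show "f \<in> carrier S \<rightarrow>\<^sub>E carrier T" using assms(1,2) by (auto simp: PiE_def)
  show "f (csup S (range c)) = csup T (range (\<lambda>n. f (c n)))" if "incr_seq S c" for c
    using T.csup_eq[OF assms(6)[OF that S.is_sup_csup[OF that]]] by simp
qed (use assms in auto)

lemma gmor_le_refl: "f \<in> G \<Longrightarrow> f \<preceq> f"
  unfolding gmor_le_def using T.le_refl gmor_closed by blast

lemma gmor_le_trans: "\<lbrakk>f \<in> G; g \<in> G; h \<in> G; f \<preceq> g; g \<preceq> h\<rbrakk> \<Longrightarrow> f \<preceq> h"
  unfolding gmor_le_def using T.le_trans[OF gmor_closed gmor_closed gmor_closed] by blast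

text \<open>\<open>\<prec>\<close> compares values at different arguments. Approximating a from way
  below and using continuity of f brings both values to the same argument.\<close>

lemma prec_le: assumes "f \<in> G" "g \<in> G" "f \<prec> g" shows "f \<preceq> g"
  unfolding gmor_le_def
proof
  fix a assume a: "a \<in> carrier S"
  note A = S.approx_seq[OF a]
  have "f (S.approx_seq a n) \<sqsubseteq>\<^bsub>T\<^esub> g a" for n
    using assms(3) A(2) T.way_below_le unfolding gcu_below_def by blast
  then show "f a \<sqsubseteq>\<^bsub>T\<^esub> g a"
    using gmor_sup[OF assms(1) A(3,4)] gmor_closed[OF assms(2) a] unfolding is_sup_def by auto
qed

lemma le_prec_trans: "\<lbrakk>f \<in> G; f \<preceq> g; g \<prec> h\<rbrakk> \<Longrightarrow> f \<prec> h"
  unfolding gcu_below_def gmor_le_def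
  using T.le_way_below_trans gmor_closed S.way_below_closed by blast

lemma prec_le_trans: "\<lbrakk>f \<prec> g; g \<preceq> h; h \<in> G\<rbrakk> \<Longrightarrow> f \<prec> h"
  unfolding gcu_below_def gmor_le_def
  using T.way_below_le_trans gmor_closed S.way_below_closed by blast

lemma prec_trans: "\<lbrakk>f \<in> G; g \<in> G; f \<prec> g; g \<prec> h\<rbrakk> \<Longrightarrow> f \<prec> h"
  using le_prec_trans prec_le by blast

text \<open>Pointwise suprema work: (O4) gives additivity, and exchanging two suprema gives
  continuity. This supplies the assumption \<open>lub\<close> when \<open>interpolating_path\<close>
  is applied to morphisms.\<close>

lemma gmor_lub:
  assumes g: "\<And>n::nat. g n \<in> G" and inc: "\<And>n. g n \<preceq> g (Suc n)"
  shows "\<exists>s\<in>G. (\<forall>n. g n \<preceq> s) \<and> (\<forall>u\<in>G. (\<forall>n. g n \<preceq> u) \<longrightarrow> s \<preceq> u)"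
proof -
  define s where "s = (\<lambda>a\<in>carrier S. csup T (range (\<lambda>n. g n a)))"
  have i: "incr_seq T (\<lambda>n. g n a)" if "a \<in> carrier S" for a
    unfolding incr_seq_def using that gmor_closed[OF g] inc unfolding gmor_le_def by blast
  have s: "is_sup T (range (\<lambda>n. g n a)) (s a)" if "a \<in> carrier S" for a
    using T.is_sup_csup[OF i[OF that]] that by (simp add: s_def)
  then have sc: "s a \<in> carrier T" and su: "\<And>n. g n a \<sqsubseteq>\<^bsub>T\<^esub> s a"
    and sl: "\<And>u. \<lbrakk>u \<in> carrier T; \<And>n. g n a \<sqsubseteq>\<^bsub>T\<^esub> u\<rbrakk> \<Longrightarrow> s a \<sqsubseteq>\<^bsub>T\<^esub> u" if "a \<in> carrier S" for a
    using that unfolding is_sup_def by auto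
  have mono: "s a \<sqsubseteq>\<^bsub>T\<^esub> s b" if ab: "a \<in> carrier S" "b \<in> carrier S" "a \<sqsubseteq>\<^bsub>S\<^esub> b" for a b
    using T.le_trans[OF gmor_closed[OF g ab(1)] gmor_closed[OF g ab(2)] sc[OF ab(2)]
        gmor_mono[OF g ab] su[OF ab(2)]] by (intro sl[OF ab(1)] sc[OF ab(2)])
  have "s \<in> G"
  proof (rule gmorI)
    show "s \<in> extensional (carrier S)" unfolding s_def by simp
    show "s (a \<oplus>\<^bsub>S\<^esub> b) = s a \<oplus>\<^bsub>T\<^esub> s b" if "a \<in> carrier S" "b \<in> carrier S" for a b
      using T.O4[OF i[OF that(1)] i[OF that(2)]] gmor_add[OF g that] that
      by (simp add: s_def S.add_closed)
    show "s \<zero>\<^bsub>S\<^esub> = \<zero>\<^bsub>T\<^esub>"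
      using T.csup_eq[OF T.is_sup_const[OF T.zero_closed]] gmor_zero[OF g] S.zero_closed by (simp add: s_def)
    show "is_sup T (range (\<lambda>n. s (c n))) (s t)" if c: "incr_seq S c" "is_sup S (range c) t" for c t
      unfolding is_sup_def
    proof (intro conjI ballI impI)
      have cc: "c n \<in> carrier S" "c n \<sqsubseteq>\<^bsub>S\<^esub> t" for n using c unfolding incr_seq_def is_sup_def by auto
      have t: "t \<in> carrier S" using c unfolding is_sup_def by auto
      show "s t \<in> carrier T" by (rule sc[OF t])
      show "x \<sqsubseteq>\<^bsub>T\<^esub> s t" if "x \<in> range (\<lambda>n. s (c n))" for x
        using that mono[OF cc(1) t cc(2)] by blast
      fix u assume u: "u \<in> carrier T" "\<forall>x\<in>range (\<lambda>n. s (c n)). x \<sqsubseteq>\<^bsub>T\<^esub> u"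
      have "g n (c k) \<sqsubseteq>\<^bsub>T\<^esub> u" for n k
        using T.le_trans[OF gmor_closed[OF g cc(1)] sc[OF cc(1)] u(1) su[OF cc(1)]] u(2) by blast
      then have "g n t \<sqsubseteq>\<^bsub>T\<^esub> u" for n using gmor_sup[OF g c] u(1) unfolding is_sup_def by blast
      then show "s t \<sqsubseteq>\<^bsub>T\<^esub> u" by (intro sl[OF t] u(1))
    qed
  qed (use sc mono in auto)
  then show ?thesis unfolding gmor_le_def using su sl gmor_closed by blast
qed

end

section \<open>The internal hom is a Cu-semigroup\<close>

lemma (in pos_ordered_semigroup) add_interchange:
  assumes "a \<in> carrier S" "b \<in> carrier S" "c \<in> carrier S" "d \<in> carrier S"
  shows "(a \<oplus> b) \<oplus> (c \<oplus> d) = (a \<oplus> c) \<oplus> (b \<oplus> d)"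
proof -
  have "(a \<oplus> b) \<oplus> (c \<oplus> d) = a \<oplus> ((b \<oplus> c) \<oplus> d)"
    by (simp add: add_assoc add_closed assms)
  also have "b \<oplus> c = c \<oplus> b" by (rule add_comm) (use assms in auto)
  also have "a \<oplus> ((c \<oplus> b) \<oplus> d) = (a \<oplus> c) \<oplus> (b \<oplus> d)"
    by (simp add: add_assoc add_closed assms)
  finally show ?thesis .
qed

section \<open>Paths modulo equivalence as an ordered monoid\<close>

context cu_pair
begin

abbreviation Paths :: "(rat \<Rightarrow> 'a \<Rightarrow> 'b) set" where "Paths \<equiv> paths S T"

abbreviation path_lesssim (infix \<open>\<lesssim>\<close> 50) where "f \<lesssim> g \<equiv> path_le S T f g"

abbreviation H :: "(rat \<Rightarrow> 'a \<Rightarrow> 'b) set cu_sg" where "H \<equiv> ihom S T"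

abbreviation pcls :: "(rat \<Rightarrow> 'a \<Rightarrow> 'b) \<Rightarrow> (rat \<Rightarrow> 'a \<Rightarrow> 'b) set" where "pcls \<equiv> path_class S T"

lemma path_gmor: "\<lbrakk>f \<in> Paths; l \<in> I_Q\<rbrakk> \<Longrightarrow> f l \<in> G"
  unfolding paths_def by auto

lemma path_prec: "\<lbrakk>f \<in> Paths; k \<in> I_Q; l \<in> I_Q; k < l\<rbrakk> \<Longrightarrow> f k \<prec> f l"
  unfolding paths_def by auto

lemma pathsI:
  assumes "f \<in> extensional I_Q" "\<And>l. l \<in> I_Q \<Longrightarrow> f l \<in> G"
    "\<And>k l. \<lbrakk>k \<in> I_Q; l \<in> I_Q; k < l\<rbrakk> \<Longrightarrow> f k \<prec> f l"
  shows "f \<in> Paths"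
  using assms unfolding paths_def by (auto simp: PiE_def)

lemma path_mono:
  assumes "f \<in> Paths" "k \<in> I_Q" "l \<in> I_Q" "k \<le> l" shows "f k \<preceq> f l"
  using assms path_prec prec_le[OF path_gmor path_gmor] gmor_le_refl[OF path_gmor]
  by (cases "k = l") auto

lemma path_leI: "(\<And>l. l \<in> I_Q \<Longrightarrow> \<exists>m\<in>I_Q. f l \<prec> g m) \<Longrightarrow> f \<lesssim> g"
  and path_leD: "\<lbrakk>f \<lesssim> g; l \<in> I_Q\<rbrakk> \<Longrightarrow> \<exists>m\<in>I_Q. f l \<prec> g m"
  unfolding path_le_def by auto

lemma path_le_refl: "f \<in> Paths \<Longrightarrow> f \<lesssim> f"
  using path_prec I_Q_above by (intro path_leI) blast

lemma path_le_trans: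
  assumes "f \<in> Paths" "g \<in> Paths" "h \<in> Paths" "f \<lesssim> g" "g \<lesssim> h" shows "f \<lesssim> h"
proof (rule path_leI)
  fix l assume l: "l \<in> I_Q"
  then obtain m n where "m \<in> I_Q" "f l \<prec> g m" "n \<in> I_Q" "g m \<prec> h n" using assms path_leD by meson
  then show "\<exists>m\<in>I_Q. f l \<prec> h m" using prec_trans path_gmor assms l by blast
qed

text \<open>Domination by some g m suffices, because g itself supplies the missing
  \<open>\<prec>\<close> in passing from m to a larger index.\<close>

lemma path_le_weakI:
  assumes "f \<in> Paths" "g \<in> Paths" "\<And>l. l \<in> I_Q \<Longrightarrow> \<exists>m\<in>I_Q. f l \<preceq> g m" shows "f \<lesssim> g"
proof (rule path_leI)
  fix l assume l: "l \<in> I_Q"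
  obtain m where m: "m \<in> I_Q" "f l \<preceq> g m" using assms(3)[OF l] by blast
  obtain n where "n \<in> I_Q" "m < n" using I_Q_above m by blast
  then show "\<exists>m\<in>I_Q. f l \<prec> g m"
    using le_prec_trans[OF path_gmor[OF assms(1) l] m(2) path_prec[OF assms(2)]] m by blast
qed

lemma pcls_self: "f \<in> Paths \<Longrightarrow> f \<in> pcls f"
  unfolding path_class_def using path_le_refl by auto

lemma pcls_mem: "g \<in> pcls f \<longleftrightarrow> g \<in> Paths \<and> f \<lesssim> g \<and> g \<lesssim> f"
  unfolding path_class_def by auto

lemma pcls_eqI: "\<lbrakk>f \<in> Paths; g \<in> Paths; f \<lesssim> g; g \<lesssim> f\<rbrakk> \<Longrightarrow> pcls f = pcls g"
  unfolding path_class_def using path_le_trans by blast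

lemma H_carrier: "X \<in> carrier H \<longleftrightarrow> (\<exists>f\<in>Paths. X = pcls f)"
  unfolding ihom_def by auto

lemma pcls_closed: "f \<in> Paths \<Longrightarrow> pcls f \<in> carrier H"
  unfolding H_carrier by blast

lemma H_le: assumes "f \<in> Paths" "g \<in> Paths" shows "pcls f \<sqsubseteq>\<^bsub>H\<^esub> pcls g \<longleftrightarrow> f \<lesssim> g"
proof
  assume "pcls f \<sqsubseteq>\<^bsub>H\<^esub> pcls g"
  then obtain f' g' where "f' \<in> pcls f" "g' \<in> pcls g" "f' \<lesssim> g'" unfolding ihom_def by auto
  then have f: "f' \<in> Paths" "f \<lesssim> f'" and g: "g' \<in> Paths" "g' \<lesssim> g" and "f' \<lesssim> g'"
    unfolding pcls_mem by auto
  then have "f \<lesssim> g'" using path_le_trans[OF assms(1) f(1) g(1)] by blast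
  then show "f \<lesssim> g" by (rule path_le_trans[OF assms(1) g(1) assms(2) _ g(2)])
qed (use pcls_self assms in \<open>auto simp: ihom_def\<close>)

lemma gmor_plus:
  assumes "f \<in> G" "g \<in> G" shows "(\<lambda>a\<in>carrier S. f a \<oplus>\<^bsub>T\<^esub> g a) \<in> G"
proof (rule gmorI)
  show "(\<lambda>a\<in>carrier S. f a \<oplus>\<^bsub>T\<^esub> g a) (a \<oplus>\<^bsub>S\<^esub> b) =
      (\<lambda>a\<in>carrier S. f a \<oplus>\<^bsub>T\<^esub> g a) a \<oplus>\<^bsub>T\<^esub> (\<lambda>a\<in>carrier S. f a \<oplus>\<^bsub>T\<^esub> g a) b"
    if ab: "a \<in> carrier S" "b \<in> carrier S" for a b
  proof -
    have c: "f a \<in> carrier T" "g a \<in> carrier T" "f b \<in> carrier T" "g b \<in> carrier T"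
      using assms ab gmor_closed by blast+
    show ?thesis
      using ab T.add_interchange[OF c(1,3,2,4)] gmor_add[OF assms(1) ab] gmor_add[OF assms(2) ab]
      by (simp add: S.add_closed)
  qed
  show "is_sup T (range (\<lambda>n. (\<lambda>a\<in>carrier S. f a \<oplus>\<^bsub>T\<^esub> g a) (c n))) ((\<lambda>a\<in>carrier S. f a \<oplus>\<^bsub>T\<^esub> g a) s)"
    if c: "incr_seq S c" "is_sup S (range c) s" for c s
  proof -
    have cc: "\<And>n. c n \<in> carrier S" and s: "s \<in> carrier S" using c unfolding incr_seq_def is_sup_def by auto
    note i = gmor_incr[OF assms(1) c(1)] gmor_incr[OF assms(2) c(1)]
    have "incr_seq T (\<lambda>n. f (c n) \<oplus>\<^bsub>T\<^esub> g (c n))"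
      using i unfolding incr_seq_def by (simp add: T.add_mono2 T.add_closed)
    from T.is_sup_csup[OF this]
    have "is_sup T (range (\<lambda>n. f (c n) \<oplus>\<^bsub>T\<^esub> g (c n))) (f s \<oplus>\<^bsub>T\<^esub> g s)"
      using T.O4[OF i] T.csup_eq[OF gmor_sup[OF assms(1) c]] T.csup_eq[OF gmor_sup[OF assms(2) c]] by simp
    then show ?thesis using cc s by simp
  qed
next
  fix a assume "a \<in> carrier S"
  then show "(\<lambda>a\<in>carrier S. f a \<oplus>\<^bsub>T\<^esub> g a) a \<in> carrier T"
    using gmor_closed[OF assms(1)] gmor_closed[OF assms(2)] T.add_closed by simp
next
  show "(\<lambda>a\<in>carrier S. f a \<oplus>\<^bsub>T\<^esub> g a) \<zero>\<^bsub>S\<^esub> = \<zero>\<^bsub>T\<^esub>"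
    using gmor_zero[OF assms(1)] gmor_zero[OF assms(2)] T.add_zero T.zero_closed S.zero_closed by simp
next
  fix a b assume ab: "a \<in> carrier S" "b \<in> carrier S" "a \<sqsubseteq>\<^bsub>S\<^esub> b"
  then show "(\<lambda>a\<in>carrier S. f a \<oplus>\<^bsub>T\<^esub> g a) a \<sqsubseteq>\<^bsub>T\<^esub> (\<lambda>a\<in>carrier S. f a \<oplus>\<^bsub>T\<^esub> g a) b"
    using T.add_mono2 gmor_closed[OF assms(1)] gmor_closed[OF assms(2)]
      gmor_mono[OF assms(1) ab] gmor_mono[OF assms(2) ab] by simp
qed simp_all

lemma prec_plus:
  assumes "f \<prec> f'" "g \<prec> g'"
  shows "(\<lambda>a\<in>carrier S. f a \<oplus>\<^bsub>T\<^esub> g a) \<prec> (\<lambda>a\<in>carrier S. f' a \<oplus>\<^bsub>T\<^esub> g' a)"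
  using assms unfolding gcu_below_def by (auto simp: S.way_below_closed T.O3)

lemma path_add_app: "l \<in> I_Q \<Longrightarrow> path_add S T f g l = (\<lambda>a\<in>carrier S. f l a \<oplus>\<^bsub>T\<^esub> g l a)"
  unfolding path_add_def by simp

lemma path_add_closed: assumes "f \<in> Paths" "g \<in> Paths" shows "path_add S T f g \<in> Paths"
proof (rule pathsI)
  show "path_add S T f g \<in> extensional I_Q" unfolding path_add_def by simp
qed (use assms in \<open>simp_all only: path_add_app gmor_plus prec_plus path_gmor path_prec\<close>)

lemma path_add_mono:
  assumes f: "f \<in> Paths" "f' \<in> Paths" "f \<lesssim> f'" and g: "g \<in> Paths" "g' \<in> Paths" "g \<lesssim> g'"
  shows "path_add S T f g \<lesssim> path_add S T f' g'"
proof (rule path_leI)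
  fix l assume l: "l \<in> I_Q"
  obtain m n where m: "m \<in> I_Q" "f l \<prec> f' m" and n: "n \<in> I_Q" "g l \<prec> g' n"
    using path_leD f g l by meson
  have k: "max m n \<in> I_Q" using m n by (simp add: max_def)
  have "f l \<prec> f' (max m n)" "g l \<prec> g' (max m n)"
    using prec_le_trans[OF m(2) path_mono[OF f(2)]] prec_le_trans[OF n(2) path_mono[OF g(2)]] m n k
      path_gmor f g by auto
  then have "path_add S T f g l \<prec> path_add S T f' g' (max m n)"
    unfolding path_add_app[OF l] path_add_app[OF k] by (rule prec_plus)
  then show "\<exists>m\<in>I_Q. path_add S T f g l \<prec> path_add S T f' g' m" using k by blast
qed

text \<open>The union over representatives in the definition of addition collapses: by monotonicity
  of \<open>path_add\<close> all its members are the same class.\<close>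

lemma H_add:
  assumes "f \<in> Paths" "g \<in> Paths" shows "pcls f \<oplus>\<^bsub>H\<^esub> pcls g = pcls (path_add S T f g)"
proof -
  have "pcls (path_add S T f' g') = pcls (path_add S T f g)" if "f' \<in> pcls f" "g' \<in> pcls g" for f' g'
    using that assms by (intro pcls_eqI path_add_closed path_add_mono) (auto simp: pcls_mem)
  then have "(\<Union>f'\<in>pcls f. \<Union>g'\<in>pcls g. pcls (path_add S T f' g')) = (\<Union>f'\<in>pcls f. \<Union>g'\<in>pcls g. pcls (path_add S T f g))"
    by simp
  also have "\<dots> = pcls (path_add S T f g)" using pcls_self[OF assms(1)] pcls_self[OF assms(2)] by fast
  finally show ?thesis unfolding ihom_def by simp
qed

definition path_zero :: "rat \<Rightarrow> 'a \<Rightarrow> 'b" where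
  "path_zero = (\<lambda>l\<in>I_Q. \<lambda>a\<in>carrier S. \<zero>\<^bsub>T\<^esub>)"

lemma H_zero: "\<zero>\<^bsub>H\<^esub> = pcls path_zero"
  unfolding ihom_def path_zero_def by simp

lemma gmor_const_zero: "(\<lambda>a\<in>carrier S. \<zero>\<^bsub>T\<^esub>) \<in> G"
proof (rule gmorI)
  fix c s assume c: "incr_seq S c" "is_sup S (range c) s"
  have "range (\<lambda>n. (\<lambda>a\<in>carrier S. \<zero>\<^bsub>T\<^esub>) (c n)) = range (\<lambda>n::nat. \<zero>\<^bsub>T\<^esub>)" "s \<in> carrier S"
    using c unfolding incr_seq_def is_sup_def by auto
  then show "is_sup T (range (\<lambda>n. (\<lambda>a\<in>carrier S. \<zero>\<^bsub>T\<^esub>) (c n))) ((\<lambda>a\<in>carrier S. \<zero>\<^bsub>T\<^esub>) s)"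
    using T.is_sup_const[OF T.zero_closed] by simp
qed (auto simp: T.zero_closed T.add_zero S.add_closed S.zero_closed T.le_refl)

lemma zero_prec: "f \<in> G \<Longrightarrow> (\<lambda>a\<in>carrier S. \<zero>\<^bsub>T\<^esub>) \<prec> f"
  unfolding gcu_below_def using T.zero_way_below gmor_closed S.way_below_closed by simp

lemma path_zero_closed: "path_zero \<in> Paths"
  by (rule pathsI) (auto simp: path_zero_def gmor_const_zero zero_prec)

text \<open>The part of f before l, rescaled to the whole index set so that it is a path again.
  These classes serve as the canonical elements way below the class of f.\<close>

definition cut :: "(rat \<Rightarrow> 'a \<Rightarrow> 'b) \<Rightarrow> rat \<Rightarrow> rat \<Rightarrow> 'a \<Rightarrow> 'b" where
  "cut f l = (\<lambda>t\<in>I_Q. f (l * t))"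

lemma cut_closed: assumes "f \<in> Paths" "l \<in> I_Q" shows "cut f l \<in> Paths"
proof (rule pathsI)
  show "cut f l k \<prec> cut f l m" if km: "k \<in> I_Q" "m \<in> I_Q" "k < m" for k m
  proof -
    have "l * k < l * m" using km assms by simp
    then show ?thesis using path_prec[OF assms(1)] I_Q_mult[OF assms(2)] km unfolding cut_def by simp
  qed
qed (use path_gmor[OF assms(1)] I_Q_mult[OF assms(2)] in \<open>auto simp: cut_def\<close>)

lemma cut_prec: "\<lbrakk>f \<in> Paths; l \<in> I_Q; k \<in> I_Q\<rbrakk> \<Longrightarrow> cut f l k \<prec> f l"
  using path_prec[of f "l * k" l] I_Q_mult[of l k] unfolding cut_def by auto

text \<open>Unlike \<open>\<prec>\<close>, this relation always interpolates.\<close>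

definition pprec (infix \<open>\<prec>\<prec>\<close> 50) where
  "p \<prec>\<prec> q \<longleftrightarrow> p \<in> G \<and> q \<in> G \<and> (\<exists>f\<in>Paths. \<exists>s\<in>I_Q. \<exists>t\<in>I_Q. s < t \<and> p \<preceq> f s \<and> f t \<preceq> q)"

lemma pprec_prec: assumes "p \<prec>\<prec> q" shows "p \<prec> q"
proof -
  obtain f s t where f: "p \<in> G" "q \<in> G" "f \<in> Paths" "s \<in> I_Q" "t \<in> I_Q" "s < t" "p \<preceq> f s" "f t \<preceq> q"
    using assms unfolding pprec_def by blast
  then show ?thesis
    using prec_le_trans[OF le_prec_trans[OF f(1,7) path_prec[OF f(3-6)]] f(8,2)] by blast
qed

lemma le_pprec_trans: assumes "p \<in> G" "p \<preceq> q" "q \<prec>\<prec> r" shows "p \<prec>\<prec> r"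
proof -
  obtain f s t where f: "q \<in> G" "r \<in> G" "f \<in> Paths" "s \<in> I_Q" "t \<in> I_Q" "s < t" "q \<preceq> f s" "f t \<preceq> r"
    using assms(3) unfolding pprec_def by blast
  then have "p \<preceq> f s" using gmor_le_trans[OF assms(1) f(1) path_gmor assms(2)] by blast
  then show ?thesis unfolding pprec_def using f assms by blast
qed

lemma pprec_le_trans: assumes "p \<prec>\<prec> q" "q \<preceq> r" "r \<in> G" shows "p \<prec>\<prec> r"
proof -
  obtain f s t where f: "p \<in> G" "q \<in> G" "f \<in> Paths" "s \<in> I_Q" "t \<in> I_Q" "s < t" "p \<preceq> f s" "f t \<preceq> q"
    using assms(1) unfolding pprec_def by blast
  then have "f t \<preceq> r" using gmor_le_trans[OF path_gmor f(2) assms(3) _ assms(2)] by blast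
  then show ?thesis unfolding pprec_def using f assms by blast
qed

lemma pprec_interpolate: assumes "p \<prec>\<prec> q" shows "\<exists>r. p \<prec>\<prec> r \<and> r \<prec>\<prec> q"
proof -
  obtain f s t where f: "p \<in> G" "q \<in> G" "f \<in> Paths" "s \<in> I_Q" "t \<in> I_Q" "s < t" "p \<preceq> f s" "f t \<preceq> q"
    using assms unfolding pprec_def by blast
  obtain u where u: "u \<in> I_Q" "s < u" "u < t" using I_Q_mid f by blast
  have "p \<prec>\<prec> f u" "f u \<prec>\<prec> q"
    unfolding pprec_def using f u path_gmor[OF f(3)] gmor_le_refl by blast+
  then show ?thesis by blast
qed

text \<open>A diagonal argument. The index \<open>l (Suc n)\<close> in F (Suc n) is chosen above
  everything that F 0, ..., F n have reached at \<open>uq n\<close>, so the diagonal dominates all F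
  k without leaving the sequence. \<open>interpolating_path\<close> spreads it over the rationals,
  with \<open>\<prec>\<prec>\<close> as the strict relation because it interpolates and implies
  \<open>\<prec>\<close>. The last conclusion says more than that h is a least upper bound; it is
  what makes cuts way below.\<close>

lemma path_sup_exists:
  assumes F: "\<And>n::nat. F n \<in> Paths" and inc: "\<And>n. F n \<lesssim> F (Suc n)"
  shows "\<exists>h\<in>Paths. (\<forall>n. F n \<lesssim> h) \<and> (\<forall>t\<in>I_Q. \<exists>n. \<exists>s\<in>I_Q. h t \<prec> F n s)"
proof -
  have incm: "F m \<lesssim> F n" if "m \<le> n" for m n
    using that
  proof (induction n rule: dec_induct)
    case (step n) then show ?case using path_le_trans[OF F F F step.IH inc] by blast
  qed (rule path_le_refl[OF F])
  have "\<exists>l'. l' \<in> I_Q \<and> F n l \<prec>\<prec> F (Suc n) l' \<and> (\<forall>k\<le>n. F k (uq n) \<preceq> F (Suc n) l')" if l: "l \<in> I_Q" for n l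
  proof -
    obtain s where s: "s \<in> I_Q" "F n l \<prec> F (Suc n) s" using path_leD[OF inc l] by blast
    have "\<exists>m\<in>I_Q. F k (uq n) \<prec> F (Suc n) m" if "k \<le> n" for k
      using path_leD[OF incm uq_I_Q] that by simp
    then obtain m where m: "\<And>k. k \<le> n \<Longrightarrow> m k \<in> I_Q \<and> F k (uq n) \<prec> F (Suc n) (m k)" by metis
    define M where "M = Max (insert s (m ` {..n}))"
    have "M \<in> insert s (m ` {..n})" unfolding M_def by (intro Max_in) auto
    then have "M \<in> I_Q" using m s(1) by blast
    then obtain l' where l': "l' \<in> I_Q" "M < l'" using I_Q_above by blast
    have ub: "x < l'" if "x \<in> insert s (m ` {..n})" for x
      using Max_ge[OF _ that] l'(2) unfolding M_def by (meson finite_atMost finite_imageI finite_insert le_less_trans)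
    \<comment> \<open>The path F (Suc n) itself is the witness, between its indices s and l'; this
      is why l' has to be strictly above \<open>M\<close>.\<close>
    have "F n l \<prec>\<prec> F (Suc n) l'"
      unfolding pprec_def using path_gmor[OF F] l s l' ub[of s] F[of "Suc n"] gmor_le_refl[of "F (Suc n) l'"]
        prec_le[OF path_gmor[OF F l] path_gmor[OF F s(1)] s(2)] by blast
    moreover have "F k (uq n) \<preceq> F (Suc n) l'" if "k \<le> n" for k
    proof -
      have "F k (uq n) \<prec> F (Suc n) l'"
        using prec_le_trans[OF _ path_mono[OF F, of "m k" l']] m[OF that] ub[of "m k"] that l'(1)
          path_gmor[OF F l'(1)] by auto
      then show ?thesis using prec_le path_gmor F uq_I_Q l'(1) by blast
    qed
    ultimately show ?thesis using l' by blast
  qed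
  then have "\<exists>l. \<forall>n. l n \<in> I_Q \<and> (F n (l n) \<prec>\<prec> F (Suc n) (l (Suc n)) \<and>
      (\<forall>k\<le>n. F k (uq n) \<preceq> F (Suc n) (l (Suc n))))"
    by (intro dependent_nat_choice) (use uq_I_Q[of 0] in blast)+
  then obtain l where l: "\<And>n. l n \<in> I_Q" "\<And>n. F n (l n) \<prec>\<prec> F (Suc n) (l (Suc n))"
    "\<And>n k. k \<le> n \<Longrightarrow> F k (uq n) \<preceq> F (Suc n) (l (Suc n))" by blast
  have "\<exists>h :: rat \<Rightarrow> 'a \<Rightarrow> 'b. (\<forall>x\<in>I_Q. h x \<in> G) \<and> (\<forall>x\<in>I_Q. \<forall>y\<in>I_Q. x < y \<longrightarrow> h x \<prec>\<prec> h y) \<and>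
    (\<forall>k. \<exists>x\<in>I_Q. F k (l k) \<preceq> h x) \<and> (\<forall>x\<in>I_Q. \<exists>k. h x \<preceq> F k (l k))"
  proof (rule interpolating_path)
    show "x \<in> G \<and> y \<in> G" if "x \<prec>\<prec> y" for x y using that unfolding pprec_def by blast
    then show "x \<preceq> y" if "x \<prec>\<prec> y" for x y using that pprec_prec prec_le by blast
  qed (rule l(2) | (rule gmor_le_refl gmor_le_trans gmor_lub le_pprec_trans pprec_le_trans
        pprec_interpolate; assumption))+
  then obtain h where h: "\<And>x. x \<in> I_Q \<Longrightarrow> h x \<in> G"
    "\<And>x y. \<lbrakk>x \<in> I_Q; y \<in> I_Q; x < y\<rbrakk> \<Longrightarrow> h x \<prec>\<prec> h y"
    "\<And>k. \<exists>x\<in>I_Q. F k (l k) \<preceq> h x" "\<And>x. x \<in> I_Q \<Longrightarrow> \<exists>k. h x \<preceq> F k (l k)" by blast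
  have hp: "restrict h I_Q \<in> Paths"
    by (rule pathsI) (use h pprec_prec in auto)
  have up: "F n \<lesssim> restrict h I_Q" for n
  proof (rule path_le_weakI[OF F hp])
    fix t assume t: "t \<in> I_Q"
    \<comment> \<open>The choice of \<open>l\<close> takes care of F n only from stage n on, and of
      the index t only once t < \<open>uq k\<close>; the maximum of n and k meets both.\<close>
    obtain k where "t < uq k" using uq_cofinal[OF t] by blast
    also have "uq k \<le> uq (max n k)" using uq_less[of k "max n k"] by (cases "k < n") (auto simp: max_def)
    finally have tk: "t < uq (max n k)" .
    obtain x where x: "x \<in> I_Q" "F (Suc (max n k)) (l (Suc (max n k))) \<preceq> h x" using h(3) by blast
    note cl = path_gmor[OF F t] path_gmor[OF F uq_I_Q] path_gmor[OF F l(1)] h(1)[OF x(1)]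
    have "F n t \<preceq> F n (uq (max n k))" using path_mono[OF F t uq_I_Q] tk by simp
    then have "F n t \<preceq> F (Suc (max n k)) (l (Suc (max n k)))"
      using gmor_le_trans[OF cl(1,2,3)] l(3)[of n "max n k"] by simp
    then have "F n t \<preceq> h x" using gmor_le_trans[OF cl(1,3,4)] x(2) by blast
    then show "\<exists>m\<in>I_Q. F n t \<preceq> restrict h I_Q m" using x(1) by auto
  qed
  have "\<exists>n. \<exists>s\<in>I_Q. restrict h I_Q t \<prec> F n s" if t: "t \<in> I_Q" for t
  proof -
    obtain k where k: "h t \<preceq> F k (l k)" using h(4) t by blast
    obtain s where "s \<in> I_Q" "l k < s" using I_Q_above l(1) by blast
    then have "h t \<prec> F k s" using le_prec_trans[OF h(1)[OF t] k path_prec[OF F l(1)]] by blast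
    then show ?thesis using t \<open>s \<in> I_Q\<close> unfolding restrict_apply'[OF t] by blast
  qed
  then show ?thesis using hp up by blast
qed

lemma path_sup_is_sup:
  assumes F: "\<And>n::nat. F n \<in> Paths" and h: "h \<in> Paths" "\<And>n. F n \<lesssim> h"
    "\<And>t. t \<in> I_Q \<Longrightarrow> \<exists>n. \<exists>s\<in>I_Q. h t \<prec> F n s"
  shows "is_sup H (range (\<lambda>n. pcls (F n))) (pcls h)"
  unfolding is_sup_def
proof (intro conjI ballI impI)
  show "pcls h \<in> carrier H" by (rule pcls_closed[OF h(1)])
  show "X \<sqsubseteq>\<^bsub>H\<^esub> pcls h" if "X \<in> range (\<lambda>n. pcls (F n))" for X
    using that H_le[OF F h(1)] h(2) by auto
  fix U assume "U \<in> carrier H" and U: "\<forall>x\<in>range (\<lambda>n. pcls (F n)). x \<sqsubseteq>\<^bsub>H\<^esub> U"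
  then obtain u where u: "u \<in> Paths" "U = pcls u" unfolding H_carrier by blast
  have le: "F n \<lesssim> u" for n using U H_le[OF F u(1)] u(2) by blast
  have "h \<lesssim> u"
  proof (rule path_leI)
    fix t assume t: "t \<in> I_Q"
    obtain n s where s: "s \<in> I_Q" "h t \<prec> F n s" using h(3)[OF t] by blast
    obtain m where "m \<in> I_Q" "F n s \<prec> u m" using path_leD[OF le s(1)] by blast
    then show "\<exists>m\<in>I_Q. h t \<prec> u m" using prec_trans path_gmor h(1) F s t by blast
  qed
  then show "pcls h \<sqsubseteq>\<^bsub>H\<^esub> U" using H_le[OF h(1) u(1)] u(2) by simp
qed

text \<open>Every supremum of the classes lies below the diagonal path k, so h t is caught first by
  some k m and then by a single member of the sequence.\<close>

lemma path_sup_cofinal: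
  assumes F: "\<And>n::nat. F n \<in> Paths" "\<And>n. F n \<lesssim> F (Suc n)" and h: "h \<in> Paths"
    and s: "is_sup H (range (\<lambda>n. pcls (F n))) U" "pcls h \<sqsubseteq>\<^bsub>H\<^esub> U" and t: "t \<in> I_Q"
  shows "\<exists>n. \<exists>s\<in>I_Q. h t \<prec> F n s"
proof -
  obtain k where k: "k \<in> Paths" "\<And>n. F n \<lesssim> k" "\<And>t. t \<in> I_Q \<Longrightarrow> \<exists>n. \<exists>s\<in>I_Q. k t \<prec> F n s"
    using path_sup_exists[of F] F by blast
  obtain u where u: "u \<in> Paths" "U = pcls u" using s(1) unfolding is_sup_def H_carrier by blast
  have "U \<sqsubseteq>\<^bsub>H\<^esub> pcls k" using s(1) k(1,2) H_le[OF F(1) k(1)] pcls_closed[OF k(1)] unfolding is_sup_def by blast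
  then have "h \<lesssim> k" using s(2) path_le_trans[OF h u(1) k(1)] H_le h u k by simp
  then obtain m where m: "m \<in> I_Q" "h t \<prec> k m" using path_leD t by blast
  then obtain n s where "s \<in> I_Q" "k m \<prec> F n s" using k(3) by blast
  then show ?thesis using prec_trans path_gmor h k(1) m t by blast
qed

lemma H_incr_seqE:
  assumes "incr_seq H c"
  obtains F where "\<And>n. F n \<in> Paths" "\<And>n. F n \<lesssim> F (Suc n)" "c = (\<lambda>n. pcls (F n))"
proof -
  have "\<forall>n. \<exists>f. f \<in> Paths \<and> c n = pcls f" using assms unfolding incr_seq_def H_carrier by blast
  then obtain F where F: "\<And>n. F n \<in> Paths" "\<And>n. c n = pcls (F n)" by metis
  moreover have "F n \<lesssim> F (Suc n)" for n using assms F H_le unfolding incr_seq_def by simp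
  ultimately show ?thesis using that by blast
qed

text \<open>The whole cut is dominated by the single morphism f l, and
  \<open>path_sup_cofinal\<close> places f l under one member of the sequence.\<close>

lemma cut_way_below:
  assumes "f \<in> Paths" "l \<in> I_Q" shows "pcls (cut f l) \<lless>\<^bsub>H\<^esub> pcls f"
  unfolding way_below_def
proof (intro conjI allI impI; (elim conjE)?)
  show "pcls (cut f l) \<in> carrier H" "pcls f \<in> carrier H" using assms cut_closed pcls_closed by auto
  fix c U assume c: "incr_seq H c" "is_sup H (range c) U" "pcls f \<sqsubseteq>\<^bsub>H\<^esub> U"
  obtain F where F: "\<And>n. F n \<in> Paths" "\<And>n. F n \<lesssim> F (Suc n)" "c = (\<lambda>n. pcls (F n))"
    by (rule H_incr_seqE[OF c(1)]) (rule that)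
  obtain n s where s: "s \<in> I_Q" "f l \<prec> F n s"
    using path_sup_cofinal[OF F(1,2) assms(1) c(2)[unfolded F(3)] c(3) assms(2)] by blast
  have "cut f l \<lesssim> F n"
    using prec_trans[OF path_gmor[OF cut_closed[OF assms]] path_gmor[OF assms] cut_prec[OF assms] s(2)] s(1)
    by (intro path_leI) blast
  then show "\<exists>k. pcls (cut f l) \<sqsubseteq>\<^bsub>H\<^esub> c k" unfolding F(3) using H_le[OF cut_closed[OF assms] F(1)] by blast
qed

lemma cut_mono: assumes "f \<in> Paths" "k \<in> I_Q" "l \<in> I_Q" "k \<le> l" shows "cut f k \<lesssim> cut f l"
proof (rule path_le_weakI[OF cut_closed cut_closed])
  fix t assume t: "t \<in> I_Q"
  have "f (k * t) \<preceq> f (l * t)" using path_mono[OF assms(1)] I_Q_mult[OF assms(2) t] I_Q_mult[OF assms(3) t] assms t by auto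
  then show "\<exists>m\<in>I_Q. cut f k t \<preceq> cut f l m" unfolding cut_def using t by auto
qed (use assms in auto)

lemma cut_sup:
  assumes f: "f \<in> Paths" shows "is_sup H (range (\<lambda>n. pcls (cut f (uq n)))) (pcls f)"
proof (rule path_sup_is_sup[OF cut_closed[OF f uq_I_Q] f])
  show "cut f (uq n) \<lesssim> f" for n using cut_prec[OF f uq_I_Q] uq_I_Q by (intro path_leI) blast
  fix t assume t: "t \<in> I_Q"
  obtain n where n: "t < uq n" using uq_cofinal[OF t] by blast
  obtain s where s: "s \<in> I_Q" "t < s" "s < uq n" using I_Q_mid[OF n t uq_I_Q] by blast
  \<comment> \<open>s / \<open>uq n\<close> is the index that the rescaling in the cut at
    \<open>uq n\<close> sends to s.\<close>
  have q: "s / uq n \<in> I_Q" "uq n * (s / uq n) = s" using s uq_I_Q[of n] by (auto simp: field_simps)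
  then have "f t \<prec> cut f (uq n) (s / uq n)" unfolding cut_def using path_prec[OF f t s(1,2)] by simp
  then show "\<exists>n. \<exists>s\<in>I_Q. f t \<prec> cut f (uq n) s" using q(1) by blast
qed

text \<open>Scale factors multiply, so the cut at k is the cut at k / l of the cut at l.\<close>

lemma cut_cut_way_below:
  assumes f: "f \<in> Paths" and "k \<in> I_Q" "l \<in> I_Q" "k < l"
  shows "pcls (cut f k) \<lless>\<^bsub>H\<^esub> pcls (cut f l)"
proof -
  have q: "k / l \<in> I_Q" using assms by (auto simp: field_simps)
  have "cut (cut f l) (k / l) = cut f k"
  proof
    fix t show "cut (cut f l) (k / l) t = cut f k t"
      using I_Q_mult[OF q, of t] assms by (auto simp: cut_def fun_eq_iff)
  qed
  then show ?thesis using cut_way_below[OF cut_closed[OF f assms(3)] q] by simp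
qed

text \<open>The class of f is the supremum of its cuts at \<open>uq n\<close>, so cuts are cofinal
  among the classes way below it. Questions about \<open>\<lless>\<close> in the internal hom thus
  reduce to one index of f.\<close>

lemma H_way_belowD:
  assumes "X \<lless>\<^bsub>H\<^esub> pcls f" "f \<in> Paths" shows "\<exists>l\<in>I_Q. X \<sqsubseteq>\<^bsub>H\<^esub> pcls (cut f l)"
proof -
  have "incr_seq H (\<lambda>n. pcls (cut f (uq n)))"
    unfolding incr_seq_def using cut_closed[OF assms(2) uq_I_Q] pcls_closed
      cut_mono[OF assms(2) uq_I_Q uq_I_Q] uq_less H_le by (simp add: less_imp_le)
  moreover have "pcls f \<sqsubseteq>\<^bsub>H\<^esub> pcls f" using H_le assms(2) path_le_refl by blast
  ultimately show ?thesis using assms(1) cut_sup[OF assms(2)] uq_I_Q unfolding way_below_def by blast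
qed

lemma cut_path_add:
  assumes "l \<in> I_Q" shows "path_add S T (cut f l) (cut g l) = cut (path_add S T f g) l"
proof
  fix t show "path_add S T (cut f l) (cut g l) t = cut (path_add S T f g) l t"
    using I_Q_mult[OF assms, of t] by (auto simp: cut_def path_add_def fun_eq_iff)
qed

lemma path_add_assoc_comm:
  assumes "f \<in> Paths" "g \<in> Paths" "h \<in> Paths"
  shows "path_add S T (path_add S T f g) h = path_add S T f (path_add S T g h)"
    "path_add S T f g = path_add S T g f" "path_add S T path_zero f = f"
proof -
  have ap: "f l a \<in> carrier T" if "f \<in> Paths" "l \<in> I_Q" "a \<in> carrier S" for f l a
    using that path_gmor gmor_closed by blast
  show "path_add S T (path_add S T f g) h = path_add S T f (path_add S T g h)"
    by (rule ext)+ (auto simp: path_add_def restrict_def T.add_assoc ap assms)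
  show "path_add S T f g = path_add S T g f"
    by (rule ext)+ (auto simp: path_add_def restrict_def T.add_comm ap assms)
  \<comment> \<open>By extensionality f takes the default value outside its domains, exactly as
    \<open>path_add\<close> does. Neutrality of zero therefore holds for functions and not only for
    classes.\<close>
  have "f l a = undefined" if "l \<in> I_Q" "a \<notin> carrier S" for l a
    using gmor_ext[OF path_gmor[OF assms(1) that(1)]] that(2) unfolding extensional_def by auto
  moreover have "f l = undefined" if "l \<notin> I_Q" for l
    using assms(1) that unfolding paths_def by (auto simp: PiE_def extensional_def)
  ultimately show "path_add S T path_zero f = f"
    by (intro ext) (auto simp: path_add_def path_zero_def restrict_def T.add_zero ap assms)
qed

section \<open>The axioms of a Cu-semigroup for classes of paths\<close>

lemma H_pos_ordered_semigroup: "pos_ordered_semigroup H"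
proof
  show "\<zero>\<^bsub>H\<^esub> \<in> carrier H" unfolding H_zero by (rule pcls_closed[OF path_zero_closed])
  show "X \<oplus>\<^bsub>H\<^esub> Y \<in> carrier H" if "X \<in> carrier H" "Y \<in> carrier H" for X Y
    using that by (auto simp: H_carrier H_add intro: path_add_closed)
  show "X \<oplus>\<^bsub>H\<^esub> Y \<oplus>\<^bsub>H\<^esub> Z = X \<oplus>\<^bsub>H\<^esub> (Y \<oplus>\<^bsub>H\<^esub> Z)" if "X \<in> carrier H" "Y \<in> carrier H" "Z \<in> carrier H" for X Y Z
    using that path_add_assoc_comm(1) by (auto simp: H_carrier H_add path_add_closed)
  show "X \<oplus>\<^bsub>H\<^esub> Y = Y \<oplus>\<^bsub>H\<^esub> X" if "X \<in> carrier H" "Y \<in> carrier H" for X Y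
    using that path_add_assoc_comm(2) by (auto simp: H_carrier H_add)
  show "\<zero>\<^bsub>H\<^esub> \<oplus>\<^bsub>H\<^esub> X = X" if "X \<in> carrier H" for X
    using that by (auto simp: H_carrier H_zero H_add path_zero_closed path_add_assoc_comm(3))
  show "X \<sqsubseteq>\<^bsub>H\<^esub> X" if "X \<in> carrier H" for X
    using that by (auto simp: H_carrier H_le path_le_refl)
  show "X = Y" if XY: "X \<in> carrier H" "Y \<in> carrier H" "X \<sqsubseteq>\<^bsub>H\<^esub> Y" "Y \<sqsubseteq>\<^bsub>H\<^esub> X" for X Y
  proof -
    obtain f g where fg: "f \<in> Paths" "X = pcls f" "g \<in> Paths" "Y = pcls g" using XY(1,2) unfolding H_carrier by blast
    then show ?thesis using XY(3,4) pcls_eqI[OF fg(1,3)] H_le[OF fg(1,3)] H_le[OF fg(3,1)] fg(2,4) by simp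
  qed
  show "X \<sqsubseteq>\<^bsub>H\<^esub> Z" if XYZ: "X \<in> carrier H" "Y \<in> carrier H" "Z \<in> carrier H" "X \<sqsubseteq>\<^bsub>H\<^esub> Y" "Y \<sqsubseteq>\<^bsub>H\<^esub> Z" for X Y Z
  proof -
    obtain f g h where "f \<in> Paths" "X = pcls f" "g \<in> Paths" "Y = pcls g" "h \<in> Paths" "Z = pcls h"
      using XYZ(1-3) unfolding H_carrier by blast
    then show ?thesis using XYZ(4,5) path_le_trans[of f g h] by (simp add: H_le)
  qed
  show "X \<oplus>\<^bsub>H\<^esub> Z \<sqsubseteq>\<^bsub>H\<^esub> Y \<oplus>\<^bsub>H\<^esub> Z" if "X \<in> carrier H" "Y \<in> carrier H" "Z \<in> carrier H" "X \<sqsubseteq>\<^bsub>H\<^esub> Y" for X Y Z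
    using that by (auto simp: H_carrier H_le H_add path_add_closed path_add_mono path_le_refl)
  show "\<zero>\<^bsub>H\<^esub> \<sqsubseteq>\<^bsub>H\<^esub> X" if X: "X \<in> carrier H" for X
  proof -
    obtain f where f: "f \<in> Paths" "X = pcls f" using X H_carrier by blast
    have "path_zero \<lesssim> f"
      using zero_prec path_gmor[OF f(1)] by (intro path_leI) (auto simp: path_zero_def)
    then show ?thesis unfolding H_zero f(2) H_le[OF path_zero_closed f(1)] .
  qed
qed

lemma ihom_cu_semigroup: "cu_semigroup H"
proof -
  interpret H: pos_ordered_semigroup H by (rule H_pos_ordered_semigroup)
  show ?thesis
  proof
    show "\<exists>s. is_sup H (range c) s" if c: "incr_seq H c" for c
    proof -
      obtain F where F: "\<And>n. F n \<in> Paths" "\<And>n. F n \<lesssim> F (Suc n)" "c = (\<lambda>n. pcls (F n))"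
        by (rule H_incr_seqE[OF c]) (rule that)
      show ?thesis unfolding F(3) using path_sup_exists[of F] path_sup_is_sup[of F] F by blast
    qed
    show "\<exists>c. (\<forall>n. c n \<lless>\<^bsub>H\<^esub> c (Suc n)) \<and> is_sup H (range c) X" if X: "X \<in> carrier H" for X
    proof -
      obtain f where f: "f \<in> Paths" "X = pcls f" using X H_carrier by blast
      show ?thesis unfolding f(2) using cut_sup[OF f(1)] cut_cut_way_below[OF f(1) uq_I_Q uq_I_Q uq_less]
        by (intro exI[of _ "\<lambda>n. pcls (cut f (uq n))"]) blast
    qed
    show "X' \<oplus>\<^bsub>H\<^esub> Y' \<lless>\<^bsub>H\<^esub> X \<oplus>\<^bsub>H\<^esub> Y" if wb: "X' \<lless>\<^bsub>H\<^esub> X" "Y' \<lless>\<^bsub>H\<^esub> Y" for X' X Y' Y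
    proof -
      obtain f g where f: "f \<in> Paths" "X = pcls f" and g: "g \<in> Paths" "Y = pcls g"
        using wb H.way_below_closed unfolding H_carrier by meson
      obtain k l where k: "k \<in> I_Q" "X' \<sqsubseteq>\<^bsub>H\<^esub> pcls (cut f k)" and l: "l \<in> I_Q" "Y' \<sqsubseteq>\<^bsub>H\<^esub> pcls (cut g l)"
        using H_way_belowD wb f g by meson
      define m where "m = max k l"
      have m: "m \<in> I_Q" "k \<le> m" "l \<le> m" using k l by (auto simp: m_def max_def)
      note cl = cut_closed[OF f(1) k(1)] cut_closed[OF f(1) m(1)] cut_closed[OF g(1) l(1)] cut_closed[OF g(1) m(1)]
      note X' = H.way_below_closed(1)[OF wb(1)] and Y' = H.way_below_closed(1)[OF wb(2)]
      have "X' \<sqsubseteq>\<^bsub>H\<^esub> pcls (cut f m)" "Y' \<sqsubseteq>\<^bsub>H\<^esub> pcls (cut g m)"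
        using H.le_trans[OF X' _ _ k(2), of "pcls (cut f m)"] H.le_trans[OF Y' _ _ l(2), of "pcls (cut g m)"]
          cut_mono[OF f(1) k(1) m(1,2)] cut_mono[OF g(1) l(1) m(1,3)] cl by (simp_all add: H_le pcls_closed)
      then have "X' \<oplus>\<^bsub>H\<^esub> Y' \<sqsubseteq>\<^bsub>H\<^esub> pcls (cut f m) \<oplus>\<^bsub>H\<^esub> pcls (cut g m)"
        using X' Y' cl pcls_closed by (intro H.add_mono2) auto
      then have "X' \<oplus>\<^bsub>H\<^esub> Y' \<sqsubseteq>\<^bsub>H\<^esub> pcls (cut (path_add S T f g) m)"
        using H_add cl cut_path_add[OF m(1)] by simp
      then show ?thesis using H.le_way_below_trans[OF _ cut_way_below[OF path_add_closed[OF f(1) g(1)] m(1)]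
          H.add_closed[OF X' Y']] H_add f g by simp
    qed
    show "csup H (range (\<lambda>n. c n \<oplus>\<^bsub>H\<^esub> d n)) = csup H (range c) \<oplus>\<^bsub>H\<^esub> csup H (range d)"
      if c: "incr_seq H c" and d: "incr_seq H d" for c d
    proof -
      obtain E where E: "\<And>n. E n \<in> Paths" "\<And>n. E n \<lesssim> E (Suc n)" "c = (\<lambda>n. pcls (E n))"
        by (rule H_incr_seqE[OF c]) (rule that)
      obtain F where F: "\<And>n. F n \<in> Paths" "\<And>n. F n \<lesssim> F (Suc n)" "d = (\<lambda>n. pcls (F n))"
        by (rule H_incr_seqE[OF d]) (rule that)
      obtain e where e: "e \<in> Paths" "\<And>n. E n \<lesssim> e" "\<And>t. t \<in> I_Q \<Longrightarrow> \<exists>n. \<exists>s\<in>I_Q. e t \<prec> E n s"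
        using path_sup_exists[of E] E by blast
      obtain f where f: "f \<in> Paths" "\<And>n. F n \<lesssim> f" "\<And>t. t \<in> I_Q \<Longrightarrow> \<exists>n. \<exists>s\<in>I_Q. f t \<prec> F n s"
        using path_sup_exists[of F] F by blast
      \<comment> \<open>The two summands are caught at different members of their sequences. Pushing
        a bound to any later member allows both to be read at the member
        \<open>max i j\<close>.\<close>
      have cofin: "\<exists>s\<in>I_Q. u \<prec> A N s" if A: "\<And>n. A n \<in> Paths" "\<And>n. A n \<lesssim> A (Suc n)"
        and u: "u \<in> G" "s \<in> I_Q" "u \<prec> A n s" "n \<le> N" for A u s n N
        using u(4)
      proof (induction N rule: dec_induct)
        case (step N)
        then obtain s where s: "s \<in> I_Q" "u \<prec> A N s" by blast
        obtain m where "m \<in> I_Q" "A N s \<prec> A (Suc N) m" using path_leD[OF A(2) s(1)] by blast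
        then show ?case using prec_trans[OF u(1) path_gmor[OF A(1) s(1)] s(2)] by blast
      qed (use u in blast)
      have "is_sup H (range (\<lambda>n. pcls (path_add S T (E n) (F n)))) (pcls (path_add S T e f))"
      proof (rule path_sup_is_sup)
        show "path_add S T (E n) (F n) \<in> Paths" for n using E F path_add_closed by blast
        show "path_add S T e f \<in> Paths" using e f path_add_closed by blast
        show "path_add S T (E n) (F n) \<lesssim> path_add S T e f" for n
          using E F e f path_add_mono by blast
        fix t assume t: "t \<in> I_Q"
        obtain i s where s: "s \<in> I_Q" "e t \<prec> E i s" using e(3)[OF t] by blast
        obtain j r where r: "r \<in> I_Q" "f t \<prec> F j r" using f(3)[OF t] by blast
        obtain s' where s': "s' \<in> I_Q" "e t \<prec> E (max i j) s'"
          using cofin[of E "e t" s i "max i j", OF E(1,2) path_gmor[OF e(1) t] s] by auto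
        obtain r' where r': "r' \<in> I_Q" "f t \<prec> F (max i j) r'"
          using cofin[of F "f t" r j "max i j", OF F(1,2) path_gmor[OF f(1) t] r] by auto
        have q: "max s' r' \<in> I_Q" using s' r' by (simp add: max_def)
        have "e t \<prec> E (max i j) (max s' r')" "f t \<prec> F (max i j) (max s' r')"
          using prec_le_trans[OF s'(2) path_mono[OF E(1) s'(1) q]] prec_le_trans[OF r'(2) path_mono[OF F(1) r'(1) q]]
            path_gmor[OF E(1) q] path_gmor[OF F(1) q] by simp_all
        then have "path_add S T e f t \<prec> path_add S T (E (max i j)) (F (max i j)) (max s' r')"
          unfolding path_add_app[OF t] path_add_app[OF q] by (rule prec_plus)
        then show "\<exists>n. \<exists>s\<in>I_Q. path_add S T e f t \<prec> path_add S T (E n) (F n) s" using q by blast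
      qed
      moreover have "is_sup H (range c) (pcls e)" "is_sup H (range d) (pcls f)"
        unfolding E(3) F(3) using path_sup_is_sup E F e f by blast+
      ultimately show ?thesis using H.csup_eq H_add E F e f by simp
    qed
  qed
qed

end

section \<open>The endpoint map and the adjunction\<close>

lemma is_sup_cong_ub:
  assumes "A \<subseteq> carrier S" "B \<subseteq> carrier S"
    "\<And>u. u \<in> carrier S \<Longrightarrow> (\<forall>x\<in>A. x \<sqsubseteq>\<^bsub>S\<^esub> u) \<longleftrightarrow> (\<forall>x\<in>B. x \<sqsubseteq>\<^bsub>S\<^esub> u)"
  shows "is_sup S A s \<longleftrightarrow> is_sup S B s"
  using assms unfolding is_sup_def by blast

lemma (in pos_ordered_semigroup) is_sup_uq:
  assumes "\<And>l. l \<in> I_Q \<Longrightarrow> p l \<in> carrier S" "\<And>k l. \<lbrakk>k \<in> I_Q; l \<in> I_Q; k < l\<rbrakk> \<Longrightarrow> p k \<sqsubseteq> p l"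
  shows "is_sup S (p ` I_Q) s \<longleftrightarrow> is_sup S (range (\<lambda>n. p (uq n))) s"
proof (rule is_sup_cong_ub)
  fix u assume u: "u \<in> carrier S"
  have "p l \<sqsubseteq> u" if l: "l \<in> I_Q" and ub: "\<And>n. p (uq n) \<sqsubseteq> u" for l
  proof -
    obtain n where "l < uq n" using uq_cofinal[OF l] by blast
    then show ?thesis
      using le_trans[OF assms(1)[OF l] assms(1)[OF uq_I_Q] u assms(2)[OF l uq_I_Q] ub] by blast
  qed
  then show "(\<forall>x\<in>p ` I_Q. x \<sqsubseteq> u) \<longleftrightarrow> (\<forall>x\<in>range (\<lambda>n. p (uq n)). x \<sqsubseteq> u)" using uq_I_Q by blast
qed (use assms(1) uq_I_Q in blast)+

section \<open>Endpoints of paths\<close>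

context cu_pair
begin

abbreviation ep where "ep \<equiv> endpoint S T"

lemma path_point_mono:
  assumes "f \<in> Paths" "a \<in> carrier S" "k \<in> I_Q" "l \<in> I_Q" "k < l"
  shows "f k a \<sqsubseteq>\<^bsub>T\<^esub> f l a"
  using path_mono[OF assms(1,3,4)] assms(2,5) unfolding gmor_le_def by simp

lemma path_point_closed: "\<lbrakk>f \<in> Paths; a \<in> carrier S; l \<in> I_Q\<rbrakk> \<Longrightarrow> f l a \<in> carrier T"
  using path_gmor gmor_closed by blast

lemma path_point_uq:
  assumes "f \<in> Paths" "a \<in> carrier S"
  shows "is_sup T ((\<lambda>l. f l a) ` I_Q) s \<longleftrightarrow> is_sup T (range (\<lambda>n. f (uq n) a)) s"
  by (rule T.is_sup_uq) (use path_point_mono path_point_closed assms in auto)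

lemma path_point_incr:
  assumes "f \<in> Paths" "a \<in> carrier S" shows "incr_seq T (\<lambda>n. f (uq n) a)"
  unfolding incr_seq_def using path_point_closed[OF assms uq_I_Q] path_point_mono[OF assms uq_I_Q uq_I_Q uq_less] by simp

lemma path_le_point:
  assumes "f \<in> Paths" "g \<in> Paths" "f \<lesssim> g" "a \<in> carrier S" "l \<in> I_Q"
  shows "\<exists>m\<in>I_Q. f l a \<sqsubseteq>\<^bsub>T\<^esub> g m a"
proof -
  obtain m where "m \<in> I_Q" "f l \<prec> g m" using path_leD assms by blast
  then show ?thesis using prec_le[OF path_gmor[OF assms(1,5)] path_gmor[OF assms(2)]] assms(4)
    unfolding gmor_le_def by blast
qed

lemma path_le_ub:
  assumes "f \<in> Paths" "g \<in> Paths" "f \<lesssim> g" "a \<in> carrier S" "u \<in> carrier T" "\<forall>x\<in>(\<lambda>l. g l a) ` I_Q. x \<sqsubseteq>\<^bsub>T\<^esub> u"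
  shows "\<forall>x\<in>(\<lambda>l. f l a) ` I_Q. x \<sqsubseteq>\<^bsub>T\<^esub> u"
proof (intro ballI; elim imageE; simp only:)
  fix l assume l: "l \<in> I_Q"
  obtain m where m: "m \<in> I_Q" "f l a \<sqsubseteq>\<^bsub>T\<^esub> g m a" using path_le_point[OF assms(1-4) l] by blast
  then show "f l a \<sqsubseteq>\<^bsub>T\<^esub> u"
    using T.le_trans[OF path_point_closed[OF assms(1,4) l] path_point_closed[OF assms(2,4) m(1)] assms(5) m(2)] assms(6)
    by blast
qed

text \<open>\<open>endpoint\<close> works with a chosen representative of the class. Equivalent
  paths have the same upper bounds at every a, so f computes the same supremum.\<close>

lemma endpoint_is_sup:
  assumes f: "f \<in> Paths" and a: "a \<in> carrier S"
  shows "is_sup T ((\<lambda>l. f l a) ` I_Q) (ep (pcls f) a)"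
proof -
  define g where "g = (SOME g. g \<in> pcls f)"
  have "g \<in> pcls f" unfolding g_def using pcls_self[OF f] by (rule someI[where P = "\<lambda>g. g \<in> pcls f"])
  then have g: "g \<in> Paths" "f \<lesssim> g" "g \<lesssim> f" unfolding pcls_mem by auto
  have "is_sup T ((\<lambda>l. g l a) ` I_Q) s \<longleftrightarrow> is_sup T ((\<lambda>l. f l a) ` I_Q) s" for s
    by (rule is_sup_cong_ub; (intro iffI)?)
      (use path_point_closed[OF f a] path_point_closed[OF g(1) a] path_le_ub[OF f g(1,2) a] path_le_ub[OF g(1) f g(3) a] in blast)+
  moreover have "ep (pcls f) a = csup T ((\<lambda>l. g l a) ` I_Q)" using a unfolding endpoint_def g_def by simp
  moreover have "is_sup T ((\<lambda>l. f l a) ` I_Q) (csup T (range (\<lambda>n. f (uq n) a)))"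
    using path_point_uq[OF f a] T.is_sup_csup[OF path_point_incr[OF f a]] by blast
  ultimately show ?thesis using T.csup_eq by metis
qed

lemma endpoint_closed: "\<lbrakk>f \<in> Paths; a \<in> carrier S\<rbrakk> \<Longrightarrow> ep (pcls f) a \<in> carrier T"
  and endpoint_upper: "\<lbrakk>f \<in> Paths; a \<in> carrier S; l \<in> I_Q\<rbrakk> \<Longrightarrow> f l a \<sqsubseteq>\<^bsub>T\<^esub> ep (pcls f) a"
  and endpoint_least: "\<lbrakk>f \<in> Paths; a \<in> carrier S; u \<in> carrier T; \<And>l. l \<in> I_Q \<Longrightarrow> f l a \<sqsubseteq>\<^bsub>T\<^esub> u\<rbrakk> \<Longrightarrow>
    ep (pcls f) a \<sqsubseteq>\<^bsub>T\<^esub> u"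
  using endpoint_is_sup[of f a] unfolding is_sup_def by auto

lemma endpoint_seq: "\<lbrakk>f \<in> Paths; a \<in> carrier S\<rbrakk> \<Longrightarrow> ep (pcls f) a = csup T (range (\<lambda>n. f (uq n) a))"
  using T.csup_eq path_point_uq endpoint_is_sup by metis

lemma endpoint_mono:
  assumes "f \<in> Paths" "g \<in> Paths" "f \<lesssim> g" "a \<in> carrier S"
  shows "ep (pcls f) a \<sqsubseteq>\<^bsub>T\<^esub> ep (pcls g) a"
  using path_le_ub[OF assms endpoint_closed[OF assms(2,4)]] endpoint_upper[OF assms(2,4)]
  by (intro endpoint_least endpoint_closed assms) auto

text \<open>For \<open>\<lless>\<close>: X' lies below a cut of f at some l, so its value at a' is
  at most f l a', which is way below f m a for any m > l. For joint suprema: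
  \<open>path_sup_cofinal\<close> catches each morphism of the limit path in a single member of the
  sequence of classes.\<close>

lemma endpoint_bimor: "cu_bimor H S T ep"
proof -
  interpret H: cu_semigroup H by (rule ihom_cu_semigroup)
  have monoX: "ep X a \<sqsubseteq>\<^bsub>T\<^esub> ep Y a" if "X \<in> carrier H" "Y \<in> carrier H" "X \<sqsubseteq>\<^bsub>H\<^esub> Y" "a \<in> carrier S" for X Y a
    using that endpoint_mono H_le unfolding H_carrier by metis
  have monoa: "ep X a \<sqsubseteq>\<^bsub>T\<^esub> ep X b" if X: "X \<in> carrier H" and ab: "a \<in> carrier S" "b \<in> carrier S" "a \<sqsubseteq>\<^bsub>S\<^esub> b" for X a b
  proof -
    obtain f where f: "f \<in> Paths" "X = pcls f" using X H_carrier by blast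
    have "f l a \<sqsubseteq>\<^bsub>T\<^esub> ep (pcls f) b" if l: "l \<in> I_Q" for l
      using T.le_trans[OF _ _ endpoint_closed[OF f(1) ab(2)] gmor_mono[OF path_gmor[OF f(1) l] ab] endpoint_upper[OF f(1) ab(2) l]]
        path_point_closed[OF f(1) _ l] ab by blast
    then show ?thesis unfolding f(2) by (intro endpoint_least endpoint_closed f ab)
  qed
  have cl: "ep X a \<in> carrier T" if "X \<in> carrier H" "a \<in> carrier S" for X a
    using that endpoint_closed unfolding H_carrier by blast
  show ?thesis unfolding cu_bimor_def
  proof (intro conjI ballI allI impI; (elim conjE)?)
    show "ep X a \<in> carrier T" if "X \<in> carrier H" "a \<in> carrier S" for X a using cl that .
    show "ep (X \<oplus>\<^bsub>H\<^esub> Y) a = ep X a \<oplus>\<^bsub>T\<^esub> ep Y a" if XY: "X \<in> carrier H" "Y \<in> carrier H" and a: "a \<in> carrier S" for X Y a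
    proof -
      obtain f where f: "f \<in> Paths" "X = pcls f" using XY H_carrier by blast
      obtain g where g: "g \<in> Paths" "Y = pcls g" using XY H_carrier by blast
      show ?thesis
        unfolding f(2) g(2) H_add[OF f(1) g(1)] endpoint_seq[OF path_add_closed[OF f(1) g(1)] a]
          endpoint_seq[OF f(1) a] endpoint_seq[OF g(1) a] path_add_app[OF uq_I_Q] restrict_apply'[OF a]
        by (rule T.O4[OF path_point_incr[OF f(1) a] path_point_incr[OF g(1) a]])
    qed
    show "ep X (a \<oplus>\<^bsub>S\<^esub> b) = ep X a \<oplus>\<^bsub>T\<^esub> ep X b" if X: "X \<in> carrier H" and a: "a \<in> carrier S" and b: "b \<in> carrier S" for X a b
    proof -
      obtain f where f: "f \<in> Paths" "X = pcls f" using X H_carrier by blast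
      show ?thesis
        unfolding f(2) endpoint_seq[OF f(1) S.add_closed[OF a b]] endpoint_seq[OF f(1) a] endpoint_seq[OF f(1) b]
          gmor_add[OF path_gmor[OF f(1) uq_I_Q] a b]
        by (rule T.O4[OF path_point_incr[OF f(1) a] path_point_incr[OF f(1) b]])
    qed
    show "ep \<zero>\<^bsub>H\<^esub> a = \<zero>\<^bsub>T\<^esub>" if a: "a \<in> carrier S" for a
    proof -
      have "path_zero (uq n) a = \<zero>\<^bsub>T\<^esub>" for n unfolding path_zero_def using a uq_I_Q[of n] by simp
      then show ?thesis unfolding H_zero endpoint_seq[OF path_zero_closed a]
        using T.csup_eq[OF T.is_sup_const[OF T.zero_closed]] by simp
    qed
    show "ep X \<zero>\<^bsub>S\<^esub> = \<zero>\<^bsub>T\<^esub>" if X: "X \<in> carrier H" for X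
    proof -
      obtain f where f: "f \<in> Paths" "X = pcls f" using X H_carrier by blast
      show ?thesis unfolding f(2) endpoint_seq[OF f(1) S.zero_closed] gmor_zero[OF path_gmor[OF f(1) uq_I_Q]]
        using T.csup_eq[OF T.is_sup_const[OF T.zero_closed]] by simp
    qed
    show "ep X a \<sqsubseteq>\<^bsub>T\<^esub> ep Y a" if "X \<in> carrier H" "Y \<in> carrier H" "a \<in> carrier S" "X \<sqsubseteq>\<^bsub>H\<^esub> Y" for X Y a
      using monoX that by blast
    show "ep X a \<sqsubseteq>\<^bsub>T\<^esub> ep X b" if "X \<in> carrier H" "a \<in> carrier S" "b \<in> carrier S" "a \<sqsubseteq>\<^bsub>S\<^esub> b" for X a b
      using monoa that by blast
  next
    fix c d assume c: "incr_seq H c" and d: "incr_seq S d"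
    have cc: "\<And>n. c n \<in> carrier H" and dc: "\<And>n. d n \<in> carrier S" using c d unfolding incr_seq_def by auto
    note sc = H.is_sup_csup[OF c] and sd = S.is_sup_csup[OF d]
    obtain F where F: "\<And>n. F n \<in> Paths" "\<And>n. F n \<lesssim> F (Suc n)" "c = (\<lambda>n. pcls (F n))"
      by (rule H_incr_seqE[OF c]) (rule that)
    have "csup H (range c) \<in> carrier H" using sc unfolding is_sup_def by blast
    then obtain h where h: "h \<in> Paths" "csup H (range c) = pcls h" using H_carrier by blast
    define s where "s = csup S (range d)"
    have s: "s \<in> carrier S" "\<And>n. d n \<sqsubseteq>\<^bsub>S\<^esub> s" using sd unfolding is_sup_def s_def by auto
    have "is_sup T (range (\<lambda>k. ep (c k) (d k))) (ep (pcls h) s)"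
      unfolding is_sup_def
    proof (intro conjI ballI impI)
      show "ep (pcls h) s \<in> carrier T" using endpoint_closed[OF h(1) s(1)] .
      show "x \<sqsubseteq>\<^bsub>T\<^esub> ep (pcls h) s" if x: "x \<in> range (\<lambda>k. ep (c k) (d k))" for x
      proof -
        obtain k where k: "x = ep (c k) (d k)" using x by blast
        have hc: "pcls h \<in> carrier H" "c k \<sqsubseteq>\<^bsub>H\<^esub> pcls h" using sc h unfolding is_sup_def by auto
        show ?thesis unfolding k
          using T.le_trans[OF cl[OF cc dc] cl[OF cc s(1)] cl[OF hc(1) s(1)] monoa[OF cc dc s] monoX[OF cc hc s(1)]] .
      qed
      fix u assume u: "u \<in> carrier T" and ub: "\<forall>x\<in>range (\<lambda>k. ep (c k) (d k)). x \<sqsubseteq>\<^bsub>T\<^esub> u"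
      show "ep (pcls h) s \<sqsubseteq>\<^bsub>T\<^esub> u"
      proof (rule endpoint_least[OF h(1) s(1) u])
        fix l assume l: "l \<in> I_Q"
        have "is_sup H (range (\<lambda>n. pcls (F n))) (pcls h)" using sc unfolding F(3)[symmetric] h(2) .
        then obtain n r where r: "r \<in> I_Q" "h l \<prec> F n r"
          using path_sup_cofinal[of F, OF F(1,2) h(1) _ _ l] H_le[OF h(1) h(1)] path_le_refl[OF h(1)] by blast
        have "h l (d k) \<sqsubseteq>\<^bsub>T\<^esub> u" for k
        proof -
          define N where "N = max n k"
          have N: "c n \<sqsubseteq>\<^bsub>H\<^esub> c N" "d k \<sqsubseteq>\<^bsub>S\<^esub> d N"
            using H.incr_seq_le[OF c] S.incr_seq_le[OF d] unfolding N_def by auto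
          have 1: "h l (d k) \<sqsubseteq>\<^bsub>T\<^esub> F n r (d k)"
            using prec_le[OF path_gmor[OF h(1) l] path_gmor[OF F(1) r(1)] r(2)] dc unfolding gmor_le_def by blast
          have 2: "F n r (d k) \<sqsubseteq>\<^bsub>T\<^esub> ep (c n) (d k)" unfolding F(3) by (rule endpoint_upper[OF F(1) dc r(1)])
          have 3: "ep (c n) (d k) \<sqsubseteq>\<^bsub>T\<^esub> ep (c N) (d k)" by (rule monoX[OF cc cc N(1) dc])
          have 4: "ep (c N) (d k) \<sqsubseteq>\<^bsub>T\<^esub> ep (c N) (d N)" by (rule monoa[OF cc dc dc N(2)])
          have 5: "ep (c N) (d N) \<sqsubseteq>\<^bsub>T\<^esub> u" using ub by blast
          note p = path_point_closed[OF h(1) dc l] path_point_closed[OF F(1) dc r(1)]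
          show ?thesis
            using T.le_trans[OF p(1) p(2) u 1 T.le_trans[OF p(2) cl[OF cc dc] u 2 T.le_trans[OF cl[OF cc dc] cl[OF cc dc] u 3
              T.le_trans[OF cl[OF cc dc] cl[OF cc dc] u 4 5]]]] .
        qed
        then show "h l s \<sqsubseteq>\<^bsub>T\<^esub> u" using gmor_sup[OF path_gmor[OF h(1) l] d sd] u unfolding is_sup_def s_def by blast
      qed
    qed
    then show "csup T (range (\<lambda>k. ep (c k) (d k))) = ep (csup H (range c)) (csup S (range d))"
      unfolding h(2) s_def by (rule T.csup_eq)
  next
    fix X' X a' a assume X: "X' \<lless>\<^bsub>H\<^esub> X" and a: "a' \<lless>\<^bsub>S\<^esub> a"
    note Xc = H.way_below_closed[OF X] and ac = S.way_below_closed[OF a]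
    obtain f where f: "f \<in> Paths" "X = pcls f" using Xc H_carrier by blast
    obtain l where l: "l \<in> I_Q" "X' \<sqsubseteq>\<^bsub>H\<^esub> pcls (cut f l)" using H_way_belowD X f by blast
    obtain m where m: "m \<in> I_Q" "l < m" using I_Q_above l by blast
    have cc: "cut f l \<in> Paths" by (rule cut_closed[OF f(1) l(1)])
    have "ep (pcls (cut f l)) a' \<sqsubseteq>\<^bsub>T\<^esub> f l a'"
    proof (rule endpoint_least[OF cc ac(1) path_point_closed[OF f(1) ac(1) l(1)]])
      fix t assume "t \<in> I_Q"
      then show "cut f l t a' \<sqsubseteq>\<^bsub>T\<^esub> f l a'"
        using prec_le[OF path_gmor[OF cc] path_gmor[OF f(1) l(1)] cut_prec[OF f(1) l(1)]] ac unfolding gmor_le_def by blast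
    qed
    then have "ep X' a' \<sqsubseteq>\<^bsub>T\<^esub> f l a'"
      using T.le_trans[OF cl[OF Xc(1) ac(1)] endpoint_closed[OF cc ac(1)] path_point_closed[OF f(1) ac(1) l(1)]
        monoX[OF Xc(1) pcls_closed[OF cc] l(2) ac(1)]] by blast
    moreover have "f l a' \<lless>\<^bsub>T\<^esub> f m a" using path_prec[OF f(1) l(1) m] a unfolding gcu_below_def by blast
    ultimately show "ep X' a' \<lless>\<^bsub>T\<^esub> ep X a" unfolding f(2)
      using T.le_way_below_trans[OF _ T.way_below_le_trans[OF _ endpoint_upper[OF f(1) ac(2) m(1)] endpoint_closed[OF f(1) ac(2)]]]
        cl[OF Xc(1) ac(1)] by blast
  qed
qed

end

section \<open>Composition of bimorphisms and morphisms\<close>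

lemma cu_bimor_comp:
  assumes S: "cu_semigroup S" "cu_semigroup T" "cu_semigroup S'" "cu_semigroup T'" and \<phi>: "cu_bimor S' T' P \<phi>"
    and \<alpha>: "\<alpha> \<in> cu_mor S S'" and \<beta>: "\<beta> \<in> cu_mor T T'"
  shows "cu_bimor S T P (\<lambda>a b. \<phi> (\<alpha> a) (\<beta> b))"
proof -
  interpret SS: cu_pair S S' using S by (simp add: cu_pair_def)
  interpret TT: cu_pair T T' using S by (simp add: cu_pair_def)
  have a: "\<alpha> \<in> gcu_mor S S'" "\<And>x y. x \<lless>\<^bsub>S\<^esub> y \<Longrightarrow> \<alpha> x \<lless>\<^bsub>S'\<^esub> \<alpha> y" using \<alpha> unfolding cu_mor_def by auto
  have b: "\<beta> \<in> gcu_mor T T'" "\<And>x y. x \<lless>\<^bsub>T\<^esub> y \<Longrightarrow> \<beta> x \<lless>\<^bsub>T'\<^esub> \<beta> y" using \<beta> unfolding cu_mor_def by auto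
  note ac = SS.gmor_closed[OF a(1)] and bc = TT.gmor_closed[OF b(1)]
  note \<phi>' = \<phi>[unfolded cu_bimor_def]
  show ?thesis unfolding cu_bimor_def
  proof (intro conjI ballI allI impI; (elim conjE)?)
    show "csup P (range (\<lambda>k. \<phi> (\<alpha> (c k)) (\<beta> (d k)))) = \<phi> (\<alpha> (csup S (range c))) (\<beta> (csup T (range d)))"
      if c: "incr_seq S c" and d: "incr_seq T d" for c d
      unfolding SS.gmor_csup[OF a(1) c] TT.gmor_csup[OF b(1) d]
      using \<phi>' SS.gmor_incr[OF a(1) c] TT.gmor_incr[OF b(1) d] by simp
  qed (use \<phi>' a(2) b(2) ac bc SS.gmor_add[OF a(1)] TT.gmor_add[OF b(1)] SS.gmor_zero[OF a(1)] TT.gmor_zero[OF b(1)]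
      SS.gmor_mono[OF a(1)] TT.gmor_mono[OF b(1)] in simp_all)
qed

text \<open>Bimorphisms, in contrast to morphisms, carry no extensionality condition, so agreeing on
  the carriers does not make them equal. This is what removes the restricted identity from
  composites.\<close>

lemma cu_bimor_cong:
  assumes "cu_semigroup S" "cu_semigroup T"
    and eq: "\<And>a b. \<lbrakk>a \<in> carrier S; b \<in> carrier T\<rbrakk> \<Longrightarrow> \<phi> a b = \<psi> a b"
  shows "cu_bimor S T P \<phi> \<longleftrightarrow> cu_bimor S T P \<psi>"
proof -
  interpret cu_pair S T using assms by (simp add: cu_pair_def)
  have "cu_bimor S T P \<psi>" if b: "cu_bimor S T P \<phi>"
    and eq: "\<And>a b. \<lbrakk>a \<in> carrier S; b \<in> carrier T\<rbrakk> \<Longrightarrow> \<psi> a b = \<phi> a b" for \<phi> \<psi>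
    unfolding cu_bimor_def
  proof (intro conjI ballI allI impI; (elim conjE)?)
    show "csup P (range (\<lambda>k. \<psi> (c k) (d k))) = \<psi> (csup S (range c)) (csup T (range d))"
      if c: "incr_seq S c" and d: "incr_seq T d" for c d
    proof -
      have "(\<lambda>k. \<psi> (c k) (d k)) = (\<lambda>k. \<phi> (c k) (d k))" using c d eq unfolding incr_seq_def by auto
      moreover have "csup S (range c) \<in> carrier S" "csup T (range d) \<in> carrier T"
        using S.is_sup_csup[OF c] T.is_sup_csup[OF d] unfolding is_sup_def by auto
      ultimately show ?thesis using b c d eq unfolding cu_bimor_def by (simp only: simp_thms)
    qed
    show "\<psi> a' b' \<lless>\<^bsub>P\<^esub> \<psi> a b" if "a' \<lless>\<^bsub>S\<^esub> a" "b' \<lless>\<^bsub>T\<^esub> b" for a' a b' b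
      using b eq that S.way_below_closed[OF that(1)] T.way_below_closed[OF that(2)] unfolding cu_bimor_def by simp
  qed (use b eq S.add_closed T.add_closed S.zero_closed T.zero_closed in \<open>simp_all add: cu_bimor_def\<close>)
  from this[of \<phi> \<psi>] this[of \<psi> \<phi>] show ?thesis using eq by auto
qed

lemma id_cu_mor:
  assumes "cu_semigroup S" shows "(\<lambda>x\<in>carrier S. x) \<in> cu_mor S S"
proof -
  interpret cu_pair S S using assms by (simp add: cu_pair_def)
  have "(\<lambda>x\<in>carrier S. x) \<in> gcu_mor S S"
  proof (rule gmorI)
    fix c s assume c: "incr_seq S c" "is_sup S (range c) s"
    then have "(\<lambda>n. (\<lambda>x\<in>carrier S. x) (c n)) = c" "s \<in> carrier S" unfolding incr_seq_def is_sup_def by auto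
    then show "is_sup S (range (\<lambda>n. (\<lambda>x\<in>carrier S. x) (c n))) ((\<lambda>x\<in>carrier S. x) s)"
      using c(2) by (simp only: restrict_apply')
  qed (auto simp: S.add_closed S.zero_closed)
  then show ?thesis unfolding cu_mor_def by (auto simp: S.way_below_closed)
qed

lemma gcu_mor_comp:
  assumes S: "cu_semigroup S" "cu_semigroup T" "cu_semigroup P" and f: "f \<in> gcu_mor S T" and g: "g \<in> gcu_mor T P"
  shows "(\<lambda>x\<in>carrier S. g (f x)) \<in> gcu_mor S P"
proof -
  interpret ST: cu_pair S T using S by (simp add: cu_pair_def)
  interpret TP: cu_pair T P using S by (simp add: cu_pair_def)
  interpret SP: cu_pair S P using S by (simp add: cu_pair_def)
  show ?thesis
  proof (rule SP.gmorI)
    fix c s assume c: "incr_seq S c" "is_sup S (range c) s"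
    then have "(\<lambda>n. (\<lambda>x\<in>carrier S. g (f x)) (c n)) = (\<lambda>n. g (f (c n)))" "s \<in> carrier S"
      unfolding incr_seq_def is_sup_def by auto
    then show "is_sup P (range (\<lambda>n. (\<lambda>x\<in>carrier S. g (f x)) (c n))) ((\<lambda>x\<in>carrier S. g (f x)) s)"
      using TP.gmor_sup[OF g ST.gmor_incr[OF f c(1)] ST.gmor_sup[OF f c]] by (simp only: restrict_apply')
  qed (simp_all add: ST.gmor_closed[OF f] TP.gmor_closed[OF g] ST.gmor_add[OF f] TP.gmor_add[OF g] ST.gmor_zero[OF f]
     TP.gmor_zero[OF g] ST.gmor_mono[OF f] TP.gmor_mono[OF g] ST.S.add_closed ST.S.zero_closed)
qed

lemma tens_closed:
  assumes "cu_semigroup S" "cu_semigroup T" "a \<in> carrier S" "b \<in> carrier T"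
  shows "tens S T a b \<in> carrier (tensor S T)"
  using tens_cu_bimor[OF assms(1,2)] assms(3,4) unfolding cu_bimor_def by simp

lemma tensor_gmor_eq:
  assumes "cu_semigroup S" "cu_semigroup T" "cu_semigroup P"
    and "\<alpha> \<in> gcu_mor (tensor S T) P" "\<beta> \<in> gcu_mor (tensor S T) P"
    and eq: "\<And>a b. \<lbrakk>a \<in> carrier S; b \<in> carrier T\<rbrakk> \<Longrightarrow> \<alpha> (tens S T a b) = \<beta> (tens S T a b)"
    and I: "I \<in> carrier (tensor S T)"
  shows "\<alpha> I = \<beta> I"
proof -
  interpret P: cu_semigroup P by fact
  interpret TP: cu_pair "tensor S T" P using assms tensor_cu_semigroup by (simp add: cu_pair_def)
  note cl = TP.gmor_closed[OF assms(4)] TP.gmor_closed[OF assms(5)]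
  note t = tens_closed[OF assms(1,2)]
  have "\<alpha> I \<sqsubseteq>\<^bsub>P\<^esub> \<beta> I" "\<beta> I \<sqsubseteq>\<^bsub>P\<^esub> \<alpha> I"
    using tensor_mor_le_iff[OF assms(1-5)] tensor_mor_le_iff[OF assms(1-3,5,4)] eq I P.le_refl[OF cl(2)[OF t]] by auto
  then show ?thesis using P.le_antisym cl I by blast
qed

lemma cu_bimor_locI:
  "\<lbrakk>cu_semigroup S; cu_semigroup T; cu_semigroup P; cu_bimor S T P \<phi>\<rbrakk> \<Longrightarrow> cu_bimor_loc S T P \<phi>"
  by (simp add: cu_bimor_loc_def cu_pair_def cu_bimor_loc_axioms_def)

lemma tensor_lift_cong:
  assumes "\<And>a b. \<lbrakk>a \<in> carrier S; b \<in> carrier T\<rbrakk> \<Longrightarrow> \<phi> a b = \<psi> a b"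
  shows "tensor_lift S T P \<phi> = tensor_lift S T P \<psi>"
  unfolding tensor_lift_def using assms by (auto intro!: arg_cong[where f = The])

section \<open>Currying a bimorphism\<close>

context cu_bimor_loc
begin

lemma TP_pair: "cu_pair T P" and SH_pair: "cu_pair S (ihom T P)"
  using cu_pair.ihom_cu_semigroup[of T P] S.cu_semigroup_axioms T.cu_semigroup_axioms P.cu_semigroup_axioms
  by (auto simp: cu_pair_def)

definition slice :: "'a \<Rightarrow> 'b \<Rightarrow> 'c" where "slice a = (\<lambda>b\<in>carrier T. \<phi> a b)"

lemma phi_sup_right:
  assumes "a \<in> carrier S" "incr_seq T d" "is_sup T (range d) s"
  shows "is_sup P (range (\<lambda>n. \<phi> a (d n))) (\<phi> a s)"
proof -
  have "incr_seq P (\<lambda>n. \<phi> a (d n))"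
    using assms(1,2) phi_closed phi_monor unfolding incr_seq_def by blast
  from P.is_sup_csup[OF this] show ?thesis
    using phi_sup[OF S.incr_seq_const[OF assms(1)] assms(2)] S.csup_eq[OF S.is_sup_const[OF assms(1)]]
      T.csup_eq[OF assms(3)] by simp
qed

lemma phi_sup_left:
  assumes "b \<in> carrier T" "incr_seq S c" "is_sup S (range c) s"
  shows "is_sup P (range (\<lambda>n. \<phi> (c n) b)) (\<phi> s b)"
proof -
  have "incr_seq P (\<lambda>n. \<phi> (c n) b)"
    using assms(1,2) phi_closed phi_monol unfolding incr_seq_def by blast
  from P.is_sup_csup[OF this] show ?thesis
    using phi_sup[OF assms(2) T.incr_seq_const[OF assms(1)]] T.csup_eq[OF T.is_sup_const[OF assms(1)]]
      S.csup_eq[OF assms(3)] by simp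
qed

lemma slice_gmor: assumes "a \<in> carrier S" shows "slice a \<in> gcu_mor T P"
proof -
  interpret TP: cu_pair T P by (rule TP_pair)
  show ?thesis
  proof (rule TP.gmorI)
    fix d s assume d: "incr_seq T d" "is_sup T (range d) s"
    then have "(\<lambda>n. slice a (d n)) = (\<lambda>n. \<phi> a (d n))" "slice a s = \<phi> a s"
      unfolding incr_seq_def is_sup_def slice_def by auto
    then show "is_sup P (range (\<lambda>n. slice a (d n))) (slice a s)" using phi_sup_right[OF assms d] by (simp only:)
  qed (use assms in \<open>simp_all add: slice_def phi_closed phi_addr phi_zeror phi_monor T.add_closed T.zero_closed\<close>)
qed

text \<open>A single slice need not preserve \<open>\<lless>\<close>. Joint preservation in both
  variables is exactly \<open>\<prec>\<close> between the slices at a' \<lless> a.\<close>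

lemma slice_prec: "a' \<lless>\<^bsub>S\<^esub> a \<Longrightarrow> gcu_below T P (slice a') (slice a)"
  unfolding gcu_below_def slice_def using T.way_below_closed phi_wb by simp

definition slices :: "(rat \<Rightarrow> 'a) \<Rightarrow> rat \<Rightarrow> 'b \<Rightarrow> 'c" where
  "slices p = (\<lambda>t\<in>I_Q. slice (p t))"

lemma slices_closed:
  assumes "approx_path S a p" shows "slices p \<in> paths T P"
proof -
  interpret TP: cu_pair T P by (rule TP_pair)
  have "p t \<in> carrier S" if "t \<in> I_Q" for t using assms that S.way_below_closed unfolding approx_path_def by blast
  then show ?thesis
    by (intro TP.pathsI) (use assms slice_gmor slice_prec in \<open>auto simp: slices_def approx_path_def\<close>)
qed

lemma slices_le:
  assumes "approx_path S a p" "approx_path S b q" "a \<sqsubseteq>\<^bsub>S\<^esub> b" "b \<in> carrier S"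
  shows "path_le T P (slices p) (slices q)"
proof -
  interpret TP: cu_pair T P by (rule TP_pair)
  show ?thesis
  proof (rule TP.path_leI)
    fix l assume l: "l \<in> I_Q"
    have "p l \<lless>\<^bsub>S\<^esub> b" using assms S.way_below_le_trans l unfolding approx_path_def by blast
    then obtain m where "m \<in> I_Q" "p l \<lless>\<^bsub>S\<^esub> q m" using assms(2) unfolding approx_path_def by blast
    then have "gcu_below T P (slices p l) (slices q m)" using l slice_prec by (simp add: slices_def)
    then show "\<exists>m\<in>I_Q. gcu_below T P (slices p l) (slices q m)" using \<open>m \<in> I_Q\<close> by blast
  qed
qed

text \<open>The constant family at \<open>slice a\<close> need not be a path, and even if it is one
  its class may be too large, as for the unit of \<open>Pbar\<close>. Slices along a family
  approximating a give the right class.\<close>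

definition curried :: "'a \<Rightarrow> (rat \<Rightarrow> 'b \<Rightarrow> 'c) set" where
  "curried = (\<lambda>a\<in>carrier S. path_class T P (slices (SOME p. approx_path S a p)))"

lemma curried_eq:
  assumes "a \<in> carrier S" "approx_path S a p" shows "curried a = path_class T P (slices p)"
proof -
  interpret TP: cu_pair T P by (rule TP_pair)
  have "approx_path S a (SOME p. approx_path S a p)" using assms(2) by (rule someI[where P = "approx_path S a"])
  then have "path_class T P (slices (SOME p. approx_path S a p)) = path_class T P (slices p)"
    using assms S.le_refl[OF assms(1)] by (intro TP.pcls_eqI slices_closed slices_le)
  then show ?thesis unfolding curried_def using assms(1) by simp
qed

lemma curried_pathE:
  assumes "a \<in> carrier S"
  obtains p where "approx_path S a p" "slices p \<in> paths T P" "curried a = path_class T P (slices p)"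
  using S.approx_path_exists[OF assms] curried_eq[OF assms] slices_closed by blast

lemma approx_path_uq:
  assumes "approx_path S a p" shows "is_sup S (range (\<lambda>n. p (uq n))) a" "incr_seq S (\<lambda>n. p (uq n))"
proof -
  have p: "\<And>k. k \<in> I_Q \<Longrightarrow> p k \<in> carrier S" "\<And>k l. \<lbrakk>k \<in> I_Q; l \<in> I_Q; k < l\<rbrakk> \<Longrightarrow> p k \<sqsubseteq>\<^bsub>S\<^esub> p l"
    using assms S.way_below_closed S.way_below_le unfolding approx_path_def by blast+
  show "is_sup S (range (\<lambda>n. p (uq n))) a"
    using S.is_sup_uq[of p, OF p] assms unfolding approx_path_def by blast
  show "incr_seq S (\<lambda>n. p (uq n))" unfolding incr_seq_def using p uq_I_Q uq_less by blast
qed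

lemma endpoint_curried:
  assumes "a \<in> carrier S" "b \<in> carrier T" shows "endpoint T P (curried a) b = \<phi> a b"
proof -
  interpret TP: cu_pair T P by (rule TP_pair)
  obtain p where p: "approx_path S a p" "slices p \<in> paths T P" "curried a = path_class T P (slices p)"
    by (rule curried_pathE[OF assms(1)])
  have "slices p (uq n) b = \<phi> (p (uq n)) b" for n using uq_I_Q[of n] assms by (simp add: slices_def slice_def)
  then show ?thesis unfolding p(3) TP.endpoint_seq[OF p(2) assms(2)]
    using P.csup_eq[OF phi_sup_left[OF assms(2) approx_path_uq(2,1)[OF p(1)]]] by simp
qed

lemma curried_cu_mor: "curried \<in> cu_mor S (ihom T P)"
proof -
  interpret TP: cu_pair T P by (rule TP_pair)
  interpret SH: cu_pair S "ihom T P" by (rule SH_pair)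
  have cl: "curried a \<in> carrier (ihom T P)" if "a \<in> carrier S" for a
    by (rule curried_pathE[OF that]) (simp add: TP.pcls_closed)
  have mono: "curried a \<sqsubseteq>\<^bsub>ihom T P\<^esub> curried b" if ab: "a \<in> carrier S" "b \<in> carrier S" "a \<sqsubseteq>\<^bsub>S\<^esub> b" for a b
  proof -
    obtain p where p: "approx_path S a p" "slices p \<in> paths T P" "curried a = path_class T P (slices p)"
      by (rule curried_pathE[OF ab(1)])
    obtain q where q: "approx_path S b q" "slices q \<in> paths T P" "curried b = path_class T P (slices q)"
      by (rule curried_pathE[OF ab(2)])
    show ?thesis unfolding p(3) q(3) TP.H_le[OF p(2) q(2)] using slices_le p q ab by blast
  qed
  have "curried \<in> gcu_mor S (ihom T P)"
  proof (rule SH.gmorI)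
    show "curried \<in> extensional (carrier S)" unfolding curried_def by simp
    show "curried (a \<oplus>\<^bsub>S\<^esub> b) = curried a \<oplus>\<^bsub>ihom T P\<^esub> curried b" if ab: "a \<in> carrier S" "b \<in> carrier S" for a b
    proof -
      obtain p where p: "approx_path S a p" "slices p \<in> paths T P" "curried a = path_class T P (slices p)"
        by (rule curried_pathE[OF ab(1)])
      obtain q where q: "approx_path S b q" "slices q \<in> paths T P" "curried b = path_class T P (slices q)"
        by (rule curried_pathE[OF ab(2)])
      obtain r where r: "approx_path S (a \<oplus>\<^bsub>S\<^esub> b) r" "slices r \<in> paths T P"
          "curried (a \<oplus>\<^bsub>S\<^esub> b) = path_class T P (slices r)"
        by (rule curried_pathE[OF S.add_closed[OF ab]])
      have pc: "p t \<in> carrier S" and qc: "q t \<in> carrier S" if "t \<in> I_Q" for t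
        using p(1) q(1) that S.way_below_closed unfolding approx_path_def by blast+
      have plus: "path_add T P (slices p) (slices q) t = slice (p t \<oplus>\<^bsub>S\<^esub> q t)" if "t \<in> I_Q" for t
        using that pc[OF that] qc[OF that] by (auto simp: path_add_def slices_def slice_def phi_addl fun_eq_iff)
      \<comment> \<open>The sums of the families for a and b approximate a + b as well: r l is split
        below a' + b', and both summands are then lifted to a common index u.\<close>
      have 1: "path_le T P (slices r) (path_add T P (slices p) (slices q))"
      proof (rule TP.path_leI)
        fix l assume l: "l \<in> I_Q"
        then have "r l \<lless>\<^bsub>S\<^esub> a \<oplus>\<^bsub>S\<^esub> b" using r(1) unfolding approx_path_def by blast
        then obtain a' b' where a': "a' \<lless>\<^bsub>S\<^esub> a" "b' \<lless>\<^bsub>S\<^esub> b" "r l \<sqsubseteq>\<^bsub>S\<^esub> a' \<oplus>\<^bsub>S\<^esub> b'"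
          using S.way_below_add_split ab by blast
        obtain s where s: "s \<in> I_Q" "a' \<lless>\<^bsub>S\<^esub> p s" using p(1) a'(1) unfolding approx_path_def by blast
        obtain t where t: "t \<in> I_Q" "b' \<lless>\<^bsub>S\<^esub> q t" using q(1) a'(2) unfolding approx_path_def by blast
        obtain u where u: "u \<in> I_Q" "s < u" "t < u" using I_Q_above2 s t by blast
        have "p s \<sqsubseteq>\<^bsub>S\<^esub> p u" "q t \<sqsubseteq>\<^bsub>S\<^esub> q u"
          using p(1) q(1) s(1) t(1) u S.way_below_le unfolding approx_path_def by blast+
        then have "a' \<oplus>\<^bsub>S\<^esub> b' \<lless>\<^bsub>S\<^esub> p u \<oplus>\<^bsub>S\<^esub> q u"
          using S.O3 S.way_below_le_trans[OF s(2) _ pc[OF u(1)]] S.way_below_le_trans[OF t(2) _ qc[OF u(1)]] by blast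
        then have "r l \<lless>\<^bsub>S\<^esub> p u \<oplus>\<^bsub>S\<^esub> q u"
          using S.le_way_below_trans[OF a'(3)] S.way_below_closed(1)[OF \<open>r l \<lless>\<^bsub>S\<^esub> a \<oplus>\<^bsub>S\<^esub> b\<close>] by blast
        then have "gcu_below T P (slices r l) (path_add T P (slices p) (slices q) u)"
          using l slice_prec plus[OF u(1)] by (simp add: slices_def)
        then show "\<exists>m\<in>I_Q. gcu_below T P (slices r l) (path_add T P (slices p) (slices q) m)" using u(1) by blast
      qed
      have 2: "path_le T P (path_add T P (slices p) (slices q)) (slices r)"
      proof (rule TP.path_leI)
        fix l assume l: "l \<in> I_Q"
        then have "p l \<oplus>\<^bsub>S\<^esub> q l \<lless>\<^bsub>S\<^esub> a \<oplus>\<^bsub>S\<^esub> b" using p(1) q(1) S.O3 unfolding approx_path_def by blast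
        then obtain m where m: "m \<in> I_Q" "p l \<oplus>\<^bsub>S\<^esub> q l \<lless>\<^bsub>S\<^esub> r m" using r(1) unfolding approx_path_def by blast
        then have "gcu_below T P (path_add T P (slices p) (slices q) l) (slices r m)"
          using slice_prec plus[OF l] by (simp add: slices_def)
        then show "\<exists>m\<in>I_Q. gcu_below T P (path_add T P (slices p) (slices q) l) (slices r m)" using m(1) by blast
      qed
      show ?thesis unfolding p(3) q(3) r(3) TP.H_add[OF p(2) q(2)]
        by (rule TP.pcls_eqI[OF r(2) TP.path_add_closed[OF p(2) q(2)] 1 2])
    qed
    show "curried \<zero>\<^bsub>S\<^esub> = \<zero>\<^bsub>ihom T P\<^esub>"
    proof -
      obtain p where p: "approx_path S \<zero>\<^bsub>S\<^esub> p" "slices p \<in> paths T P" "curried \<zero>\<^bsub>S\<^esub> = path_class T P (slices p)"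
        by (rule curried_pathE[OF S.zero_closed])
      have "p t = \<zero>\<^bsub>S\<^esub>" if "t \<in> I_Q" for t
      proof -
        have "p t \<lless>\<^bsub>S\<^esub> \<zero>\<^bsub>S\<^esub>" using p(1) that unfolding approx_path_def by blast
        then show ?thesis
          using S.le_antisym[OF _ S.zero_closed] S.way_below_le S.way_below_closed(1) S.zero_le by blast
      qed
      then have "slices p = TP.path_zero" unfolding slices_def TP.path_zero_def slice_def
        by (auto simp: fun_eq_iff phi_zerol)
      then show ?thesis unfolding p(3) TP.H_zero by simp
    qed
    show "is_sup (ihom T P) (range (\<lambda>n. curried (c n))) (curried s)" if c: "incr_seq S c" "is_sup S (range c) s" for c s
      unfolding is_sup_def
    proof (intro conjI ballI impI)
      have cc: "\<And>n. c n \<in> carrier S" using c unfolding incr_seq_def by blast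
      have s: "s \<in> carrier S" "\<And>n. c n \<sqsubseteq>\<^bsub>S\<^esub> s" using c unfolding is_sup_def by auto
      show "curried s \<in> carrier (ihom T P)" by (rule cl[OF s(1)])
      show "x \<sqsubseteq>\<^bsub>ihom T P\<^esub> curried s" if "x \<in> range (\<lambda>n. curried (c n))" for x
        using that mono[OF cc s] by blast
      fix U assume U: "U \<in> carrier (ihom T P)" "\<forall>x\<in>range (\<lambda>n. curried (c n)). x \<sqsubseteq>\<^bsub>ihom T P\<^esub> U"
      obtain u where u: "u \<in> paths T P" "U = path_class T P u" using U TP.H_carrier by blast
      obtain p where p: "approx_path S s p" "slices p \<in> paths T P" "curried s = path_class T P (slices p)"
        by (rule curried_pathE[OF s(1)])
      have "path_le T P (slices p) u"
      proof (rule TP.path_leI)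
        fix l assume l: "l \<in> I_Q"
        obtain m where m: "m \<in> I_Q" "l < m" using I_Q_above l by blast
        have pm: "p m \<lless>\<^bsub>S\<^esub> s" "p l \<lless>\<^bsub>S\<^esub> p m" using p(1) l m unfolding approx_path_def by blast+
        obtain n where "p m \<sqsubseteq>\<^bsub>S\<^esub> c n" using S.way_below_seq[OF pm(1) c] by blast
        then have n: "p l \<lless>\<^bsub>S\<^esub> c n" by (rule S.way_below_le_trans[OF pm(2) _ cc])
        obtain q where q: "approx_path S (c n) q" "slices q \<in> paths T P" "curried (c n) = path_class T P (slices q)"
          by (rule curried_pathE[OF cc])
        obtain r where r: "r \<in> I_Q" "p l \<lless>\<^bsub>S\<^esub> q r" using q(1) n unfolding approx_path_def by blast
        have "path_le T P (slices q) u" using U(2) u q TP.H_le[OF q(2) u(1)] by blast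
        then obtain k where k: "k \<in> I_Q" "gcu_below T P (slices q r) (u k)" using TP.path_leD r(1) by blast
        have "gcu_below T P (slices p l) (slices q r)" using slice_prec[OF r(2)] l r(1) by (simp add: slices_def)
        then show "\<exists>m\<in>I_Q. gcu_below T P (slices p l) (u m)"
          using TP.prec_trans[OF TP.path_gmor[OF p(2) l] TP.path_gmor[OF q(2) r(1)] _ k(2)] k(1) by blast
      qed
      then show "curried s \<sqsubseteq>\<^bsub>ihom T P\<^esub> U" unfolding p(3) u(2) TP.H_le[OF p(2) u(1)] .
    qed
  qed (use cl mono in auto)
  moreover have "curried a' \<lless>\<^bsub>ihom T P\<^esub> curried a" if wb: "a' \<lless>\<^bsub>S\<^esub> a" for a' a
  proof -
    note ac = S.way_below_closed[OF wb]
    obtain p where p: "approx_path S a p" "slices p \<in> paths T P" "curried a = path_class T P (slices p)"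
      by (rule curried_pathE[OF ac(2)])
    obtain q where q: "approx_path S a' q" "slices q \<in> paths T P" "curried a' = path_class T P (slices q)"
      by (rule curried_pathE[OF ac(1)])
    obtain t where t: "t \<in> I_Q" "a' \<lless>\<^bsub>S\<^esub> p t" using p(1) wb unfolding approx_path_def by blast
    obtain l where l: "l \<in> I_Q" "t < l" using I_Q_above t by blast
    have d: "t / l \<in> I_Q" "l * (t / l) = t" using t l by (auto simp: field_simps)
    \<comment> \<open>All members of the family of a' lie way below the one element p t, so the
      whole path of a' fits under index t / l of the cut at l, which is index t of the original
      path.\<close>
    have "path_le T P (slices q) (TP.cut (slices p) l)"
    proof (rule TP.path_leI)
      fix r assume r: "r \<in> I_Q"
      then have "q r \<lless>\<^bsub>S\<^esub> p t" using q(1) t(2) S.way_below_le_trans[OF _ S.way_below_le] S.way_below_closed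
        unfolding approx_path_def by blast
      then have "gcu_below T P (slices q r) (TP.cut (slices p) l (t / l))"
        using slice_prec r t d by (simp add: slices_def TP.cut_def)
      then show "\<exists>m\<in>I_Q. gcu_below T P (slices q r) (TP.cut (slices p) l m)" using d by blast
    qed
    then have "curried a' \<sqsubseteq>\<^bsub>ihom T P\<^esub> path_class T P (TP.cut (slices p) l)"
      unfolding q(3) TP.H_le[OF q(2) TP.cut_closed[OF p(2) l(1)]] .
    then show ?thesis using SH.T.le_way_below_trans[OF _ TP.cut_way_below[OF p(2) l(1)] cl[OF ac(1)]] unfolding p(3) by blast
  qed
  ultimately show ?thesis unfolding cu_mor_def by blast
qed

text \<open>Endpoints alone do not determine a class in general, but preservation of
  \<open>\<lless>\<close> does the rest. Cuts of \<alpha> a lie below some \<alpha> (p t), and each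
  \<alpha> (p t) lies below some cut of \<alpha> a. Since a cut leaves one strict step of the path
  to spare, comparing endpoints pointwise suffices to compare the paths for
  \<open>\<prec>\<close>.\<close>

lemma curried_unique:
  assumes \<alpha>: "\<alpha> \<in> cu_mor S (ihom T P)"
    and ep: "\<And>a b. \<lbrakk>a \<in> carrier S; b \<in> carrier T\<rbrakk> \<Longrightarrow> endpoint T P (\<alpha> a) b = \<phi> a b"
  shows "\<alpha> = curried"
proof -
  interpret TP: cu_pair T P by (rule TP_pair)
  interpret SH: cu_pair S "ihom T P" by (rule SH_pair)
  have \<alpha>g: "\<alpha> \<in> gcu_mor S (ihom T P)" and \<alpha>w: "\<And>x y. x \<lless>\<^bsub>S\<^esub> y \<Longrightarrow> \<alpha> x \<lless>\<^bsub>ihom T P\<^esub> \<alpha> y"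
    using \<alpha> unfolding cu_mor_def by auto
  have "\<alpha> a = curried a" if a: "a \<in> carrier S" for a
  proof -
    obtain p where p: "approx_path S a p" "slices p \<in> paths T P" "curried a = path_class T P (slices p)"
      by (rule curried_pathE[OF a])
    have pc: "p t \<in> carrier S" if "t \<in> I_Q" for t using p(1) that S.way_below_closed unfolding approx_path_def by blast
    obtain f where f: "f \<in> paths T P" "\<alpha> a = path_class T P f" using SH.gmor_closed[OF \<alpha>g a] TP.H_carrier by blast
    have 1: "path_le T P f (slices p)"
    proof (rule TP.path_leI)
      fix l assume l: "l \<in> I_Q"
      obtain m where m: "m \<in> I_Q" "l < m" using I_Q_above l by blast
      have "path_class T P (TP.cut f m) \<lless>\<^bsub>ihom T P\<^esub> \<alpha> a" unfolding f(2) by (rule TP.cut_way_below[OF f(1) m(1)])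
      then obtain n where n: "path_class T P (TP.cut f m) \<sqsubseteq>\<^bsub>ihom T P\<^esub> \<alpha> (p (uq n))"
        using SH.T.way_below_seq[OF _ SH.gmor_incr[OF \<alpha>g approx_path_uq(2)[OF p(1)]]
          SH.gmor_sup[OF \<alpha>g approx_path_uq(2,1)[OF p(1)]]] by blast
      obtain g where g: "g \<in> paths T P" "\<alpha> (p (uq n)) = path_class T P g"
        using SH.gmor_closed[OF \<alpha>g pc[OF uq_I_Q]] TP.H_carrier by blast
      have cg: "path_le T P (TP.cut f m) g" using n unfolding g(2) TP.H_le[OF TP.cut_closed[OF f(1) m(1)] g(1)] .
      have d: "l / m \<in> I_Q" "m * (l / m) = l" using l m by (auto simp: field_simps)
      obtain k where k: "k \<in> I_Q" "gcu_below T P (f l) (g k)"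
        using TP.path_leD[OF cg d(1)] d by (auto simp: TP.cut_def)
      have "TP.gmor_le (g k) (slices p (uq n))"
        unfolding TP.gmor_le_def
      proof
        fix b assume b: "b \<in> carrier T"
        have "endpoint T P (path_class T P g) b = slices p (uq n) b"
          using ep[OF pc[OF uq_I_Q] b] b uq_I_Q[of n] by (simp add: g(2)[symmetric] slices_def slice_def)
        then show "g k b \<sqsubseteq>\<^bsub>P\<^esub> slices p (uq n) b" using TP.endpoint_upper[OF g(1) b k(1)] by simp
      qed
      then show "\<exists>m\<in>I_Q. gcu_below T P (f l) (slices p m)"
        using TP.prec_le_trans[OF k(2) _ TP.path_gmor[OF p(2) uq_I_Q]] uq_I_Q by blast
    qed
    have 2: "path_le T P (slices p) f"
    proof (rule TP.path_leI)
      fix l assume l: "l \<in> I_Q"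
      have "\<alpha> (p l) \<lless>\<^bsub>ihom T P\<^esub> path_class T P f" using \<alpha>w p(1) l unfolding f(2)[symmetric] approx_path_def by blast
      then obtain k where k: "k \<in> I_Q" "\<alpha> (p l) \<sqsubseteq>\<^bsub>ihom T P\<^esub> path_class T P (TP.cut f k)"
        using TP.H_way_belowD f(1) by blast
      obtain m where m: "m \<in> I_Q" "k < m" using I_Q_above k by blast
      obtain g where g: "g \<in> paths T P" "\<alpha> (p l) = path_class T P g"
        using SH.gmor_closed[OF \<alpha>g pc[OF l]] TP.H_carrier by blast
      have gc: "path_le T P g (TP.cut f k)" using k(2) unfolding g(2) TP.H_le[OF g(1) TP.cut_closed[OF f(1) k(1)]] .
      have "TP.gmor_le (slices p l) (f k)"
        unfolding TP.gmor_le_def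
      proof
        fix b assume b: "b \<in> carrier T"
        have "slices p l b = endpoint T P (path_class T P g) b"
          using ep[OF pc[OF l] b] b l by (simp add: g(2)[symmetric] slices_def slice_def)
        also have "\<dots> \<sqsubseteq>\<^bsub>P\<^esub> f k b"
        proof (rule TP.endpoint_least[OF g(1) b TP.path_point_closed[OF f(1) b k(1)]])
          fix i assume i: "i \<in> I_Q"
          obtain j where j: "j \<in> I_Q" "gcu_below T P (g i) (TP.cut f k j)" using TP.path_leD[OF gc i] by blast
          have c: "g i \<in> gcu_mor T P" "TP.cut f k j \<in> gcu_mor T P" "f k \<in> gcu_mor T P"
            using TP.path_gmor g(1) i f(1) k(1) j(1) TP.cut_closed by blast+
          have "gcu_below T P (g i) (f k)" by (rule TP.prec_trans[OF c(1,2) j(2) TP.cut_prec[OF f(1) k(1) j(1)]])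
          then show "g i b \<sqsubseteq>\<^bsub>P\<^esub> f k b" using TP.prec_le[OF c(1,3)] b unfolding TP.gmor_le_def by blast
        qed
        finally show "slices p l b \<sqsubseteq>\<^bsub>P\<^esub> f k b" .
      qed
      then have "gcu_below T P (slices p l) (f m)"
        using TP.le_prec_trans[OF TP.path_gmor[OF p(2) l] _ TP.path_prec[OF f(1) k(1) m]] by blast
      then show "\<exists>m\<in>I_Q. gcu_below T P (slices p l) (f m)" using m(1) by blast
    qed
    show ?thesis unfolding f(2) p(3) by (rule TP.pcls_eqI[OF f(1) p(2) 1 2])
  qed
  moreover have "\<alpha> \<in> extensional (carrier S)" "curried \<in> extensional (carrier S)"
    using SH.gmor_ext[OF \<alpha>g] unfolding curried_def by auto
  ultimately show ?thesis by (rule extensionalityI[rotated 2])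
qed

end

section \<open>The adjunction and its inverse\<close>

lemma endpoint_comp_bimor:
  assumes "cu_semigroup S" "cu_semigroup T" "cu_semigroup P" and \<alpha>: "\<alpha> \<in> cu_mor S (ihom T P)"
  shows "cu_bimor S T P (\<lambda>a b. endpoint T P (\<alpha> a) b)"
proof -
  interpret cu_pair T P using assms by (simp add: cu_pair_def)
  have "cu_bimor S T P (\<lambda>a b. endpoint T P (\<alpha> a) ((\<lambda>x\<in>carrier T. x) b))"
    by (rule cu_bimor_comp[OF assms(1,2) ihom_cu_semigroup assms(2) endpoint_bimor \<alpha> id_cu_mor[OF assms(2)]])
  then show ?thesis by (rule cu_bimor_cong[OF assms(1,2), THEN iffD1, rotated]) simp
qed

lemma hom_adj:
  assumes "cu_semigroup S" "cu_semigroup T" "cu_semigroup P" and "\<alpha> \<in> cu_mor S (ihom T P)"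
  shows "hom_adj S T P \<alpha> \<in> cu_mor (tensor S T) P"
    and "\<lbrakk>a \<in> carrier S; b \<in> carrier T\<rbrakk> \<Longrightarrow> hom_adj S T P \<alpha> (tens S T a b) = endpoint T P (\<alpha> a) b"
  unfolding hom_adj_def using tensor_lift[OF assms(1-3) endpoint_comp_bimor[OF assms]] by blast+

lemma hom_adj_inj_on:
  assumes "cu_semigroup S" "cu_semigroup T" "cu_semigroup P"
  shows "inj_on (hom_adj S T P) (cu_mor S (ihom T P))"
proof (rule inj_onI)
  fix \<alpha> \<beta> assume \<alpha>: "\<alpha> \<in> cu_mor S (ihom T P)" and \<beta>: "\<beta> \<in> cu_mor S (ihom T P)"
    and eq: "hom_adj S T P \<alpha> = hom_adj S T P \<beta>"
  interpret B: cu_bimor_loc S T P "\<lambda>a b. endpoint T P (\<beta> a) b"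
    by (rule cu_bimor_locI[OF assms endpoint_comp_bimor[OF assms \<beta>]])
  have "endpoint T P (\<alpha> a) b = endpoint T P (\<beta> a) b" if "a \<in> carrier S" "b \<in> carrier T" for a b
    using hom_adj(2)[OF assms \<alpha> that] hom_adj(2)[OF assms \<beta> that] eq by simp
  then show "\<alpha> = \<beta>" using B.curried_unique[OF \<alpha>] B.curried_unique[OF \<beta>] by simp
qed

text \<open>Makes \<open>pi_map\<close> concrete: the inverse of the adjunction in its definition
  becomes the path of slices of the multiplication.\<close>

lemma (in cu_bimor_loc) the_inv_hom_adj:
  "the_inv_into (cu_mor S (ihom T P)) (hom_adj S T P) (tensor_lift S T P \<phi>) = curried"
proof (rule the_inv_into_f_eq)
  show "inj_on (hom_adj S T P) (cu_mor S (ihom T P))"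
    by (rule hom_adj_inj_on) unfold_locales
  show "hom_adj S T P curried = tensor_lift S T P \<phi>"
    unfolding hom_adj_def by (rule tensor_lift_cong) (rule endpoint_curried)
qed (rule curried_cu_mor)

text \<open>Fixing the second argument gives no control of \<open>\<lless>\<close> when that
  argument is not compact. Evaluation of endpoints at the unit and the map a -> a \<otimes> 1 are
  the instances used later.\<close>

lemma (in cu_bimor_loc) slice_left_gmor:
  assumes "b \<in> carrier T" shows "(\<lambda>a\<in>carrier S. \<phi> a b) \<in> gcu_mor S P"
proof -
  interpret SP: cu_pair S P by unfold_locales
  show ?thesis
  proof (rule SP.gmorI)
    fix c s assume c: "incr_seq S c" "is_sup S (range c) s"
    then have "(\<lambda>n. (\<lambda>a\<in>carrier S. \<phi> a b) (c n)) = (\<lambda>n. \<phi> (c n) b)" "(\<lambda>a\<in>carrier S. \<phi> a b) s = \<phi> s b"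
      unfolding incr_seq_def is_sup_def by auto
    then show "is_sup P (range (\<lambda>n. (\<lambda>a\<in>carrier S. \<phi> a b) (c n))) ((\<lambda>a\<in>carrier S. \<phi> a b) s)"
      using phi_sup_left[OF assms c] by (simp only:)
  qed (use assms in \<open>simp_all add: phi_closed phi_addl phi_zerol phi_monol S.add_closed S.zero_closed\<close>)
qed

section \<open>Isomorphisms\<close>

lemma cu_iso_cancel_left:
  assumes h: "cu_iso S P h" and g: "cu_iso T P g"
    and f: "\<And>x. x \<in> carrier S \<Longrightarrow> f x \<in> carrier T"
      "\<And>x y. \<lbrakk>x \<in> carrier S; y \<in> carrier S\<rbrakk> \<Longrightarrow> f (x \<oplus>\<^bsub>S\<^esub> y) = f x \<oplus>\<^bsub>T\<^esub> f y"
    and eq: "\<And>x. x \<in> carrier S \<Longrightarrow> h x = g (f x)"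
  shows "cu_iso S T f"
  unfolding cu_iso_def
proof (intro conjI ballI)
  have hb: "bij_betw h (carrier S) (carrier P)" and gb: "bij_betw g (carrier T) (carrier P)"
    using h g unfolding cu_iso_def by auto
  show "bij_betw f (carrier S) (carrier T)" unfolding bij_betw_def
  proof
    show "inj_on f (carrier S)"
      using hb eq unfolding bij_betw_def inj_on_def by metis
    have "z \<in> f ` carrier S" if z: "z \<in> carrier T" for z
    proof -
      have "g z \<in> h ` carrier S" using z hb gb unfolding bij_betw_def by auto
      then obtain x where x: "x \<in> carrier S" "g z = g (f x)" using eq by auto
      then have "z = f x" using gb z f(1) unfolding bij_betw_def inj_on_def by blast
      then show ?thesis using x by blast
    qed
    then show "f ` carrier S = carrier T" using f(1) by blast
  qed
  show "x \<sqsubseteq>\<^bsub>S\<^esub> y \<longleftrightarrow> f x \<sqsubseteq>\<^bsub>T\<^esub> f y" if "x \<in> carrier S" "y \<in> carrier S" for x y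
    using h g that f(1) eq unfolding cu_iso_def by simp
qed (use f in auto)

lemma cu_iso_cancel_right:
  assumes h: "cu_iso S P h" and f: "cu_iso S T f"
    and g: "\<And>x y. \<lbrakk>x \<in> carrier T; y \<in> carrier T\<rbrakk> \<Longrightarrow> g (x \<oplus>\<^bsub>T\<^esub> y) = g x \<oplus>\<^bsub>P\<^esub> g y"
    and eq: "\<And>x. x \<in> carrier S \<Longrightarrow> h x = g (f x)"
  shows "cu_iso T P g"
  unfolding cu_iso_def
proof (intro conjI ballI)
  have hb: "bij_betw h (carrier S) (carrier P)" and fb: "bij_betw f (carrier S) (carrier T)"
    using h f unfolding cu_iso_def by auto
  have T: "\<exists>x\<in>carrier S. y = f x" if "y \<in> carrier T" for y using fb that unfolding bij_betw_def by blast
  show "bij_betw g (carrier T) (carrier P)" unfolding bij_betw_def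
  proof
    show "inj_on g (carrier T)"
    proof (rule inj_onI)
      fix y z assume "y \<in> carrier T" "z \<in> carrier T" and yz: "g y = g z"
      then obtain u v where uv: "u \<in> carrier S" "v \<in> carrier S" "y = f u" "z = f v" using T by blast
      then have "h u = h v" using eq yz by simp
      then show "y = z" using uv hb unfolding bij_betw_def inj_on_def by blast
    qed
    have "g ` carrier T = (\<lambda>x. g (f x)) ` carrier S" using fb unfolding bij_betw_def by (metis image_image)
    also have "\<dots> = carrier P" using hb eq unfolding bij_betw_def by simp
    finally show "g ` carrier T = carrier P" .
  qed
  show "x \<sqsubseteq>\<^bsub>T\<^esub> y \<longleftrightarrow> g x \<sqsubseteq>\<^bsub>P\<^esub> g y" if xy: "x \<in> carrier T" "y \<in> carrier T" for x y
  proof -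
    obtain u v where uv: "u \<in> carrier S" "v \<in> carrier S" "x = f u" "y = f v" using T xy by blast
    then show ?thesis using h f eq unfolding cu_iso_def by simp
  qed
qed (use g in auto)

lemma cu_iso_id: "cu_iso S S (\<lambda>x. x)"
  unfolding cu_iso_def by (simp add: bij_betw_def)

text \<open>Suprema and \<open>\<lless>\<close> are expressed by the order alone, so an order
  isomorphism transports them. This upgrades \<epsilon> to a Cu-morphism once it is known to be an
  isomorphism.\<close>

lemma cu_iso_cu_mor:
  assumes "cu_semigroup S" "cu_semigroup T" and f: "cu_iso S T f" "f \<in> extensional (carrier S)"
  shows "f \<in> cu_mor S T"
proof -
  interpret cu_pair S T using assms by (simp add: cu_pair_def)
  have bij: "bij_betw f (carrier S) (carrier T)"
    and add: "\<And>a b. \<lbrakk>a \<in> carrier S; b \<in> carrier S\<rbrakk> \<Longrightarrow> f (a \<oplus>\<^bsub>S\<^esub> b) = f a \<oplus>\<^bsub>T\<^esub> f b"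
    and le: "\<And>a b. \<lbrakk>a \<in> carrier S; b \<in> carrier S\<rbrakk> \<Longrightarrow> f a \<sqsubseteq>\<^bsub>T\<^esub> f b \<longleftrightarrow> a \<sqsubseteq>\<^bsub>S\<^esub> b"
    using f(1) unfolding cu_iso_def by auto
  have cl: "f a \<in> carrier T" if "a \<in> carrier S" for a using bij that bij_betwE by blast
  have sur: "\<exists>a\<in>carrier S. b = f a" if "b \<in> carrier T" for b using bij that unfolding bij_betw_def by blast
  have sup: "is_sup T (range (\<lambda>n. f (c n))) (f s) \<longleftrightarrow> is_sup S (range c) s"
    if "\<And>n. c n \<in> carrier S" "s \<in> carrier S" for c :: "nat \<Rightarrow> _" and s
  proof -
    have "carrier T = f ` carrier S" using bij unfolding bij_betw_def by simp
    then show ?thesis using that le unfolding is_sup_def by auto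
  qed
  have "f \<in> G"
  proof (rule gmorI)
    obtain z where z: "z \<in> carrier S" "\<zero>\<^bsub>T\<^esub> = f z" using sur T.zero_closed by blast
    have "f \<zero>\<^bsub>S\<^esub> \<sqsubseteq>\<^bsub>T\<^esub> \<zero>\<^bsub>T\<^esub>" unfolding z(2) using le S.zero_closed z(1) S.zero_le by simp
    then show "f \<zero>\<^bsub>S\<^esub> = \<zero>\<^bsub>T\<^esub>"
      using T.le_antisym[OF cl[OF S.zero_closed] T.zero_closed] T.zero_le[OF cl[OF S.zero_closed]] by blast
    show "is_sup T (range (\<lambda>n. f (c n))) (f s)" if "incr_seq S c" "is_sup S (range c) s" for c s
      using that sup[of c s] unfolding incr_seq_def is_sup_def[of S] by blast
  qed (use f(2) cl add le in auto)
  moreover have "f a \<lless>\<^bsub>T\<^esub> f b" if wb: "a \<lless>\<^bsub>S\<^esub> b" for a b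
    unfolding way_below_def
  proof (intro conjI allI impI; (elim conjE)?)
    note ab = S.way_below_closed[OF wb]
    show "f a \<in> carrier T" "f b \<in> carrier T" using ab cl by auto
    fix d t assume d: "incr_seq T d" "is_sup T (range d) t" "f b \<sqsubseteq>\<^bsub>T\<^esub> t"
    then have "\<forall>n. \<exists>a. a \<in> carrier S \<and> d n = f a" using sur unfolding incr_seq_def by blast
    then obtain c where c: "\<And>n. c n \<in> carrier S" "d = (\<lambda>n. f (c n))" by metis
    obtain s where s: "s \<in> carrier S" "t = f s" using d(2) sur unfolding is_sup_def by blast
    have "incr_seq S c" "is_sup S (range c) s" "b \<sqsubseteq>\<^bsub>S\<^esub> s"
      using d c sup[of c s] s le ab unfolding incr_seq_def by auto
    then obtain k where "a \<sqsubseteq>\<^bsub>S\<^esub> c k" using wb unfolding way_below_def by blast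
    then show "\<exists>k. f a \<sqsubseteq>\<^bsub>T\<^esub> d k" using c le ab by auto
  qed
  ultimately show ?thesis unfolding cu_mor_def by blast
qed

text \<open>One composite has to be checked on elementary tensors only, because generalized
  Cu-morphisms that agree there are equal. The candidate \<psi> may be merely generalized: the
  inverses a -> a \<otimes> 1 used later arise as slices.\<close>

lemma tensor_lift_iso:
  assumes cu: "cu_semigroup S" "cu_semigroup T" "cu_semigroup P" and \<phi>: "cu_bimor S T P \<phi>"
    and \<psi>: "\<psi> \<in> gcu_mor P (tensor S T)"
    and \<psi>\<phi>: "\<And>a b. \<lbrakk>a \<in> carrier S; b \<in> carrier T\<rbrakk> \<Longrightarrow> \<psi> (\<phi> a b) = tens S T a b"
    and sec: "\<And>p. p \<in> carrier P \<Longrightarrow> tensor_lift S T P \<phi> (\<psi> p) = p"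
  shows "cu_iso (tensor S T) P (tensor_lift S T P \<phi>)"
proof -
  let ?m = "tensor_lift S T P \<phi>" and ?ST = "tensor S T"
  have ST: "cu_semigroup ?ST" by (rule tensor_cu_semigroup[OF cu(1,2)])
  interpret M: cu_pair ?ST P using ST cu by (simp add: cu_pair_def)
  interpret N: cu_pair P ?ST using ST cu by (simp add: cu_pair_def)
  have m: "?m \<in> gcu_mor ?ST P" using tensor_lift(1)[OF cu \<phi>] unfolding cu_mor_def by blast
  have id: "(\<lambda>x\<in>carrier ?ST. x) \<in> gcu_mor ?ST ?ST" using id_cu_mor[OF ST] unfolding cu_mor_def by blast
  note t = tens_closed[OF cu(1,2)]
  have inv: "\<psi> (?m I) = I" if "I \<in> carrier ?ST" for I
    using tensor_gmor_eq[OF cu(1,2) ST gcu_mor_comp[OF ST cu(3) ST m \<psi>] id _ that]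
      tensor_lift(2)[OF cu \<phi>] \<psi>\<phi> t that by simp
  show ?thesis unfolding cu_iso_def
  proof (intro conjI ballI)
    show "bij_betw ?m (carrier ?ST) (carrier P)"
      by (rule bij_betw_byWitness[where f' = \<psi>]) (use inv sec M.gmor_closed[OF m] N.gmor_closed[OF \<psi>] in auto)
    show "x \<sqsubseteq>\<^bsub>?ST\<^esub> y \<longleftrightarrow> ?m x \<sqsubseteq>\<^bsub>P\<^esub> ?m y" if "x \<in> carrier ?ST" "y \<in> carrier ?ST" for x y
      using M.gmor_mono[OF m that] N.gmor_mono[OF \<psi> M.gmor_closed[OF m that(1)] M.gmor_closed[OF m that(2)]]
        inv[OF that(1)] inv[OF that(2)] by auto
  qed (use M.gmor_add[OF m] in auto)
qed

section \<open>Transferring inequalities of tensors\<close>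

text \<open>The generators of the pre-order mention addition, zero and order, all of which a
  generalized Cu-morphism preserves.\<close>

lemma tensor_le_map:
  assumes "cu_semigroup S'" "cu_semigroup S" "cu_semigroup T" and \<gamma>: "\<gamma> \<in> gcu_mor S' S"
    and "tensor_le S' T x y"
  shows "tensor_le S T (map (map_prod \<gamma> (\<lambda>b. b)) x) (map (map_prod \<gamma> (\<lambda>b. b)) y)"
proof -
  interpret G: cu_pair S' S using assms by (simp add: cu_pair_def)
  interpret T: cu_semigroup T by fact
  note cl = G.gmor_closed[OF \<gamma>]
  have fs: "map (map_prod \<gamma> (\<lambda>b. b)) z \<in> formal_sums S T" if "z \<in> formal_sums S' T" for z
    using that cl by (induction z) (auto simp: formal_sums_simps)
  show ?thesis using assms(5)
  proof (induction rule: tensor_le.induct)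
    case (trans x y z) then show ?case using tensor_le.trans[OF trans.IH] by blast
  next
    case (mono a a' b b')
    then show ?case by (auto intro!: tensor_le.mono simp: cl G.gmor_mono[OF \<gamma>])
  next
    case (swap x y) then show ?case using tensor_le.swap[OF fs fs] by simp
  qed (use fs in \<open>auto intro: tensor_le.intros simp: cl G.gmor_add[OF \<gamma>] G.gmor_zero[OF \<gamma>]\<close>)
qed

text \<open>A left inverse of \<open>\<eta>\<close> that only is a generalized Cu-morphism does not induce a map of tensor
  products in the category Cu; it does, however, map inequalities of formal sums to inequalities.\<close>

lemma tens_le_reflect:
  assumes cu: "cu_semigroup S'" "cu_semigroup S" "cu_semigroup T"
    and \<eta>: "\<eta> \<in> cu_mor S S'" and \<gamma>: "\<gamma> \<in> gcu_mor S' S" and inv: "\<And>a. a \<in> carrier S \<Longrightarrow> \<gamma> (\<eta> a) = a"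
    and c: "c \<in> carrier S" and le: "tens S' T (\<eta> a) b \<subseteq> tens S' T (\<eta> c) d"
  shows "tens S T a b \<subseteq> tens S T c d"
proof
  interpret A: cu_pair S T using cu by (simp add: cu_pair_def)
  interpret B: cu_pair S' T using cu by (simp add: cu_pair_def)
  fix f assume "f \<in> tens S T a b"
  then obtain p q where pq: "tensor_below S T f [(p, q)]" "p \<lless>\<^bsub>S\<^esub> a" "q \<lless>\<^bsub>T\<^esub> b"
    using A.below_single unfolding tens_def by blast
  \<comment> \<open>The tensor of p and q between f and the tensor of a and b has an image under
    \<eta> that belongs to the left ideal, and \<gamma> takes this image back to p.\<close>
  have "\<eta> p \<lless>\<^bsub>S'\<^esub> \<eta> a" using \<eta> pq(2) unfolding cu_mor_def by blast
  then have "[(\<eta> p, q)] \<in> tens S' T (\<eta> a) b"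
    unfolding tens_def using pq(3) by (auto intro!: B.tw_below simp: B.tw_simps)
  then have "tensor_le S' T [(\<eta> p, q)] [(\<eta> c, d)]" using le B.below_le unfolding tens_def by blast
  from tensor_le_map[OF cu \<gamma> this] have "tensor_le S T [(p, q)] [(c, d)]"
    using inv A.S.way_below_closed(1)[OF pq(2)] c by simp
  then show "f \<in> tens S T c d" unfolding tens_def using A.below_le_trans[OF pq(1)] by blast
qed

section \<open>The implications for a general Cu-semiring\<close>

context cu_semiring
begin

abbreviation HR where "HR \<equiv> ihom R R"

lemma mult_loc: "cu_bimor_loc R R R (mult R)" and RR_pair: "cu_pair R R"
  using cu_semigroup_axioms mult_bimor cu_bimor_locI by (auto simp: cu_pair_def)

lemma R_cu: "cu_semigroup R" by (rule cu_semigroup_axioms)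

lemma HR_cu: "cu_semigroup HR"
  by (rule cu_pair.ihom_cu_semigroup[OF RR_pair])

lemma HRR_cu: "cu_semigroup (tensor HR R)"
  by (rule tensor_cu_semigroup[OF HR_cu R_cu])

lemma pi_map_eq: "pi_map R = cu_bimor_loc.curried R R R (mult R)"
  unfolding pi_map_def mu_map_def by (rule cu_bimor_loc.the_inv_hom_adj[OF mult_loc])

lemma pi_cu_mor: "pi_map R \<in> cu_mor R HR"
  unfolding pi_map_eq by (rule cu_bimor_loc.curried_cu_mor[OF mult_loc])

lemma endpoint_pi: "\<lbrakk>a \<in> carrier R; b \<in> carrier R\<rbrakk> \<Longrightarrow> endpoint R R (pi_map R a) b = a \<odot> b"
  unfolding pi_map_eq by (rule cu_bimor_loc.endpoint_curried[OF mult_loc])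

lemma pi_closed: "a \<in> carrier R \<Longrightarrow> pi_map R a \<in> carrier HR"
  using pi_cu_mor unfolding cu_mor_def gcu_mor_def by auto

lemma endpoint_bimor_R: "cu_bimor HR R R (endpoint R R)"
  by (rule cu_pair.endpoint_bimor[OF RR_pair])

lemma endpoint_loc: "cu_bimor_loc HR R R (endpoint R R)"
  by (rule cu_bimor_locI[OF HR_cu R_cu R_cu endpoint_bimor_R])

lemma eval_map_eq: "eval_map R R = tensor_lift HR R R (endpoint R R)"
  unfolding eval_map_def hom_adj_def by (rule tensor_lift_cong) simp

lemma eps_map_eq: "eps_map R = (\<lambda>X\<in>carrier HR. endpoint R R X \<one>)"
  unfolding eps_map_def endpoint_def using one_closed by simp

lemma eps_gcu_mor: "eps_map R \<in> gcu_mor HR R"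
  unfolding eps_map_eq by (rule cu_bimor_loc.slice_left_gmor[OF endpoint_loc one_closed])

lemma eps_pi: "a \<in> carrier R \<Longrightarrow> eps_map R (pi_map R a) = a"
  unfolding eps_map_eq using endpoint_pi pi_closed one_closed mult_one_right by simp

lemma mult_closed: "\<lbrakk>a \<in> carrier R; b \<in> carrier R\<rbrakk> \<Longrightarrow> a \<odot> b \<in> carrier R"
  by (rule cu_bimor_loc.phi_closed[OF mult_loc])

lemma pi_tens_bimor: "cu_bimor R R (tensor HR R) (\<lambda>a b. tens HR R (pi_map R a) b)"
proof -
  have "cu_bimor R R (tensor HR R) (\<lambda>a b. tens HR R (pi_map R a) ((\<lambda>x\<in>carrier R. x) b))"
    by (rule cu_bimor_comp[OF R_cu R_cu HR_cu R_cu tens_cu_bimor[OF HR_cu R_cu] pi_cu_mor id_cu_mor[OF R_cu]])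
  then show ?thesis by (rule cu_bimor_cong[OF R_cu R_cu, THEN iffD1, rotated]) simp
qed

abbreviation pi_tens where "pi_tens \<equiv> tensor_map R R HR R (pi_map R) (\<lambda>r\<in>carrier R. r)"

lemma pi_tens_eq: "pi_tens = tensor_lift R R (tensor HR R) (\<lambda>a b. tens HR R (pi_map R a) b)"
  unfolding tensor_map_def by (rule tensor_lift_cong) simp

lemma pi_tens_cu_mor: "pi_tens \<in> cu_mor (tensor R R) (tensor HR R)"
  unfolding pi_tens_eq by (rule tensor_lift(1)[OF R_cu R_cu HRR_cu pi_tens_bimor])

lemma pi_tens_tens: "\<lbrakk>a \<in> carrier R; b \<in> carrier R\<rbrakk> \<Longrightarrow> pi_tens (tens R R a b) = tens HR R (pi_map R a) b"
  unfolding pi_tens_eq by (rule tensor_lift(2)[OF R_cu R_cu HRR_cu pi_tens_bimor])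

lemma eval_cu_mor: "eval_map R R \<in> cu_mor (tensor HR R) R"
  unfolding eval_map_eq by (rule tensor_lift(1)[OF HR_cu R_cu R_cu endpoint_bimor_R])

lemma eval_tens: "\<lbrakk>X \<in> carrier HR; b \<in> carrier R\<rbrakk> \<Longrightarrow> eval_map R R (tens HR R X b) = endpoint R R X b"
  unfolding eval_map_eq by (rule tensor_lift(2)[OF HR_cu R_cu R_cu endpoint_bimor_R])

lemma mu_cu_mor: "mu_map R \<in> cu_mor (tensor R R) R"
  unfolding mu_map_def by (rule tensor_lift(1)[OF R_cu R_cu R_cu mult_bimor])

lemma mu_tens: "\<lbrakk>a \<in> carrier R; b \<in> carrier R\<rbrakk> \<Longrightarrow> mu_map R (tens R R a b) = a \<odot> b"
  unfolding mu_map_def by (rule tensor_lift(2)[OF R_cu R_cu R_cu mult_bimor])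

lemma cu_morD:
  assumes "f \<in> cu_mor S T"
  shows "f \<in> gcu_mor S T" "x \<in> carrier S \<Longrightarrow> f x \<in> carrier T"
    "\<lbrakk>x \<in> carrier S; y \<in> carrier S\<rbrakk> \<Longrightarrow> f (x \<oplus>\<^bsub>S\<^esub> y) = f x \<oplus>\<^bsub>T\<^esub> f y"
  using assms unfolding cu_mor_def gcu_mor_def by auto

lemma eval_pi_tens:
  assumes "x \<in> carrier (tensor R R)" shows "mu_map R x = eval_map R R (pi_tens x)"
proof -
  note RR = tensor_cu_semigroup[OF R_cu R_cu]
  note c = gcu_mor_comp[OF RR HRR_cu R_cu cu_morD(1)[OF pi_tens_cu_mor] cu_morD(1)[OF eval_cu_mor]]
  note t = tens_closed[OF R_cu R_cu]
  have "mu_map R x = (\<lambda>x\<in>carrier (tensor R R). eval_map R R (pi_tens x)) x"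
    by (rule tensor_gmor_eq[OF R_cu R_cu R_cu cu_morD(1)[OF mu_cu_mor] c _ assms])
      (simp add: mu_tens t pi_tens_tens eval_tens pi_closed endpoint_pi)
  then show ?thesis using assms by simp
qed

section \<open>Implications between the five conditions\<close>

lemma pi_tens_iso_if: "\<lbrakk>eval_iso R; solid R\<rbrakk> \<Longrightarrow> pi_tensor_id_iso R"
  unfolding eval_iso_def solid_def pi_tensor_id_iso_def
  by (rule cu_iso_cancel_left[of _ R "mu_map R" _ "eval_map R R"])
    (use cu_morD[OF pi_tens_cu_mor] eval_pi_tens in auto)

lemma eval_iso_if: "\<lbrakk>solid R; pi_tensor_id_iso R\<rbrakk> \<Longrightarrow> eval_iso R"
  unfolding eval_iso_def solid_def pi_tensor_id_iso_def
  by (rule cu_iso_cancel_right[of "tensor R R" R "mu_map R" _ pi_tens])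
    (use cu_morD[OF eval_cu_mor] eval_pi_tens in auto)

lemma pi_iso_iff_eps_iso: "pi_iso R \<longleftrightarrow> eps_iso R"
proof
  assume "pi_iso R"
  then show "eps_iso R" unfolding pi_iso_def eps_iso_def
    by (rule cu_iso_cancel_right[OF cu_iso_id])
      (use eps_gcu_mor eps_pi in \<open>auto simp: gcu_mor_def\<close>)
next
  assume "eps_iso R"
  then show "pi_iso R" unfolding pi_iso_def eps_iso_def
    by (rule cu_iso_cancel_left[OF cu_iso_id])
      (use cu_morD[OF pi_cu_mor] eps_pi in auto)
qed

text \<open>Functoriality: the inverse is \<epsilon> \<otimes> id. It exists here because \<epsilon>
  is an isomorphism and hence preserves \<open>\<lless>\<close>.\<close>

lemma pi_tens_iso_if_pi_iso:
  assumes "pi_iso R" shows "pi_tensor_id_iso R"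
proof -
  have eps: "eps_map R \<in> cu_mor HR R"
  proof (rule cu_iso_cu_mor[OF HR_cu R_cu])
    show "cu_iso HR R (eps_map R)" by (rule assms[unfolded pi_iso_iff_eps_iso eps_iso_def])
    show "eps_map R \<in> extensional (carrier HR)" unfolding eps_map_eq by (rule restrict_extensional)
  qed
  have pi_eps: "pi_map R (eps_map R X) = X" if X: "X \<in> carrier HR" for X
  proof -
    have "pi_map R ` carrier R = carrier HR"
      by (rule bij_betw_imp_surj_on[OF conjunct1[OF assms[unfolded pi_iso_def cu_iso_def]]])
    then obtain a where a: "a \<in> carrier R" "X = pi_map R a" using X by auto
    then show ?thesis using eps_pi by simp
  qed
  note RR = tensor_cu_semigroup[OF R_cu R_cu]
  define \<beta> where "\<beta> = (\<lambda>X b. tens R R (eps_map R X) ((\<lambda>x\<in>carrier R. x) b))"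
  have \<beta>: "cu_bimor HR R (tensor R R) \<beta>" unfolding \<beta>_def
    by (rule cu_bimor_comp[OF HR_cu R_cu R_cu R_cu tens_cu_bimor[OF R_cu R_cu] eps id_cu_mor[OF R_cu]])
  define \<psi> where "\<psi> = tensor_lift HR R (tensor R R) \<beta>"
  have \<psi>: "\<psi> \<in> cu_mor (tensor HR R) (tensor R R)"
    "\<And>X b. \<lbrakk>X \<in> carrier HR; b \<in> carrier R\<rbrakk> \<Longrightarrow> \<psi> (tens HR R X b) = tens R R (eps_map R X) b"
    unfolding \<psi>_def using tensor_lift[OF HR_cu R_cu RR \<beta>] by (auto simp: \<beta>_def)
  note t = tens_closed[OF HR_cu R_cu]
  have id: "(\<lambda>x\<in>carrier (tensor HR R). x) \<in> gcu_mor (tensor HR R) (tensor HR R)"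
    using id_cu_mor[OF HRR_cu] unfolding cu_mor_def by blast
  have sec: "pi_tens (\<psi> z) = z" if "z \<in> carrier (tensor HR R)" for z
    using tensor_gmor_eq[OF HR_cu R_cu HRR_cu gcu_mor_comp[OF HRR_cu RR HRR_cu cu_morD(1)[OF \<psi>(1)]
          cu_morD(1)[OF pi_tens_cu_mor]] id _ that]
      \<psi>(2) t pi_tens_tens pi_eps cu_morD(2)[OF eps] that by simp
  show ?thesis unfolding pi_tensor_id_iso_def pi_tens_eq
    by (rule tensor_lift_iso[OF R_cu R_cu HRR_cu pi_tens_bimor cu_morD(1)[OF \<psi>(1)]])
      (use \<psi>(2) pi_closed eps_pi sec in \<open>simp_all add: pi_tens_eq\<close>)
qed

text \<open>The map a -> \<pi>(a) \<otimes> 1 is a section of e, as \<pi>(a) has value a at the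
  unit. The assumption says that it also undoes e on elementary tensors.\<close>

lemma eval_isoI:
  assumes "\<And>X a. \<lbrakk>X \<in> carrier HR; a \<in> carrier R\<rbrakk> \<Longrightarrow>
    tens HR R X a = tens HR R (pi_map R (endpoint R R X a)) \<one>"
  shows "eval_iso R"
proof -
  interpret P: cu_bimor_loc R R "tensor HR R" "\<lambda>a b. tens HR R (pi_map R a) b"
    by (rule cu_bimor_locI[OF R_cu R_cu HRR_cu pi_tens_bimor])
  show ?thesis unfolding eval_iso_def eval_map_eq
  proof (rule tensor_lift_iso[OF HR_cu R_cu R_cu endpoint_bimor_R P.slice_left_gmor[OF one_closed]])
    fix X a assume Xa: "X \<in> carrier HR" "a \<in> carrier R"
    then have "endpoint R R X a \<in> carrier R" using cu_bimor_loc.phi_closed[OF endpoint_loc] by blast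
    then show "(\<lambda>a\<in>carrier R. tens HR R (pi_map R a) \<one>) (endpoint R R X a) = tens HR R X a"
      using assms[OF Xa] by simp
  next
    fix p assume "p \<in> carrier R"
    then show "tensor_lift HR R R (endpoint R R) ((\<lambda>a\<in>carrier R. tens HR R (pi_map R a) \<one>) p) = p"
      using eval_tens pi_closed one_closed endpoint_pi mult_one_right by (simp add: eval_map_eq)
  qed
qed

lemma solidI:
  assumes "\<And>a b. \<lbrakk>a \<in> carrier R; b \<in> carrier R\<rbrakk> \<Longrightarrow> tens R R a b = tens R R (a \<odot> b) \<one>"
  shows "solid R"
proof -
  note RR = tensor_cu_semigroup[OF R_cu R_cu]
  interpret P: cu_bimor_loc R R "tensor R R" "tens R R"
    by (rule cu_bimor_locI[OF R_cu R_cu RR tens_cu_bimor[OF R_cu R_cu]])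
  show ?thesis unfolding solid_def mu_map_def
  proof (rule tensor_lift_iso[OF R_cu R_cu R_cu mult_bimor P.slice_left_gmor[OF one_closed]])
    fix a b assume "a \<in> carrier R" "b \<in> carrier R"
    then show "(\<lambda>a\<in>carrier R. tens R R a \<one>) (a \<odot> b) = tens R R a b"
      using assms mult_closed by simp
  next
    fix p assume "p \<in> carrier R"
    then show "tensor_lift R R R (mult R) ((\<lambda>a\<in>carrier R. tens R R a \<one>) p) = p"
      using mu_tens one_closed mult_one_right by (simp add: mu_map_def)
  qed
qed

lemma solid_if_eval_iso:
  assumes "eval_iso R" shows "solid R"
proof (rule solidI)
  fix a b assume ab: "a \<in> carrier R" "b \<in> carrier R"
  note t = tens_closed[OF HR_cu R_cu]
  have "eval_map R R (tens HR R (pi_map R a) b) = eval_map R R (tens HR R (pi_map R (a \<odot> b)) \<one>)"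
    using ab by (simp add: eval_tens pi_closed endpoint_pi mult_closed one_closed mult_one_right)
  then have eq: "tens HR R (pi_map R a) b = tens HR R (pi_map R (a \<odot> b)) \<one>"
    using assms inj_onD[OF _ _ t[OF pi_closed[OF ab(1)] ab(2)] t[OF pi_closed[OF mult_closed[OF ab]] one_closed]]
    unfolding eval_iso_def cu_iso_def bij_betw_def by blast
  show "tens R R a b = tens R R (a \<odot> b) \<one>"
    by (intro equalityI tens_le_reflect[OF HR_cu R_cu R_cu pi_cu_mor eps_gcu_mor eps_pi])
      (use ab mult_closed[OF ab] eq in auto)
qed

end

section \<open>Extended nonnegative reals\<close>

text \<open>Density allows every step to be strict while still overtaking the n-th term of a
  countable sequence with supremum b. Infinite b is included.\<close>

lemma ennreal_strict_approx:
  assumes "(0::ennreal) < b"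
  shows "\<exists>d. strict_mono d \<and> (\<forall>n. d n < b) \<and> (SUP n::nat. d n) = b"
proof -
  have "Sup {..<b} = b" using assms by (intro Sup_lessThan) 
  then obtain c where c: "range c \<subseteq> {..<b}" "(SUP i::nat. c i) = b"
    using ennreal_Sup_countable_SUP[of "{..<b}"] assms by auto
  have "\<exists>y<b. x < y \<and> c n \<le> y" if "x < b" for x n
  proof -
    have "max x (c n) < b" using that c(1) by auto
    then obtain y where "max x (c n) < y" "y < b" using dense by blast
    then show ?thesis by (intro exI[of _ y]) auto
  qed
  then obtain d where d: "\<And>n. d n < b" "\<And>n. d n < d (Suc n)" "\<And>n. c n \<le> d (Suc n)"
    using dependent_nat_choice[where P = "\<lambda>_ x. x < b" and Q = "\<lambda>n x y. x < y \<and> c n \<le> y"] assms by blast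
  have "(SUP n. d n) = b"
  proof (rule antisym)
    show "(SUP n. d n) \<le> b" using d(1) by (intro SUP_least) (simp add: less_imp_le)
    show "b \<le> (SUP n. d n)" unfolding c(2)[symmetric] using d(3) by (intro SUP_mono) blast
  qed
  then show ?thesis using d strict_mono_Suc_iff by blast
qed

lemma ennreal_add_less_mono:
  assumes "(a'::ennreal) < a" "b' \<le> b" "b' < top" shows "a' + b' < a + b"
proof -
  have "b' + a' < b' + a" using assms ennreal_add_left_cancel_less by auto
  also have "\<dots> \<le> b + a" using assms by (intro add_right_mono)
  finally show ?thesis by (simp add: add.commute)
qed

text \<open>For b' = 0 the factor b' cannot carry the strict step. A positive finite c between b'
  and b carries it instead: a' b' \<le> a' c < a c \<le> a b.\<close>

lemma ennreal_mult_less_mono: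
  assumes "(a'::ennreal) < a" "b' \<le> b" "0 < b" "b' < top" shows "a' * b' < a * b"
proof -
  obtain c where c: "b' \<le> c" "c \<le> b" "0 < c" "c < top"
  proof (cases "b' = 0")
    case True
    then show ?thesis using dense[OF assms(3)] that by (metis less_imp_le less_top_ennreal le_less_trans not_gr_zero top.not_eq_extremum zero_le)
  next
    case False then show ?thesis using that[of b'] assms by (simp add: zero_less_iff_neq_zero)
  qed
  have "a' * b' \<le> a' * c" using c by (intro mult_left_mono) auto
  also have "\<dots> < a * c" using ennreal_mult_strict_right_mono[of a' a c] assms c by (simp add: mult.commute)
  also have "\<dots> \<le> a * b" using c by (intro mult_left_mono) auto
  finally show ?thesis .
qed

lemma ennreal_SUP_mult_diag:
  fixes c d :: "nat \<Rightarrow> ennreal"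
  assumes "incseq c" "incseq d" shows "(SUP n. c n * d n) = (SUP n. c n) * (SUP n. d n)"
proof (rule antisym)
  show "(SUP n. c n * d n) \<le> (SUP n. c n) * (SUP n. d n)"
    by (intro SUP_least mult_mono SUP_upper) auto
  have "c i * d j \<le> (SUP n. c n * d n)" for i j
  proof -
    have "c i * d j \<le> c (max i j) * d (max i j)"
      using assms by (intro mult_mono) (auto simp: incseq_def)
    also have "\<dots> \<le> (SUP n. c n * d n)" by (rule SUP_upper) simp
    finally show ?thesis .
  qed
  then show "(SUP n. c n) * (SUP n. d n) \<le> (SUP n. c n * d n)"
    by (auto simp: SUP_mult_left_ennreal SUP_mult_right_ennreal intro!: SUP_least)
qed

text \<open>The integer part of n a places n h(a) between two consecutive multiples of h(1), so for
  finite h(1) the error of h(a) is at most h(1) / n. The hypotheses speak of finite arguments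
  because \<open>M1\<close> has no compact element of infinite value.\<close>

lemma ennreal_additive_linear:
  fixes h :: "ennreal \<Rightarrow> ennreal"
  assumes add: "\<And>a b. \<lbrakk>a < top; b < top\<rbrakk> \<Longrightarrow> h (a + b) = h a + h b" and zero: "h 0 = 0"
    and mono: "\<And>a b. \<lbrakk>a \<le> b; b < top\<rbrakk> \<Longrightarrow> h a \<le> h b" and a: "a < top"
  shows "h a = h 1 * a"
proof -
  have nat: "h (of_nat n * b) = of_nat n * h b" if "b < top" for n b
  proof (induction n)
    case (Suc n)
    have "of_nat n * b < top" using that by (simp add: ennreal_mult_less_top of_nat_less_top)
    then show ?case using Suc add[OF that, of "of_nat n * b"] by (simp add: distrib_right)
  qed (simp add: zero)
  obtain r where r: "0 \<le> r" "a = ennreal r" using a by (cases a) auto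
  define m where "m n = nat \<lfloor>real n * r\<rfloor>" for n
  have m: "real (m n) \<le> real n * r" "real n * r < real (Suc (m n))" for n
    using r(1) unfolding m_def by (simp_all add: of_nat_nat) linarith
  have na: "of_nat n * a = ennreal (real n * r)" for n
    using r by (simp add: ennreal_mult ennreal_of_nat_eq_real_of_nat)
  have "of_nat (m n) \<le> of_nat n * a" "of_nat n * a \<le> of_nat (Suc (m n))" for n
    unfolding na unfolding ennreal_of_nat_eq_real_of_nat by (rule ennreal_leI, use m[of n] in linarith)+
  then have b: "of_nat (m n) * h 1 \<le> of_nat n * h a" "of_nat n * h a \<le> of_nat (Suc (m n)) * h 1" for n
    using mono[of "of_nat (m n)" "of_nat n * a"] mono[of "of_nat n * a" "of_nat (Suc (m n))"] a
      nat[OF a, of n] nat[of 1 "m n"] nat[of 1 "Suc (m n)"]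
    by (simp_all add: ennreal_mult_less_top of_nat_less_top del: of_nat_Suc)
  show ?thesis
  proof (cases "h 1 = top")
    case True
    show ?thesis
    proof (cases "r = 0")
      case False
      \<comment> \<open>With n r > 1 the lower multiple \<open>m n\<close> is positive, so the
        infinite value at 1 passes to a.\<close>
      obtain n where n: "1 / r < real n" using reals_Archimedean2 by blast
      then have "1 < real (Suc (m n))" using m(2)[of n] r(1) False by (simp add: field_simps)
      then have "0 < m n" by simp
      then have "of_nat n * h a = top" using b(1)[of n] True by (simp add: ennreal_mult_top top_unique)
      then have "h a = top" by (auto simp: ennreal_mult_eq_top_iff)
      then show ?thesis using True r False by (simp add: ennreal_top_mult)
    qed (simp add: r zero)
  next
    case False
    then obtain c where c: "0 \<le> c" "h 1 = ennreal c" by (cases "h 1") auto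
    have "h a < top" using b(2)[of 1] c by (auto simp: less_top[symmetric] ennreal_mult_eq_top_iff top_unique)
    then obtain y where y: "0 \<le> y" "h a = ennreal y" by (cases "h a") auto
    have bb: "real (m n) * c \<le> real n * y" "real n * y \<le> real (Suc (m n)) * c" for n
      using b[of n] c y by (simp_all add: ennreal_of_nat_eq_real_of_nat ennreal_mult[symmetric] del: of_nat_Suc)
    have "real n * \<bar>y - c * r\<bar> \<le> c" for n
    proof -
      have "real (m n) * c \<le> real n * r * c" "real n * r * c \<le> real (Suc (m n)) * c"
        using m[of n] c(1) by (simp_all add: mult_right_mono)
      then have "\<bar>real n * y - real n * r * c\<bar> \<le> c" using bb[of n] by (simp add: algebra_simps abs_le_iff)
      moreover have "real n * \<bar>y - c * r\<bar> = \<bar>real n * (y - c * r)\<bar>" by (simp add: abs_mult)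
      ultimately show ?thesis by (simp add: algebra_simps)
    qed
    then have "\<bar>y - c * r\<bar> = 0"
      using reals_Archimedean3[of "\<bar>y - c * r\<bar>"] by (metis abs_ge_zero not_less order_le_less)
    then show ?thesis using r y c by (simp add: ennreal_mult)
  qed
qed


section \<open>The semiring of extended nonnegative reals\<close>

lemma Pbar_simps [simp]:
  "carrier Pbar = UNIV" "add Pbar = (+)" "zero Pbar = 0" "le Pbar = (\<le>)" "mult Pbar = (*)" "one Pbar = 1"
  unfolding Pbar_def by auto

lemma Pbar_incr_seq [simp]: "incr_seq Pbar c \<longleftrightarrow> incseq c"
  unfolding incr_seq_def by (simp add: incseq_Suc_iff)

lemma Pbar_is_sup [simp]: "is_sup Pbar A s \<longleftrightarrow> s = Sup A"
  unfolding is_sup_def by (auto intro: antisym Sup_upper Sup_least)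

lemma Pbar_csup [simp]: "csup Pbar A = Sup A"
  unfolding csup_def by (rule the_equality) auto

lemma Pbar_way_below: "a \<lless>\<^bsub>Pbar\<^esub> b \<longleftrightarrow> a < b \<or> a = 0"
proof
  assume wb: "a \<lless>\<^bsub>Pbar\<^esub> b"
  show "a < b \<or> a = 0"
  proof (cases "b = 0")
    case True
    then have "incr_seq Pbar (\<lambda>n. 0) \<and> is_sup Pbar (range (\<lambda>n::nat. 0)) 0 \<and> b \<sqsubseteq>\<^bsub>Pbar\<^esub> 0" by simp
    then show ?thesis using wb unfolding way_below_def by fastforce
  next
    case False
    then obtain d where d: "strict_mono d" "\<And>n. d n < b" "(SUP n::nat. d n) = b"
      using ennreal_strict_approx[of b] by (auto simp: zero_less_iff_neq_zero)
    then have "incr_seq Pbar d \<and> is_sup Pbar (range d) b \<and> b \<sqsubseteq>\<^bsub>Pbar\<^esub> b"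
      by (simp add: strict_mono_mono)
    then obtain n where "a \<le> d n" using wb unfolding way_below_def by fastforce
    then show ?thesis using d(2) le_less_trans by blast
  qed
next
  assume a: "a < b \<or> a = 0"
  show "a \<lless>\<^bsub>Pbar\<^esub> b" unfolding way_below_def
  proof (intro conjI allI impI; (elim conjE)?)
    fix c :: "nat \<Rightarrow> ennreal" and s
    assume c: "incr_seq Pbar c" "is_sup Pbar (range c) s" "b \<sqsubseteq>\<^bsub>Pbar\<^esub> s"
    show "\<exists>k. a \<sqsubseteq>\<^bsub>Pbar\<^esub> c k"
    proof (cases "a = 0")
      case False
      then have "a < (SUP n. c n)" using a c by auto
      then show ?thesis by (auto simp: less_SUP_iff intro: less_imp_le)
    qed simp
  qed auto
qed

lemma Pbar_cu_semigroup: "cu_semigroup Pbar"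
proof
  show "\<exists>c. (\<forall>n. c n \<lless>\<^bsub>Pbar\<^esub> c (Suc n)) \<and> is_sup Pbar (range c) a" for a
  proof (cases "a = 0")
    case True then show ?thesis by (intro exI[of _ "\<lambda>_. 0"]) (simp add: Pbar_way_below)
  next
    case False
    then obtain d where "strict_mono d" "(SUP n::nat. d n) = a"
      using ennreal_strict_approx[of a] by (auto simp: zero_less_iff_neq_zero)
    then show ?thesis by (intro exI[of _ d]) (simp add: Pbar_way_below strict_mono_Suc_iff)
  qed
  show "a' \<oplus>\<^bsub>Pbar\<^esub> b' \<lless>\<^bsub>Pbar\<^esub> a \<oplus>\<^bsub>Pbar\<^esub> b" if "a' \<lless>\<^bsub>Pbar\<^esub> a" "b' \<lless>\<^bsub>Pbar\<^esub> b" for a' a b' b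
  proof -
    have fin: "b' < top" "b' \<le> b" "a' < top" "a' \<le> a"
      using that by (auto simp: Pbar_way_below less_top[symmetric])
    show ?thesis using that ennreal_add_less_mono[OF _ fin(2,1), of a' a] ennreal_add_less_mono[OF _ fin(4,3), of b' b]
      by (auto simp: Pbar_way_below add.commute)
  qed
qed (auto simp: ennreal_SUP_add add.assoc add.commute add_right_mono)

lemma Pbar_cu_semiring: "cu_semiring Pbar"
proof -
  interpret cu_semigroup Pbar by (rule Pbar_cu_semigroup)
  show ?thesis
  proof
    show "cu_bimor Pbar Pbar Pbar ((\<odot>\<^bsub>Pbar\<^esub>))"
      unfolding cu_bimor_def
    proof (intro conjI ballI allI impI; (elim conjE)?)
      show "a' \<odot>\<^bsub>Pbar\<^esub> b' \<lless>\<^bsub>Pbar\<^esub> a \<odot>\<^bsub>Pbar\<^esub> b" if "a' \<lless>\<^bsub>Pbar\<^esub> a" "b' \<lless>\<^bsub>Pbar\<^esub> b" for a' a b' b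
      proof (cases "b = 0 \<or> b' = 0 \<or> a' = 0")
        case False
        then have "a' < a" "b' < b" using that by (auto simp: Pbar_way_below)
        moreover from this have "b' < top" "b' \<le> b" using less_le_trans[of b' b top] by auto
        ultimately show ?thesis using ennreal_mult_less_mono False by (simp add: Pbar_way_below zero_less_iff_neq_zero)
      qed (use that in \<open>auto simp: Pbar_way_below\<close>)
    qed (auto simp: ennreal_SUP_mult_diag distrib_left distrib_right mult_left_mono mult_right_mono)
  qed (auto simp: mult.assoc)
qed

interpretation Pbar: cu_semiring Pbar by (rule Pbar_cu_semiring)

interpretation PP: cu_pair Pbar Pbar by unfold_locales

lemma Pbar_gmor_linear:
  assumes f: "f \<in> gcu_mor Pbar Pbar" shows "f x = f 1 * x"
proof -
  have fin: "f a = f 1 * a" if "a < top" for a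
    by (rule ennreal_additive_linear) (use PP.gmor_add[OF f] PP.gmor_zero[OF f] PP.gmor_mono[OF f] that in auto)
  show ?thesis
  proof (cases "x = top")
    case True
    have i: "incseq (of_nat :: nat \<Rightarrow> ennreal)" by (simp add: incseq_def)
    have "f (SUP n::nat. of_nat n) = (SUP n::nat. f (of_nat n))"
      using PP.gmor_csup[OF f, of of_nat] i by simp
    also have "\<dots> = (SUP n::nat. f 1 * of_nat n)" by (rule SUP_cong[OF _ fin[OF of_nat_less_top]]) simp
    also have "\<dots> = f 1 * (SUP n::nat. of_nat n)" by (rule SUP_mult_left_ennreal[symmetric])
    finally show ?thesis using True by (simp add: ennreal_SUP_of_nat_eq_top)
  qed (use fin less_top in blast)
qed

lemma Pbar_mult_gmor: "(\<lambda>x. c * x) \<in> gcu_mor Pbar Pbar"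
  by (rule PP.gmorI) (auto simp: distrib_left mult_left_mono SUP_mult_left_ennreal extensional_def)

text \<open>Multiplication by a finite number is \<open>\<prec>\<close> itself. Paths may therefore
  be stationary, and this is where compact elements of the internal hom come from although
  \<open>Pbar\<close> has none besides 0. The test pair 1 \<lless> 2 detects an infinite
  factor.\<close>

lemma Pbar_mult_prec:
  "gcu_below Pbar Pbar (\<lambda>x. c * x) (\<lambda>x. d * x) \<longleftrightarrow> c \<le> d \<and> c < top"
proof
  assume *: "gcu_below Pbar Pbar (\<lambda>x. c * x) (\<lambda>x. d * x)"
  have "1 \<lless>\<^bsub>Pbar\<^esub> 2" by (simp add: Pbar_way_below)
  then have "c * 1 \<lless>\<^bsub>Pbar\<^esub> d * 2" using * unfolding gcu_below_def by blast
  then have "c < top" by (auto simp: Pbar_way_below less_top[symmetric])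
  moreover have "\<forall>x. c * x \<le> d * x"
    using PP.prec_le[OF Pbar_mult_gmor Pbar_mult_gmor *] unfolding PP.gmor_le_def by simp
  then have "c * 1 \<le> d * 1" by blast
  ultimately show "c \<le> d \<and> c < top" by simp
next
  assume c: "c \<le> d \<and> c < top"
  show "gcu_below Pbar Pbar (\<lambda>x. c * x) (\<lambda>x. d * x)" unfolding gcu_below_def
  proof (intro allI impI)
    fix a' a assume "a' \<lless>\<^bsub>Pbar\<^esub> a"
    then show "c * a' \<lless>\<^bsub>Pbar\<^esub> d * a"
      using ennreal_mult_less_mono[of a' a c d] c
      by (cases "d = 0") (auto simp: Pbar_way_below mult.commute zero_less_iff_neq_zero)
  qed
qed

section \<open>Paths over the extended nonnegative reals in coordinates\<close>

definition incr_vals :: "(rat \<Rightarrow> ennreal) \<Rightarrow> bool" where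
  "incr_vals c \<longleftrightarrow> (\<forall>l\<in>I_Q. c l < top) \<and> (\<forall>k\<in>I_Q. \<forall>l\<in>I_Q. k < l \<longrightarrow> c k \<le> c l)"

definition mpath :: "(rat \<Rightarrow> ennreal) \<Rightarrow> rat \<Rightarrow> ennreal \<Rightarrow> ennreal" where
  "mpath c = (\<lambda>l\<in>I_Q. \<lambda>x. c l * x)"

abbreviation mcls :: "(rat \<Rightarrow> ennreal) \<Rightarrow> (rat \<Rightarrow> ennreal \<Rightarrow> ennreal) set" where
  "mcls c \<equiv> path_class Pbar Pbar (mpath c)"

lemma mpath_closed: "incr_vals c \<Longrightarrow> mpath c \<in> paths Pbar Pbar"
  by (rule PP.pathsI) (auto simp: mpath_def incr_vals_def Pbar_mult_gmor Pbar_mult_prec)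

lemma mpathE:
  assumes "f \<in> paths Pbar Pbar" obtains c where "incr_vals c" "f = mpath c"
proof -
  have eq: "f l = (\<lambda>x. f l 1 * x)" if "l \<in> I_Q" for l
    using Pbar_gmor_linear[OF PP.path_gmor[OF assms that]] by blast
  have p: "f k 1 \<le> f l 1 \<and> f k 1 < top" if "k \<in> I_Q" "l \<in> I_Q" "k < l" for k l
    using PP.path_prec[OF assms that] eq[OF that(1)] eq[OF that(2)] Pbar_mult_prec by metis
  then have "incr_vals (\<lambda>l. f l 1)" unfolding incr_vals_def using I_Q_above by blast
  moreover have "f = mpath (\<lambda>l. f l 1)"
  proof
    fix l show "f l = mpath (\<lambda>l. f l 1) l"
      using eq[of l] assms unfolding mpath_def paths_def by (cases "l \<in> I_Q") (auto simp: PiE_def extensional_def)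
  qed
  ultimately show ?thesis by (rule that)
qed

text \<open>This exhibits the copy of \<open>M1\<close>: a class is determined by the supremum of
  its values and by whether it is attained. Attained suprema give the compact elements, the others
  the soft ones.\<close>

lemma mpath_le:
  assumes "incr_vals c" "incr_vals d"
  shows "path_le Pbar Pbar (mpath c) (mpath d) \<longleftrightarrow> (\<forall>l\<in>I_Q. \<exists>m\<in>I_Q. c l \<le> d m)"
  using assms unfolding path_le_def mpath_def incr_vals_def by (auto simp: Pbar_mult_prec)

lemma endpoint_mcls:
  assumes "incr_vals c" shows "endpoint Pbar Pbar (mcls c) a = (SUP l\<in>I_Q. c l) * a"
proof -
  have "endpoint Pbar Pbar (mcls c) a = (SUP l\<in>I_Q. mpath c l a)"
    using PP.endpoint_is_sup[OF mpath_closed[OF assms], of a] by simp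
  also have "\<dots> = (SUP l\<in>I_Q. c l * a)" unfolding mpath_def by (intro SUP_cong) auto
  finally show ?thesis by (simp add: SUP_mult_right_ennreal)
qed

lemma mclsE:
  assumes "X \<in> carrier (ihom Pbar Pbar)" obtains c where "incr_vals c" "X = mcls c"
  using assms PP.H_carrier mpathE by metis

lemma endpoint_Pbar:
  assumes "X \<in> carrier (ihom Pbar Pbar)"
  shows "endpoint Pbar Pbar X a = endpoint Pbar Pbar X 1 * a"
  by (rule mclsE[OF assms]) (simp add: endpoint_mcls)

text \<open>A strict inequality between suprema overrules the difference between attained and
  unattained ones; at supremum 0 all values vanish.\<close>

lemma Pbar_ihom_le:
  assumes X: "X \<in> carrier (ihom Pbar Pbar)" and Y: "Y \<in> carrier (ihom Pbar Pbar)"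
    and less: "endpoint Pbar Pbar X 1 < endpoint Pbar Pbar Y 1 \<or> endpoint Pbar Pbar X 1 = 0"
  shows "X \<sqsubseteq>\<^bsub>ihom Pbar Pbar\<^esub> Y"
proof -
  obtain c where c: "incr_vals c" "X = mcls c" by (rule mclsE[OF X])
  obtain d where d: "incr_vals d" "Y = mcls d" by (rule mclsE[OF Y])
  have "\<exists>m\<in>I_Q. c l \<le> d m" if l: "l \<in> I_Q" for l
  proof (cases "(SUP l\<in>I_Q. c l) = 0")
    case True
    then have "c l = 0" using l by (simp add: SUP_eq_iff bot_ennreal[symmetric])
    then show ?thesis using l by auto
  next
    case False
    have "c l \<le> (SUP l\<in>I_Q. c l)" using l by (rule SUP_upper)
    also have "\<dots> < (SUP l\<in>I_Q. d l)" using less False c d by (simp add: endpoint_mcls)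
    finally show ?thesis unfolding less_SUP_iff by (auto intro: less_imp_le)
  qed
  then show ?thesis unfolding c(2) d(2) PP.H_le[OF mpath_closed[OF c(1)] mpath_closed[OF d(1)]] mpath_le[OF c(1) d(1)]
    by blast
qed

section \<open>Rational factors across the tensor sign\<close>

fun nsum :: "('a, 'm) cu_sg_scheme \<Rightarrow> nat \<Rightarrow> 'a \<Rightarrow> 'a" where
  "nsum S 0 x = \<zero>\<^bsub>S\<^esub>"
| "nsum S (Suc n) x = x \<oplus>\<^bsub>S\<^esub> nsum S n x"

lemma (in pos_ordered_semigroup) nsum_closed: "x \<in> carrier S \<Longrightarrow> nsum S n x \<in> carrier S"
  by (induction n) (auto simp: zero_closed add_closed)

lemma (in cu_bimor_loc) phi_nsum:
  assumes "a \<in> carrier S" "b \<in> carrier T"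
  shows "\<phi> (nsum S n a) b = \<phi> a (nsum T n b)"
proof -
  have "\<phi> (nsum S n a) b = nsum P n (\<phi> a b)"
    by (induction n) (simp_all add: assms phi_zerol phi_addl S.nsum_closed)
  also have "\<dots> = \<phi> a (nsum T n b)"
    by (induction n) (simp_all add: assms phi_zeror phi_addr T.nsum_closed)
  finally show ?thesis .
qed

lemma nsum_Pbar: "nsum Pbar n x = of_nat n * x"
  by (induction n) (simp_all add: distrib_right)

lemma incr_vals_scale: "\<lbrakk>incr_vals c; q < top\<rbrakk> \<Longrightarrow> incr_vals (\<lambda>l. q * c l)"
  unfolding incr_vals_def by (auto simp: ennreal_mult_less_top mult_left_mono)

lemma nsum_mcls:
  assumes "incr_vals c" shows "nsum (ihom Pbar Pbar) n (mcls c) = mcls (\<lambda>l. of_nat n * c l)"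
proof (induction n)
  case 0
  have "PP.path_zero = mpath (\<lambda>l. 0)" unfolding PP.path_zero_def mpath_def by (auto simp: fun_eq_iff)
  then show ?case by (simp add: PP.H_zero)
next
  case (Suc n)
  have "path_add Pbar Pbar (mpath c) (mpath (\<lambda>l. of_nat n * c l)) = mpath (\<lambda>l. of_nat (Suc n) * c l)"
    unfolding path_add_def mpath_def by (auto simp: fun_eq_iff distrib_right restrict_def)
  then show ?case
    using PP.H_add[OF mpath_closed[OF assms] mpath_closed[OF incr_vals_scale[OF assms, of "of_nat n"]]] Suc
    by (simp add: of_nat_less_top)
qed

interpretation HP: cu_bimor_loc "ihom Pbar Pbar" Pbar "tensor (ihom Pbar Pbar) Pbar" "tens (ihom Pbar Pbar) Pbar"
  by (rule cu_bimor_locI[OF Pbar.HR_cu Pbar_cu_semigroup Pbar.HRR_cu tens_cu_bimor[OF Pbar.HR_cu Pbar_cu_semigroup]])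

text \<open>Both sides are n-divisible. With d = c / n the class of c is n times that of d; the
  factor n crosses to the right and cancels the denominator, and the remaining m crosses back to the
  left.\<close>

lemma tens_rational_scale:
  assumes c: "incr_vals c" and n: "0 < n"
  shows "tens (ihom Pbar Pbar) Pbar (mcls c) (of_nat m / of_nat n * b) =
    tens (ihom Pbar Pbar) Pbar (mcls (\<lambda>l. of_nat m / of_nat n * c l)) b"
proof -
  have n': "of_nat n \<noteq> (0::ennreal)" "of_nat n < (top::ennreal)" using n by (auto simp: of_nat_less_top)
  have inv: "of_nat n * (x / of_nat n) = (x::ennreal)" for x
    using n' by (simp add: ennreal_times_divide mult_divide_eq_ennreal mult.commute)
  define d where "d = (\<lambda>l. 1 / of_nat n * c l)"
  have "1 / of_nat n < (top::ennreal)" using n by (simp add: ennreal_divide_eq_top_iff less_top[symmetric])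
  then have d: "incr_vals d" unfolding d_def by (rule incr_vals_scale[OF c])
  have dc: "mcls d \<in> carrier (ihom Pbar Pbar)" by (rule PP.pcls_closed[OF mpath_closed[OF d]])
  have c_eq: "mcls c = nsum (ihom Pbar Pbar) n (mcls d)"
    unfolding nsum_mcls[OF d] by (simp add: d_def mult.assoc[symmetric] inv)
  have "of_nat m * (1 / of_nat n) = (of_nat m / of_nat n :: ennreal)" by (simp add: ennreal_times_divide)
  then have q_eq: "mcls (\<lambda>l. of_nat m / of_nat n * c l) = nsum (ihom Pbar Pbar) m (mcls d)"
    unfolding nsum_mcls[OF d] by (simp add: d_def mult.assoc[symmetric])
  have "nsum Pbar n (of_nat m / of_nat n * b) = nsum Pbar m b"
    by (simp add: nsum_Pbar mult.assoc[symmetric] inv)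
  then show ?thesis unfolding c_eq q_eq by (simp add: HP.phi_nsum[OF dc])
qed

text \<open>The rational is found between a / b and w / x. For infinite w there is no upper
  constraint, so any rational above a / b will do.\<close>

lemma rational_between:
  fixes x a b w :: ennreal
  assumes "x * a < w * b" "0 < x" "x < top" "0 < a" "b < top"
  shows "\<exists>m n. 0 < n \<and> a \<le> of_nat m / of_nat n * b \<and> of_nat m / of_nat n * x < w"
proof -
  have "x * a < top" using assms(1) less_top by (metis order_less_le_trans top_greatest less_le_trans)
  then have "a < top" using assms(2) by (auto simp: ennreal_mult_less_top)
  then obtain r where r: "0 < r" "a = ennreal r" using assms(4) by (cases a) auto
  obtain s where s: "0 < s" "x = ennreal s" using assms(2,3) by (cases x) auto
  have "b \<noteq> 0" using assms(1) by auto
  then obtain t where t: "0 < t" "b = ennreal t" using assms(5) by (cases b) (auto simp: less_le)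
  obtain q where q: "q \<in> \<rat>" "r / t < q" "ennreal (q * s) < w"
  proof (cases w)
    case top
    obtain q where "q \<in> \<rat>" "r / t < q" using Rats_dense_in_real[of "r / t" "r / t + 1"] by auto
    then show ?thesis using that top by simp
  next
    case (real v)
    have "ennreal (s * r) < ennreal (v * t)" using assms(1) r s t real by (simp add: ennreal_mult)
    then have "s * r < v * t" using r s by (simp add: ennreal_less_iff)
    then have "r / t < v / s" using s t by (simp add: field_simps)
    then obtain q where "q \<in> \<rat>" "r / t < q" "q < v / s" using Rats_dense_in_real by blast
    moreover have "0 < q" using \<open>r / t < q\<close> r t by (meson divide_pos_pos less_trans)
    moreover have "q * s < v" using \<open>q < v / s\<close> s by (simp add: field_simps)
    then have "ennreal (q * s) < w" unfolding real using \<open>0 < q\<close> s by (simp add: ennreal_less_iff)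
    ultimately show ?thesis using that by blast
  qed
  have q0: "0 < q" using q(2) r t by (meson divide_pos_pos less_trans)
  obtain m n where mn: "n \<noteq> 0" "\<bar>q\<bar> = real m / real n" by (rule Rats_abs_nat_div_natE[OF q(1)])
  have eq: "of_nat m / of_nat n = ennreal q"
    using mn q0 by (simp add: ennreal_of_nat_eq_real_of_nat divide_ennreal)
  have "r \<le> q * t" using q(2) t by (simp add: field_simps)
  then have "a \<le> of_nat m / of_nat n * b" unfolding eq using r t q0 by (simp add: ennreal_mult[symmetric] ennreal_leI)
  moreover have "of_nat m / of_nat n * x < w" unfolding eq using q s q0 by (simp add: ennreal_mult)
  ultimately show ?thesis using mn(1) by blast
qed

text \<open>Moving rational factors across the tensor sign and comparing elements of the internal hom whose
  endpoints are strictly ordered identifies the compact and the soft elements with the same value.\<close>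

lemma Pbar_tens_le:
  assumes X: "X \<in> carrier (ihom Pbar Pbar)" and Y: "Y \<in> carrier (ihom Pbar Pbar)"
    and le: "endpoint Pbar Pbar X a \<le> endpoint Pbar Pbar Y b"
  shows "tens (ihom Pbar Pbar) Pbar X a \<subseteq> tens (ihom Pbar Pbar) Pbar Y b"
proof
  let ?H = "ihom Pbar Pbar" and ?t = "tens (ihom Pbar Pbar) Pbar" and ?e = "\<lambda>X. endpoint Pbar Pbar X 1"
  have zero_le: "?t Z x \<subseteq> ?t Y b" if "?t Z x = \<zero>\<^bsub>tensor ?H Pbar\<^esub>" for Z x
    using HP.P.zero_le[OF HP.phi_closed[OF Y]] that by (simp add: HP.tensor_simps(4))
  fix f assume "f \<in> ?t X a"
  \<comment> \<open>Passing to X' and a' creates the room: a' < a unless a' = 0, and the endpoint of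
    X' becomes finite.\<close>
  then obtain X' a' where f: "tensor_below ?H Pbar f [(X', a')]" and X': "X' \<lless>\<^bsub>?H\<^esub> X" and a': "a' \<lless>\<^bsub>Pbar\<^esub> a"
    using HP.below_single unfolding tens_def by blast
  have Xc: "X' \<in> carrier ?H" using HP.S.way_below_closed X' by blast
  obtain c where c: "incr_vals c" "X' = mcls c" by (rule mclsE[OF Xc])
  have "?t X' a' \<subseteq> ?t Y b"
  proof (cases "a' = 0 \<or> ?e X' = 0")
    case True
    have "?t X' a' = \<zero>\<^bsub>tensor ?H Pbar\<^esub>"
    proof (cases "a' = 0")
      case True then show ?thesis using HP.phi_zeror[OF Xc] by simp
    next
      case False
      then have "X' \<sqsubseteq>\<^bsub>?H\<^esub> \<zero>\<^bsub>?H\<^esub>" using True by (intro Pbar_ihom_le Xc HP.S.zero_closed) simp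
      then have "X' = \<zero>\<^bsub>?H\<^esub>" using HP.S.le_antisym HP.S.zero_le Xc HP.S.zero_closed by blast
      then show ?thesis using HP.phi_zerol by simp
    qed
    then show ?thesis by (rule zero_le)
  next
    case False
    then have a'_less: "a' < a" "0 < a'" and e0: "0 < ?e X'"
      using a' by (auto simp: Pbar_way_below zero_less_iff_neq_zero)
    \<comment> \<open>The unit is not way below itself, so 2 serves as the larger test argument that
      shows the endpoint of X' to be finite.\<close>
    have "1 \<lless>\<^bsub>Pbar\<^esub> 2" by (simp add: Pbar_way_below)
    then have "?e X' \<lless>\<^bsub>Pbar\<^esub> endpoint Pbar Pbar X 2"
      by (rule cu_bimor_loc.phi_wb[OF Pbar.endpoint_loc X'])
    then have etop: "?e X' < top" by (auto simp: Pbar_way_below less_top[symmetric])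
    have "?e X' \<le> ?e X"
      using cu_bimor_loc.phi_monol[OF Pbar.endpoint_loc Xc X _ HP.S.way_below_le[OF X'], of 1] by simp
    then have "?e X' * a' < ?e Y * b"
    proof -
      have "?e X' * a' < ?e X' * a" using ennreal_mult_strict_left_mono[OF a'_less(1) e0 etop] .
      also have "\<dots> \<le> ?e X * a" using \<open>?e X' \<le> ?e X\<close> by (intro mult_right_mono) auto
      also have "\<dots> \<le> ?e Y * b" using le endpoint_Pbar[OF X, of a] endpoint_Pbar[OF Y, of b] by simp
      finally show ?thesis .
    qed
    moreover from this have "0 < b" by (auto simp: zero_less_iff_neq_zero)
    \<comment> \<open>b may be infinite. A member \<open>d i\<close> < b still satisfies the strict
      inequality and is finite, as \<open>rational_between\<close> requires.\<close>
    then obtain d where d: "\<And>n. d n < b" "(SUP n::nat. d n) = b" using ennreal_strict_approx by blast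
    ultimately have "?e X' * a' < (SUP n. ?e Y * d n)" by (simp add: SUP_mult_left_ennreal[symmetric])
    then obtain i where i: "?e X' * a' < ?e Y * d i" unfolding less_SUP_iff by blast
    have "d i < top" using d(1)[of i] by (rule less_le_trans) simp
    then obtain m n where mn: "0 < n" "a' \<le> of_nat m / of_nat n * d i" "of_nat m / of_nat n * ?e X' < ?e Y"
      using rational_between[OF i e0 etop a'_less(2)] by blast
    have q: "of_nat m / of_nat n < (top::ennreal)"
      using mn(1) by (simp add: ennreal_divide_eq_top_iff less_top[symmetric])
    have qc: "incr_vals (\<lambda>l. of_nat m / of_nat n * c l)" by (rule incr_vals_scale[OF c(1) q])
    let ?Z = "mcls (\<lambda>l. of_nat m / of_nat n * c l)"
    have Z: "?Z \<in> carrier ?H" by (rule PP.pcls_closed[OF mpath_closed[OF qc]])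
    have "?e ?Z < ?e Y"
      using mn(3) by (simp add: endpoint_mcls[OF qc] c(2) endpoint_mcls[OF c(1)] SUP_mult_left_ennreal)
    then have ZY: "?Z \<sqsubseteq>\<^bsub>?H\<^esub> Y" by (intro Pbar_ihom_le Z Y) simp
    have "?t X' a' \<subseteq> ?t X' (of_nat m / of_nat n * d i)"
      using HP.phi_monor[OF Xc _ _ , of a' "of_nat m / of_nat n * d i"] mn(2) by (simp add: HP.tensor_simps(4))
    also have "\<dots> = ?t ?Z (d i)" unfolding c(2) by (rule tens_rational_scale[OF c(1) mn(1)])
    also have "\<dots> \<subseteq> ?t Y b"
      using HP.phi_mono[OF Z Y _ _ ZY, of "d i" b] d(1)[of i] by (simp add: HP.tensor_simps(4))
    finally show ?thesis .
  qed
  then show "f \<in> ?t Y b" using f unfolding tens_def by blast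
qed

lemma Pbar_eval_iso: "eval_iso Pbar"
proof (rule Pbar.eval_isoI)
  fix X a assume X: "X \<in> carrier (ihom Pbar Pbar)"
  let ?p = "pi_map Pbar (endpoint Pbar Pbar X a)"
  have p: "?p \<in> carrier (ihom Pbar Pbar)" by (rule Pbar.pi_closed) simp
  have "endpoint Pbar Pbar ?p 1 = endpoint Pbar Pbar X a" by (simp add: Pbar.endpoint_pi)
  then show "tens (ihom Pbar Pbar) Pbar X a = tens (ihom Pbar Pbar) Pbar ?p \<one>\<^bsub>Pbar\<^esub>"
    by (intro equalityI Pbar_tens_le X p) simp_all
qed

text \<open>The constant path at the identity and \<open>\<pi>(1)\<close> are the compact and the soft element of value 1.\<close>

lemma Pbar_not_eps_iso: "\<not> eps_iso Pbar"
proof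
  let ?H = "ihom Pbar Pbar"
  assume "eps_iso Pbar"
  then have inj: "inj_on (eps_map Pbar) (carrier ?H)" unfolding eps_iso_def cu_iso_def bij_betw_def by simp
  have i: "incr_vals (\<lambda>l. 1)" unfolding incr_vals_def by simp
  have X: "mcls (\<lambda>l. 1) \<in> carrier ?H" by (rule PP.pcls_closed[OF mpath_closed[OF i]])
  have p: "pi_map Pbar 1 \<in> carrier ?H" by (rule Pbar.pi_closed) simp
  have "(SUP l\<in>I_Q. 1) = (1::ennreal)" using uq_I_Q[of 0] by (intro SUP_const) blast
  then have "eps_map Pbar (mcls (\<lambda>l. 1)) = eps_map Pbar (pi_map Pbar 1)"
    using X p by (simp add: Pbar.eps_pi) (simp add: Pbar.eps_map_eq endpoint_mcls[OF i])
  then have eq: "mcls (\<lambda>l. 1) = pi_map Pbar 1" using inj_onD[OF inj _ X p] by blast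
  interpret M: cu_bimor_loc Pbar Pbar Pbar "(*)" using Pbar.mult_loc by simp
  obtain q where q: "approx_path Pbar 1 q" "M.slices q \<in> paths Pbar Pbar"
      "M.curried 1 = path_class Pbar Pbar (M.slices q)"
    by (rule M.curried_pathE[of 1]) simp
  have "pi_map Pbar 1 = path_class Pbar Pbar (M.slices q)" using q(3) Pbar.pi_map_eq by simp
  then have "path_le Pbar Pbar (mpath (\<lambda>l. 1)) (M.slices q)"
    using eq PP.pcls_self[OF q(2)] PP.pcls_mem by metis
  then obtain m where m: "m \<in> I_Q" "gcu_below Pbar Pbar (mpath (\<lambda>l. 1) (uq 0)) (M.slices q m)"
    using PP.path_leD[OF _ uq_I_Q] by blast
  have "mpath (\<lambda>l. 1) (uq 0) = (\<lambda>x. 1 * x)" "M.slices q m = (\<lambda>x. q m * x)"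
    using uq_I_Q[of 0] m(1) by (auto simp: mpath_def M.slices_def M.slice_def)
  then have "1 \<le> q m" using m(2) Pbar_mult_prec[of 1 "q m"] by simp
  moreover have "q m \<lless>\<^bsub>Pbar\<^esub> 1" using q(1) m(1) unfolding approx_path_def by blast
  ultimately show False by (auto simp: Pbar_way_below)
qed

section \<open>The Cuntz semigroup of a II-1-factor\<close>

text \<open>Value and flag serve as coordinates: the order becomes lexicographic, with the soft
  element just below the compact one of equal value.\<close>

fun m1_val :: "m1 \<Rightarrow> ennreal" where
  "m1_val (Cpt a) = a"
| "m1_val (Soft a) = a"

fun m1_cpt :: "m1 \<Rightarrow> bool" where
  "m1_cpt (Cpt a) = True"
| "m1_cpt (Soft a) = False"

lemma m1_eq_iff: "x = y \<longleftrightarrow> m1_val x = m1_val y \<and> (m1_cpt x \<longleftrightarrow> m1_cpt y)"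
  by (cases x; cases y) auto

lemma M1_carrier: "x \<in> carrier M1 \<longleftrightarrow> (if m1_cpt x then m1_val x < top else 0 < m1_val x)"
  by (cases x) (auto simp: M1_def)

lemma M1_le: "x \<sqsubseteq>\<^bsub>M1\<^esub> y \<longleftrightarrow> m1_val x < m1_val y \<or> m1_val x = m1_val y \<and> (m1_cpt x \<longrightarrow> m1_cpt y)"
  by (cases x; cases y) (auto simp: M1_def)

lemma M1_add: "m1_val (x \<oplus>\<^bsub>M1\<^esub> y) = m1_val x + m1_val y" "m1_cpt (x \<oplus>\<^bsub>M1\<^esub> y) \<longleftrightarrow> m1_cpt x \<and> m1_cpt y"
  by (cases x; cases y; simp add: M1_def)+

lemma M1_zero: "\<zero>\<^bsub>M1\<^esub> = Cpt 0" and M1_one: "\<one>\<^bsub>M1\<^esub> = Cpt 1"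
  unfolding M1_def by auto

lemma M1_val_mult: "m1_val (x \<odot>\<^bsub>M1\<^esub> y) = m1_val x * m1_val y"
  by (cases x; cases y) (auto simp: M1_def)

lemma M1_cpt_mult:
  assumes "x \<in> carrier M1" "y \<in> carrier M1"
  shows "m1_cpt (x \<odot>\<^bsub>M1\<^esub> y) \<longleftrightarrow> m1_cpt x \<and> m1_cpt y \<or> m1_val x = 0 \<or> m1_val y = 0"
  using assms unfolding M1_carrier by (cases x; cases y) (auto simp: M1_def)

lemma M1_cpt_if_zero: "\<lbrakk>x \<in> carrier M1; m1_val x = 0\<rbrakk> \<Longrightarrow> m1_cpt x"
  unfolding M1_carrier by (auto split: if_splits)

lemma M1_soft_if_top: "\<lbrakk>x \<in> carrier M1; m1_val x = top\<rbrakk> \<Longrightarrow> \<not> m1_cpt x"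
  unfolding M1_carrier by (auto split: if_splits)

lemma M1_add_closed: "\<lbrakk>x \<in> carrier M1; y \<in> carrier M1\<rbrakk> \<Longrightarrow> x \<oplus>\<^bsub>M1\<^esub> y \<in> carrier M1"
  unfolding M1_carrier M1_add by (auto simp: zero_less_iff_neq_zero)

lemma M1_mult_closed:
  assumes "x \<in> carrier M1" "y \<in> carrier M1" shows "x \<odot>\<^bsub>M1\<^esub> y \<in> carrier M1"
  using assms M1_cpt_mult[OF assms] unfolding M1_carrier[of "x \<odot>\<^bsub>M1\<^esub> y"] M1_val_mult
  by (auto simp: M1_carrier ennreal_mult_less_top zero_less_iff_neq_zero split: if_splits)

lemma M1_pos_ordered_semigroup: "pos_ordered_semigroup M1"
proof
  show "a \<oplus>\<^bsub>M1\<^esub> c \<sqsubseteq>\<^bsub>M1\<^esub> b \<oplus>\<^bsub>M1\<^esub> c" if c: "c \<in> carrier M1" and ab: "a \<sqsubseteq>\<^bsub>M1\<^esub> b" for a b c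
  proof (cases "m1_val c = top")
    \<comment> \<open>Adding infinity may destroy strictness, but then c is soft and both sums are
      the soft infinite element.\<close>
    case True
    then show ?thesis using M1_soft_if_top[OF c] by (simp add: M1_le M1_add)
  next
    case False
    then show ?thesis using ab ennreal_add_less_mono[of "m1_val a" "m1_val b" "m1_val c" "m1_val c"]
      by (auto simp: M1_le M1_add less_top)
  qed
  show "\<zero>\<^bsub>M1\<^esub> \<sqsubseteq>\<^bsub>M1\<^esub> a" if "a \<in> carrier M1" for a
    using M1_cpt_if_zero[OF that] by (auto simp: M1_le M1_zero zero_less_iff_neq_zero)
qed (auto simp: m1_eq_iff M1_add M1_add_closed M1_le M1_zero add.assoc add.commute, simp add: M1_carrier)

interpretation M1_pos: pos_ordered_semigroup M1 by (rule M1_pos_ordered_semigroup)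

lemma M1_incr_val: "incr_seq M1 c \<Longrightarrow> incseq (\<lambda>n. m1_val (c n))"
  unfolding incr_seq_def incseq_Suc_iff M1_le by (metis le_less)

lemma M1_is_supI:
  assumes c: "incr_seq M1 c" and s: "s \<in> carrier M1" "(SUP n. m1_val (c n)) = m1_val s"
    "m1_cpt s \<longleftrightarrow> (\<exists>n. m1_cpt (c n) \<and> m1_val (c n) = m1_val s)"
  shows "is_sup M1 (range c) s"
  unfolding is_sup_def
proof (intro conjI ballI impI)
  show "x \<sqsubseteq>\<^bsub>M1\<^esub> s" if x: "x \<in> range c" for x
  proof -
    obtain n where n: "x = c n" using x by blast
    have "m1_val (c n) \<le> m1_val s" unfolding s(2)[symmetric] by (rule SUP_upper) simp
    then show ?thesis using s(3) unfolding n M1_le by (auto simp: le_less)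
  qed
  fix u assume u: "u \<in> carrier M1" "\<forall>x\<in>range c. x \<sqsubseteq>\<^bsub>M1\<^esub> u"
  then have le: "c n \<sqsubseteq>\<^bsub>M1\<^esub> u" for n by blast
  then have "m1_val s \<le> m1_val u" unfolding s(2)[symmetric] M1_le by (intro SUP_least) (auto simp: le_less)
  moreover have "m1_cpt u" if "m1_val s = m1_val u" "m1_cpt s"
    using that s(3) le unfolding M1_le by (metis less_irrefl)
  ultimately show "s \<sqsubseteq>\<^bsub>M1\<^esub> u" unfolding M1_le by (auto simp: le_less)
qed (rule s(1))

lemma M1_sup_exists:
  assumes c: "incr_seq M1 c"
  shows "\<exists>s\<in>carrier M1. (SUP n. m1_val (c n)) = m1_val s \<and>
    (m1_cpt s \<longleftrightarrow> (\<exists>n. m1_cpt (c n) \<and> m1_val (c n) = m1_val s))"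
proof -
  define V where "V = (SUP n. m1_val (c n))"
  have cc: "c n \<in> carrier M1" for n using c unfolding incr_seq_def by blast
  have le: "m1_val (c n) \<le> V" for n unfolding V_def by (rule SUP_upper) simp
  show ?thesis
  proof (cases "\<exists>n. m1_cpt (c n) \<and> m1_val (c n) = V")
    case True
    then have "Cpt V \<in> carrier M1" using cc M1_carrier by auto
    then show ?thesis using True by (intro bexI[of _ "Cpt V"]) (auto simp: V_def)
  next
    case False
    \<comment> \<open>Value 0 would be attained by the compact zero; hence a soft supremum has
      positive value and lies in the carrier.\<close>
    have "0 < V"
    proof (rule ccontr)
      assume "\<not> 0 < V"
      then have "m1_val (c 0) = V" "V = 0" using le[of 0] by (auto simp: zero_less_iff_neq_zero)
      then show False using False M1_cpt_if_zero[OF cc, of 0] by auto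
    qed
    then have "Soft V \<in> carrier M1" using M1_carrier by auto
    then show ?thesis using False by (intro bexI[of _ "Soft V"]) (auto simp: V_def)
  qed
qed

lemma M1_is_sup_iff:
  assumes c: "incr_seq M1 c"
  shows "is_sup M1 (range c) s \<longleftrightarrow> s \<in> carrier M1 \<and> (SUP n. m1_val (c n)) = m1_val s \<and>
    (m1_cpt s \<longleftrightarrow> (\<exists>n. m1_cpt (c n) \<and> m1_val (c n) = m1_val s))"
  using M1_is_supI[OF c] M1_sup_exists[OF c] M1_pos.is_sup_unique by metis

text \<open>Soft elements are limits of compact ones of strictly smaller value. This yields (O2),
  tests \<open>\<lless>\<close> below soft elements, and extends identities from compact elements to
  soft ones.\<close>

lemma M1_sup_soft:
  assumes d: "strict_mono d" "\<And>n. d n < b" "(SUP n::nat. d n) = b"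
  shows "incr_seq M1 (\<lambda>n. Cpt (d n))" "is_sup M1 (range (\<lambda>n. Cpt (d n))) (Soft b)"
proof -
  have "d n < top" for n using d(2)[of n] by (rule less_le_trans) simp
  then show i: "incr_seq M1 (\<lambda>n. Cpt (d n))"
    using d(1) unfolding incr_seq_def by (simp add: M1_carrier M1_le strict_mono_Suc_iff)
  have "0 < b" using d(2)[of 0] by (rule le_less_trans[rotated]) simp
  then show "is_sup M1 (range (\<lambda>n. Cpt (d n))) (Soft b)"
    unfolding M1_is_sup_iff[OF i] using d(3) less_imp_neq[OF d(2)] \<open>0 < b\<close> by (simp add: M1_carrier)
qed

lemma M1_way_below:
  "x \<lless>\<^bsub>M1\<^esub> y \<longleftrightarrow> x \<in> carrier M1 \<and> y \<in> carrier M1 \<and>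
    (m1_val x < m1_val y \<or> m1_val x = m1_val y \<and> m1_cpt y)"
proof
  assume wb: "x \<lless>\<^bsub>M1\<^esub> y"
  note xy = M1_pos.way_below_closed[OF wb]
  have "m1_val x < m1_val y \<or> m1_val x = m1_val y \<and> m1_cpt y"
  proof (cases "m1_cpt y")
    case True
    then show ?thesis using M1_pos.way_below_le[OF wb] unfolding M1_le by blast
  next
    case False
    then have y: "y = Soft (m1_val y)" "0 < m1_val y" using xy(2) by (auto simp: m1_eq_iff M1_carrier)
    obtain d where d: "strict_mono d" "\<And>n. d n < m1_val y" "(SUP n::nat. d n) = m1_val y"
      using ennreal_strict_approx[OF y(2)] by blast
    obtain n where "x \<sqsubseteq>\<^bsub>M1\<^esub> Cpt (d n)"
      using M1_pos.way_below_seq[OF wb M1_sup_soft(1)[OF d]] M1_sup_soft(2)[OF d] y(1) by auto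
    then show ?thesis using d(2)[of n] unfolding M1_le by auto
  qed
  then show "x \<in> carrier M1 \<and> y \<in> carrier M1 \<and> (m1_val x < m1_val y \<or> m1_val x = m1_val y \<and> m1_cpt y)"
    using xy by blast
next
  assume *: "x \<in> carrier M1 \<and> y \<in> carrier M1 \<and> (m1_val x < m1_val y \<or> m1_val x = m1_val y \<and> m1_cpt y)"
  show "x \<lless>\<^bsub>M1\<^esub> y" unfolding way_below_def
  proof (intro conjI allI impI; (elim conjE)?)
    fix c s assume c: "incr_seq M1 c" "is_sup M1 (range c) s" "y \<sqsubseteq>\<^bsub>M1\<^esub> s"
    note s = c(2)[unfolded M1_is_sup_iff[OF c(1)]]
    show "\<exists>k. x \<sqsubseteq>\<^bsub>M1\<^esub> c k"
    proof (cases "m1_val x < m1_val s")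
      case True
      then obtain n where "m1_val x < m1_val (c n)" using s less_SUP_iff by metis
      then show ?thesis unfolding M1_le by blast
    next
      case False
      then have "m1_val x = m1_val s" "m1_cpt s" using * c(3) unfolding M1_le by (auto dest: less_trans)
      then show ?thesis using s unfolding M1_le by metis
    qed
  qed (use * in auto)
qed

text \<open>A compact member that attains the supremum equals it, so the sequence is constant from
  there on. Two sequences can then be read at a common index.\<close>

lemma M1_eventually_sup:
  assumes c: "incr_seq M1 c" "is_sup M1 (range c) s" and n: "m1_cpt (c n)" "m1_val (c n) = m1_val s" "n \<le> k"
  shows "m1_cpt (c k)" "m1_val (c k) = m1_val s"
proof -
  have "c n \<sqsubseteq>\<^bsub>M1\<^esub> c k" by (rule M1_pos.incr_seq_le[OF c(1) n(3)])
  moreover have "c k \<sqsubseteq>\<^bsub>M1\<^esub> s" using c(2) unfolding is_sup_def by blast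
  ultimately show "m1_cpt (c k)" "m1_val (c k) = m1_val s" using n unfolding M1_le by auto
qed

lemma M1_cu_semigroup: "cu_semigroup M1"
proof (intro cu_semigroup.intro M1_pos_ordered_semigroup cu_semigroup_axioms.intro)
  show "\<exists>s. is_sup M1 (range c) s" if "incr_seq M1 c" for c
    using M1_is_sup_iff[OF that] M1_sup_exists[OF that] by blast
  show "\<exists>c. (\<forall>n. c n \<lless>\<^bsub>M1\<^esub> c (Suc n)) \<and> is_sup M1 (range c) a" if a: "a \<in> carrier M1" for a
  proof (cases "m1_cpt a")
    case True
    then show ?thesis using a M1_pos.is_sup_const by (intro exI[of _ "\<lambda>_. a"]) (auto simp: M1_way_below)
  next
    case False
    then have y: "a = Soft (m1_val a)" "0 < m1_val a" using a by (auto simp: m1_eq_iff M1_carrier)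
    obtain d where d: "strict_mono d" "\<And>n. d n < m1_val a" "(SUP n::nat. d n) = m1_val a"
      using ennreal_strict_approx[OF y(2)] by blast
    have "Cpt (d n) \<lless>\<^bsub>M1\<^esub> Cpt (d (Suc n))" for n
      using M1_sup_soft(1)[OF d] d(1) by (simp add: M1_way_below incr_seq_def strict_mono_Suc_iff)
    then show ?thesis using M1_sup_soft(2)[OF d] y(1) by (intro exI[of _ "\<lambda>n. Cpt (d n)"]) auto
  qed
  show "x' \<oplus>\<^bsub>M1\<^esub> y' \<lless>\<^bsub>M1\<^esub> x \<oplus>\<^bsub>M1\<^esub> y" if wb: "x' \<lless>\<^bsub>M1\<^esub> x" "y' \<lless>\<^bsub>M1\<^esub> y" for x' x y' y
  proof -
    have fin: "m1_val z' < top" "m1_val z' \<le> m1_val z" if "z' \<lless>\<^bsub>M1\<^esub> z" for z' z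
      using that less_le_trans[of "m1_val z'" "m1_val z" top] by (auto simp: M1_way_below M1_carrier)
    show ?thesis
      using wb ennreal_add_less_mono[OF _ fin(2,1)[OF wb(2)], of "m1_val x'" "m1_val x"]
        ennreal_add_less_mono[OF _ fin(2,1)[OF wb(1)], of "m1_val y'" "m1_val y"]
      by (auto simp: M1_way_below M1_add M1_add_closed add.commute)
  qed
  show "csup M1 (range (\<lambda>n. c n \<oplus>\<^bsub>M1\<^esub> d n)) = csup M1 (range c) \<oplus>\<^bsub>M1\<^esub> csup M1 (range d)"
    if c: "incr_seq M1 c" and d: "incr_seq M1 d" for c d
  proof -
    obtain s t where s: "is_sup M1 (range c) s" and t: "is_sup M1 (range d) t"
      using M1_sup_exists[OF c] M1_sup_exists[OF d] M1_is_sup_iff[OF c] M1_is_sup_iff[OF d] by meson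
    note s' = s[unfolded M1_is_sup_iff[OF c]] and t' = t[unfolded M1_is_sup_iff[OF d]]
    have cc: "c n \<in> carrier M1" "d n \<in> carrier M1" for n using c d unfolding incr_seq_def by auto
    have le: "m1_val (c n) \<le> m1_val s" "m1_val (d n) \<le> m1_val t" for n
      using s t unfolding is_sup_def M1_le by (auto simp: le_less)
    have i: "incr_seq M1 (\<lambda>n. c n \<oplus>\<^bsub>M1\<^esub> d n)"
      using c d cc unfolding incr_seq_def by (simp add: M1_add_closed M1_pos.add_mono2)
    have "is_sup M1 (range (\<lambda>n. c n \<oplus>\<^bsub>M1\<^esub> d n)) (s \<oplus>\<^bsub>M1\<^esub> t)"
      unfolding M1_is_sup_iff[OF i] M1_add
    proof (intro conjI iffI)
      show "s \<oplus>\<^bsub>M1\<^esub> t \<in> carrier M1" using s' t' M1_add_closed by blast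
      show "(SUP n. m1_val (c n) + m1_val (d n)) = m1_val s + m1_val t"
        using ennreal_SUP_add[OF M1_incr_val[OF c] M1_incr_val[OF d]] s' t' by simp
      assume "m1_cpt s \<and> m1_cpt t"
      then obtain m n where mn: "m1_cpt (c m)" "m1_val (c m) = m1_val s" "m1_cpt (d n)" "m1_val (d n) = m1_val t"
        using s' t' by blast
      show "\<exists>n. (m1_cpt (c n) \<and> m1_cpt (d n)) \<and> m1_val (c n) + m1_val (d n) = m1_val s + m1_val t"
        using M1_eventually_sup[OF c s mn(1,2), of "max m n"] M1_eventually_sup[OF d t mn(3,4), of "max m n"]
        by (intro exI[of _ "max m n"]) simp
    next
      assume "\<exists>n. (m1_cpt (c n) \<and> m1_cpt (d n)) \<and> m1_val (c n) + m1_val (d n) = m1_val s + m1_val t"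
      then obtain n where n: "m1_cpt (c n)" "m1_cpt (d n)" "m1_val (c n) + m1_val (d n) = m1_val s + m1_val t" by blast
      \<comment> \<open>Compact members have finite values, where addition is strictly monotone;
        equality of the sums thus forces equality in both summands.\<close>
      have "m1_val (c n) < top" "m1_val (d n) < top" using n cc[of n] unfolding M1_carrier by auto
      then have "m1_val (c n) = m1_val s" "m1_val (d n) = m1_val t"
        using n(3) le[of n] ennreal_add_less_mono[of "m1_val (c n)" "m1_val s" "m1_val (d n)" "m1_val t"]
          ennreal_add_less_mono[of "m1_val (d n)" "m1_val t" "m1_val (c n)" "m1_val s"]
        by (auto simp: le_less add.commute)
      then show "m1_cpt s" "m1_cpt t" using n s' t' by blast+
    qed
    then show ?thesis using M1_pos.csup_eq s t by simp
  qed
qed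

section \<open>Multiplication of compact and soft elements\<close>

lemma M1_mult_mono:
  assumes x: "x \<in> carrier M1" "x' \<in> carrier M1" and y: "y \<in> carrier M1" "y' \<in> carrier M1"
    and le: "x \<sqsubseteq>\<^bsub>M1\<^esub> x'" "y \<sqsubseteq>\<^bsub>M1\<^esub> y'"
  shows "x \<odot>\<^bsub>M1\<^esub> y \<sqsubseteq>\<^bsub>M1\<^esub> x' \<odot>\<^bsub>M1\<^esub> y'"
proof -
  have "m1_val x \<le> m1_val x'" "m1_val y \<le> m1_val y'" using le unfolding M1_le by auto
  then have v: "m1_val x * m1_val y \<le> m1_val x' * m1_val y'" by (rule mult_mono) auto
  have "m1_cpt (x' \<odot>\<^bsub>M1\<^esub> y')" if eq: "m1_val x * m1_val y = m1_val x' * m1_val y'" and cpt: "m1_cpt (x \<odot>\<^bsub>M1\<^esub> y)"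
  proof (cases "m1_val x' * m1_val y' = 0")
    case True then show ?thesis using M1_cpt_mult[OF x(2) y(2)] by auto
  next
    case False
    then have c: "m1_cpt x" "m1_cpt y" using eq cpt M1_cpt_mult[OF x(1) y(1)] by auto
    then have fin: "m1_val x < top" "m1_val y < top" using x y by (auto simp: M1_carrier)
    \<comment> \<open>The smaller factors are finite and the product is nonzero, so a strict
      increase of either factor would increase the product. Equal products thus have factors of
      equal value, and compactness passes to x' and y'.\<close>
    have "m1_val x = m1_val x'" "m1_val y = m1_val y'"
      using eq False fin \<open>m1_val x \<le> m1_val x'\<close> \<open>m1_val y \<le> m1_val y'\<close>
        ennreal_mult_less_mono[of "m1_val x" "m1_val x'" "m1_val y" "m1_val y'"]
        ennreal_mult_less_mono[of "m1_val y" "m1_val y'" "m1_val x" "m1_val x'"]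
      by (auto simp: le_less zero_less_iff_neq_zero mult.commute)
    then have "m1_cpt x'" "m1_cpt y'" using le c unfolding M1_le by auto
    then show ?thesis using M1_cpt_mult[OF x(2) y(2)] by blast
  qed
  then show ?thesis using v unfolding M1_le M1_val_mult by (auto simp: le_less)
qed

lemma M1_distrib_left:
  assumes "x \<in> carrier M1" "y \<in> carrier M1" "z \<in> carrier M1"
  shows "x \<odot>\<^bsub>M1\<^esub> (y \<oplus>\<^bsub>M1\<^esub> z) = x \<odot>\<^bsub>M1\<^esub> y \<oplus>\<^bsub>M1\<^esub> x \<odot>\<^bsub>M1\<^esub> z"
  using assms M1_cpt_if_zero[of y] M1_cpt_if_zero[of z]
  by (auto simp: m1_eq_iff M1_val_mult M1_add M1_cpt_mult M1_add_closed distrib_left)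

lemma M1_distrib_right:
  assumes "x \<in> carrier M1" "y \<in> carrier M1" "z \<in> carrier M1"
  shows "(y \<oplus>\<^bsub>M1\<^esub> z) \<odot>\<^bsub>M1\<^esub> x = y \<odot>\<^bsub>M1\<^esub> x \<oplus>\<^bsub>M1\<^esub> z \<odot>\<^bsub>M1\<^esub> x"
  using assms M1_cpt_if_zero[of y] M1_cpt_if_zero[of z]
  by (auto simp: m1_eq_iff M1_val_mult M1_add M1_cpt_mult M1_add_closed distrib_right)

lemma M1_mult_sup:
  assumes c: "incr_seq M1 c" "is_sup M1 (range c) s" and d: "incr_seq M1 d" "is_sup M1 (range d) t"
  shows "is_sup M1 (range (\<lambda>n. c n \<odot>\<^bsub>M1\<^esub> d n)) (s \<odot>\<^bsub>M1\<^esub> t)"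
proof -
  note s' = c(2)[unfolded M1_is_sup_iff[OF c(1)]] and t' = d(2)[unfolded M1_is_sup_iff[OF d(1)]]
  have cc: "c n \<in> carrier M1" "d n \<in> carrier M1" for n using c d unfolding incr_seq_def by auto
  have le: "m1_val (c n) \<le> m1_val s" "m1_val (d n) \<le> m1_val t" for n
    using c(2) d(2) unfolding is_sup_def M1_le by (auto simp: le_less)
  have i: "incr_seq M1 (\<lambda>n. c n \<odot>\<^bsub>M1\<^esub> d n)"
    using c(1) d(1) cc unfolding incr_seq_def by (simp add: M1_mult_closed M1_mult_mono)
  show ?thesis unfolding M1_is_sup_iff[OF i] M1_val_mult
  proof (intro conjI iffI)
    show "s \<odot>\<^bsub>M1\<^esub> t \<in> carrier M1" using s' t' M1_mult_closed by blast
    show "(SUP n. m1_val (c n) * m1_val (d n)) = m1_val s * m1_val t"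
      using ennreal_SUP_mult_diag[OF M1_incr_val[OF c(1)] M1_incr_val[OF d(1)]] s' t' by simp
    assume "m1_cpt (s \<odot>\<^bsub>M1\<^esub> t)"
    then consider "m1_cpt s" "m1_cpt t" | "m1_val s = 0 \<or> m1_val t = 0" using s' t' M1_cpt_mult by blast
    then show "\<exists>n. m1_cpt (c n \<odot>\<^bsub>M1\<^esub> d n) \<and> m1_val (c n) * m1_val (d n) = m1_val s * m1_val t"
    proof cases
      case 1
      then obtain m n where mn: "m1_cpt (c m)" "m1_val (c m) = m1_val s" "m1_cpt (d n)" "m1_val (d n) = m1_val t"
        using s' t' by blast
      show ?thesis
        using M1_eventually_sup[OF c mn(1,2), of "max m n"] M1_eventually_sup[OF d mn(3,4), of "max m n"] cc
        by (intro exI[of _ "max m n"]) (simp add: M1_cpt_mult)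
    next
      case 2
      then have "m1_val (c 0) = 0 \<or> m1_val (d 0) = 0" using le[of 0] by auto
      then show ?thesis using 2 cc[of 0] by (intro exI[of _ 0]) (auto simp: M1_cpt_mult)
    qed
  next
    assume "\<exists>n. m1_cpt (c n \<odot>\<^bsub>M1\<^esub> d n) \<and> m1_val (c n) * m1_val (d n) = m1_val s * m1_val t"
    then obtain n where n: "m1_cpt (c n \<odot>\<^bsub>M1\<^esub> d n)" "m1_val (c n) * m1_val (d n) = m1_val s * m1_val t" by blast
    have "c n \<sqsubseteq>\<^bsub>M1\<^esub> s" "d n \<sqsubseteq>\<^bsub>M1\<^esub> t" using c(2) d(2) unfolding is_sup_def by auto
    from M1_mult_mono[OF cc(1) _ cc(2) _ this] have "c n \<odot>\<^bsub>M1\<^esub> d n \<sqsubseteq>\<^bsub>M1\<^esub> s \<odot>\<^bsub>M1\<^esub> t" using s' t' by blast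
    then show "m1_cpt (s \<odot>\<^bsub>M1\<^esub> t)" using n unfolding M1_le M1_val_mult by auto
  qed
qed

lemma M1_mult_bimor: "cu_bimor M1 M1 M1 (mult M1)"
proof -
  interpret cu_semigroup M1 by (rule M1_cu_semigroup)
  show ?thesis unfolding cu_bimor_def
  proof (intro conjI ballI allI impI; (elim conjE)?)
    show "\<zero>\<^bsub>M1\<^esub> \<odot>\<^bsub>M1\<^esub> b = \<zero>\<^bsub>M1\<^esub>" "b \<odot>\<^bsub>M1\<^esub> \<zero>\<^bsub>M1\<^esub> = \<zero>\<^bsub>M1\<^esub>" if "b \<in> carrier M1" for b
      using that M1_pos.zero_closed M1_cpt_mult[OF M1_pos.zero_closed that] M1_cpt_mult[OF that M1_pos.zero_closed]
      by (simp_all add: m1_eq_iff M1_val_mult) (simp_all add: M1_zero)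
    show "csup M1 (range (\<lambda>k. c k \<odot>\<^bsub>M1\<^esub> d k)) = csup M1 (range c) \<odot>\<^bsub>M1\<^esub> csup M1 (range d)"
      if "incr_seq M1 c" "incr_seq M1 d" for c d
      by (rule M1_pos.csup_eq[OF M1_mult_sup[OF that(1) is_sup_csup[OF that(1)] that(2) is_sup_csup[OF that(2)]]])
    show "x' \<odot>\<^bsub>M1\<^esub> y' \<lless>\<^bsub>M1\<^esub> x \<odot>\<^bsub>M1\<^esub> y" if wb: "x' \<lless>\<^bsub>M1\<^esub> x" "y' \<lless>\<^bsub>M1\<^esub> y" for x' x y' y
    proof -
      have xy: "x \<in> carrier M1" "y \<in> carrier M1" "x' \<in> carrier M1" "y' \<in> carrier M1"
        using wb by (auto simp: M1_way_below)
      have fin: "m1_val z' < top" "m1_val z' \<le> m1_val z" if "z' \<lless>\<^bsub>M1\<^esub> z" for z' z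
        using that less_le_trans[of "m1_val z'" "m1_val z" top] by (auto simp: M1_way_below M1_carrier)
      show ?thesis
      proof (cases "m1_val x = 0 \<or> m1_val y = 0")
        case True
        then show ?thesis using xy fin(2)[OF wb(1)] fin(2)[OF wb(2)]
          by (auto simp: M1_way_below M1_mult_closed M1_val_mult M1_cpt_mult)
      next
        case False
        then show ?thesis
          using wb xy ennreal_mult_less_mono[OF _ fin(2)[OF wb(2)] _ fin(1)[OF wb(2)], of "m1_val x'" "m1_val x"]
            ennreal_mult_less_mono[OF _ fin(2)[OF wb(1)] _ fin(1)[OF wb(1)], of "m1_val y'" "m1_val y"]
          by (auto simp: M1_way_below M1_mult_closed M1_val_mult M1_cpt_mult mult.commute zero_less_iff_neq_zero)
      qed
    qed
  qed (auto simp: M1_mult_closed M1_distrib_left M1_distrib_right M1_mult_mono M1_pos.le_refl)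
qed

lemma M1_cu_semiring: "cu_semiring M1"
proof -
  interpret cu_semigroup M1 by (rule M1_cu_semigroup)
  show ?thesis
  proof
    show one: "\<one>\<^bsub>M1\<^esub> \<in> carrier M1" by (simp add: M1_one M1_carrier)
    show "a \<odot>\<^bsub>M1\<^esub> \<one>\<^bsub>M1\<^esub> = a" "\<one>\<^bsub>M1\<^esub> \<odot>\<^bsub>M1\<^esub> a = a" if "a \<in> carrier M1" for a
      using M1_cpt_mult[OF that one] M1_cpt_mult[OF one that] M1_cpt_if_zero[OF that]
      by (auto simp: m1_eq_iff M1_val_mult M1_one)
  qed (auto simp: M1_mult_bimor m1_eq_iff M1_val_mult M1_cpt_mult M1_mult_closed mult.assoc)
qed

interpretation M1: cu_semiring M1 by (rule M1_cu_semiring)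

interpretation MM: cu_pair M1 M1 by unfold_locales

interpretation MB: cu_bimor_loc M1 M1 M1 "mult M1" by (rule M1.mult_loc)

text \<open>Divisibility of the compact elements determines whether \<open>f (Cpt a)\<close> is compact.\<close>

lemma M1_gmor_eq:
  assumes f: "f \<in> gcu_mor M1 M1" and x: "x \<in> carrier M1"
  shows "f x = f \<one>\<^bsub>M1\<^esub> \<odot>\<^bsub>M1\<^esub> x"
proof -
  have C: "Cpt a \<in> carrier M1" if "a < top" for a using that by (simp add: M1_carrier)
  have add: "f (Cpt (a + b)) = f (Cpt a) \<oplus>\<^bsub>M1\<^esub> f (Cpt b)" if "a < top" "b < top" for a b
  proof -
    have "Cpt (a + b) = Cpt a \<oplus>\<^bsub>M1\<^esub> Cpt b" by (simp add: m1_eq_iff M1_add)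
    then show ?thesis using MM.gmor_add[OF f C[OF that(1)] C[OF that(2)]] by simp
  qed
  note cl = MM.gmor_closed[OF f]
  have zero: "f (Cpt 0) = Cpt 0" using MM.gmor_zero[OF f] by (simp add: M1_zero)
  have le: "f (Cpt a) \<sqsubseteq>\<^bsub>M1\<^esub> f (Cpt b)" if "a \<le> b" "b < top" for a b
    using MM.gmor_mono[OF f C[OF le_less_trans[OF that]] C[OF that(2)]] that(1) by (auto simp: M1_le le_less)
  have val: "m1_val (f (Cpt a)) = m1_val (f (Cpt 1)) * a" if "a < top" for a
  proof (rule ennreal_additive_linear[where h = "\<lambda>a. m1_val (f (Cpt a))"])
    show "m1_val (f (Cpt a)) \<le> m1_val (f (Cpt b))" if "a \<le> b" "b < top" for a b
      using le[OF that] unfolding M1_le by auto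
  qed (use add zero that in \<open>auto simp: M1_add\<close>)
  have cpt_add: "m1_cpt (f (Cpt (a + b))) \<longleftrightarrow> m1_cpt (f (Cpt a)) \<and> m1_cpt (f (Cpt b))" if "a < top" "b < top" for a b
    using add[OF that] by (simp add: M1_add)
  have cpt_le: "m1_cpt (f (Cpt a))" if ab: "a \<le> b" "b < top" "m1_cpt (f (Cpt b))" for a b
  proof -
    obtain e where "b = a + e" using ab(1) unfolding le_iff_add by blast
    then show ?thesis using ab cpt_add[of a e] by simp
  qed
  have cpt_nat: "m1_cpt (f (Cpt (of_nat n * a)))" if "a < top" "m1_cpt (f (Cpt a))" for n a
  proof (induction n)
    case (Suc n)
    have "of_nat n * a < top" using that by (simp add: ennreal_mult_less_top of_nat_less_top)
    then show ?case using Suc that cpt_add[of a "of_nat n * a"] by (simp add: distrib_right)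
  qed (simp add: zero)
  \<comment> \<open>Compactness of images passes to multiples and, by splitting off a summand, to
    smaller arguments. Some multiple of a exceeds 1 and some multiple of 1 exceeds a, so all
    positive finite arguments behave alike.\<close>
  have cpt: "m1_cpt (f (Cpt a)) \<longleftrightarrow> m1_cpt (f (Cpt 1))" if a: "a < top" "0 < a" for a
  proof
    obtain r where r: "0 < r" "a = ennreal r" using a by (cases a) auto
    show "m1_cpt (f (Cpt 1))" if "m1_cpt (f (Cpt a))"
    proof -
      obtain n where n: "1 / r < real n" using reals_Archimedean2 by blast
      then have "1 \<le> of_nat n * a" using r
        by (simp add: ennreal_of_nat_eq_real_of_nat ennreal_mult[symmetric] field_simps)
      then show ?thesis using cpt_le[OF _ _ cpt_nat[OF a(1) that]] a
        by (simp add: ennreal_mult_less_top of_nat_less_top)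
    qed
    show "m1_cpt (f (Cpt a))" if "m1_cpt (f (Cpt 1))"
    proof -
      obtain n where "r < real n" using reals_Archimedean2 by blast
      then have "a \<le> of_nat n * 1" using r by (simp add: ennreal_of_nat_eq_real_of_nat)
      then show ?thesis using cpt_le[OF _ _ cpt_nat[OF _ that]] by (simp add: of_nat_less_top)
    qed
  qed
  have fC: "f (Cpt a) = f (Cpt 1) \<odot>\<^bsub>M1\<^esub> Cpt a" if a: "a < top" for a
  proof -
    have one: "Cpt 1 \<in> carrier M1" by (rule C) simp
    have "m1_cpt (f (Cpt a)) \<longleftrightarrow> m1_cpt (f (Cpt 1) \<odot>\<^bsub>M1\<^esub> Cpt a)"
      using M1_cpt_mult[OF cl[OF one] C[OF a]] cpt[OF a] zero M1_cpt_if_zero[OF cl[OF one]]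
      by (cases "a = 0") (auto simp: zero_less_iff_neq_zero)
    then show ?thesis using val[OF a] by (simp add: m1_eq_iff M1_val_mult)
  qed
  show ?thesis
  proof (cases "m1_cpt x")
    case True
    then have "x = Cpt (m1_val x)" "m1_val x < top" using x by (auto simp: m1_eq_iff M1_carrier)
    then show ?thesis using fC[of "m1_val x"] unfolding M1_one by simp
  next
    case False
    then have y: "x = Soft (m1_val x)" "0 < m1_val x" using x by (auto simp: m1_eq_iff M1_carrier)
    obtain d where d: "strict_mono d" "\<And>n. d n < m1_val x" "(SUP n::nat. d n) = m1_val x"
      using ennreal_strict_approx[OF y(2)] by blast
    note D = M1_sup_soft[OF d, folded y(1)]
    have "d n < top" for n using d(2)[of n] by (rule less_le_trans) simp
    then have eq: "(\<lambda>n. f (Cpt (d n))) = (\<lambda>n. f \<one>\<^bsub>M1\<^esub> \<odot>\<^bsub>M1\<^esub> Cpt (d n))" using fC unfolding M1_one by blast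
    have "is_sup M1 (range (\<lambda>n. f (Cpt (d n)))) (f x)" by (rule MM.gmor_sup[OF f D])
    moreover have "is_sup M1 (range (\<lambda>n. f \<one>\<^bsub>M1\<^esub> \<odot>\<^bsub>M1\<^esub> Cpt (d n))) (f \<one>\<^bsub>M1\<^esub> \<odot>\<^bsub>M1\<^esub> x)"
      by (rule MB.phi_sup_right[OF cl[OF M1.one_closed] D])
    ultimately show ?thesis unfolding eq by (rule M1_pos.is_sup_unique)
  qed
qed

text \<open>Because the unit is compact, the values of a path at the unit increase for
  \<open>\<lless>\<close> and approximate their supremum c. As every morphism is multiplication by
  its value at the unit, the path of slices along this family is the given path itself, hence
  represents \<pi>(c). The argument breaks down for \<open>Pbar\<close>, whose unit is not
  compact.\<close>

lemma (in cu_semiring) pi_isoI: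
  assumes compact: "\<one> \<lless> \<one>"
    and linear: "\<And>f x. \<lbrakk>f \<in> gcu_mor R R; x \<in> carrier R\<rbrakk> \<Longrightarrow> f x = f \<one> \<odot> x"
  shows "pi_iso R"
proof -
  interpret RR: cu_pair R R by (rule RR_pair)
  interpret M: cu_bimor_loc R R R "mult R" by (rule mult_loc)
  interpret HP: cu_pair HR R using HR_cu R_cu by (simp add: cu_pair_def)
  interpret PH: cu_pair R HR using HR_cu R_cu by (simp add: cu_pair_def)
  note eps = eps_gcu_mor and pi = cu_morD[OF pi_cu_mor]
  have inv: "pi_map R (eps_map R X) = X" if X: "X \<in> carrier HR" for X
  proof -
    obtain f where f: "f \<in> paths R R" "X = path_class R R f" using X RR.H_carrier by blast
    define c where "c = eps_map R X"
    define p where "p l = f l \<one>" for l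
    have sup: "is_sup R (p ` I_Q) c"
      using RR.endpoint_is_sup[OF f(1) one_closed] X unfolding c_def eps_map_eq f(2) p_def by simp
    then have c: "c \<in> carrier R" and up: "\<And>l. l \<in> I_Q \<Longrightarrow> p l \<sqsubseteq> c" unfolding is_sup_def by auto
    have pp: "p k \<lless> p l" if "k \<in> I_Q" "l \<in> I_Q" "k < l" for k l
      using RR.path_prec[OF f(1) that] compact unfolding gcu_below_def p_def by blast
    have pc: "p l \<in> carrier R" if "l \<in> I_Q" for l
      using RR.path_point_closed[OF f(1) one_closed that] unfolding p_def .
    have incr: "incr_seq R (\<lambda>n. p (uq n))"
      unfolding incr_seq_def using pc uq_I_Q way_below_le[OF pp[OF uq_I_Q uq_I_Q uq_less]] by simp
    have uq: "is_sup R (range (\<lambda>n. p (uq n))) c"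
      using sup is_sup_uq[of p] pc way_below_le[OF pp] by blast
    have "approx_path R c p" unfolding approx_path_def
    proof (intro conjI ballI impI allI)
      show "p l \<lless> c" if l: "l \<in> I_Q" for l
        using I_Q_above[OF l] way_below_le_trans[OF pp[OF l] up c] by blast
      show "\<exists>t\<in>I_Q. x \<lless> p t" if x: "x \<lless> c" for x
      proof -
        obtain n where n: "x \<sqsubseteq> p (uq n)" using way_below_seq[OF x incr uq] by blast
        obtain t where t: "t \<in> I_Q" "uq n < t" using I_Q_above uq_I_Q by blast
        then show ?thesis
          using le_way_below_trans[OF n pp[OF uq_I_Q t] way_below_closed(1)[OF x]] by blast
      qed
    qed (use pp sup in blast)+
    then have "pi_map R c = path_class R R (M.slices p)" unfolding pi_map_eq by (rule M.curried_eq[OF c])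
    moreover have "M.slices p = f"
    proof (rule ext)
      fix l show "M.slices p l = f l"
      proof (cases "l \<in> I_Q")
        case True
        note fl = RR.path_gmor[OF f(1) True]
        have "M.slice (p l) = f l"
          by (rule extensionalityI[OF _ RR.gmor_ext[OF fl]]) (use linear[OF fl] in \<open>auto simp: M.slice_def p_def\<close>)
        then show ?thesis using True by (simp add: M.slices_def)
      next
        case False
        then show ?thesis using f(1) by (auto simp: M.slices_def paths_def PiE_def extensional_def)
      qed
    qed
    ultimately show ?thesis unfolding c_def f(2) by simp
  qed
  show ?thesis unfolding pi_iso_def cu_iso_def
  proof (intro conjI ballI)
    show "bij_betw (pi_map R) (carrier R) (carrier HR)"
      by (rule bij_betw_byWitness[where f' = "eps_map R"]) (use inv eps_pi pi(2) HP.gmor_closed[OF eps] in auto)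
    show "x \<sqsubseteq> y \<longleftrightarrow> pi_map R x \<sqsubseteq>\<^bsub>HR\<^esub> pi_map R y" if "x \<in> carrier R" "y \<in> carrier R" for x y
      using PH.gmor_mono[OF pi(1) that] HP.gmor_mono[OF eps pi(2)[OF that(1)] pi(2)[OF that(2)]]
        eps_pi that by auto
  qed (rule pi(3))
qed

lemma M1_pi_iso: "pi_iso M1"
  by (rule M1.pi_isoI[OF _ M1_gmor_eq]) (auto simp: M1_way_below M1_carrier M1_one)

section \<open>The tensor square of the second example\<close>

lemma sqrt_2_irrational: "sqrt 2 \<notin> \<rat>"
proof
  assume "sqrt 2 \<in> \<rat>"
  then obtain m n :: nat where mn: "n \<noteq> 0" "\<bar>sqrt 2\<bar> = real m / real n" "coprime m n"
    by (rule Rats_abs_nat_div_natE)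
  have "real m = sqrt 2 * real n" using mn(1,2) by (simp add: field_simps)
  then have "real m ^ 2 = 2 * real n ^ 2" by (simp add: power_mult_distrib)
  then have eq: "m ^ 2 = 2 * n ^ 2" by (metis of_nat_eq_iff of_nat_mult of_nat_numeral of_nat_power)
  then have "even (m ^ 2)" by simp
  then have "even m" by simp
  then obtain k where k: "m = 2 * k" by blast
  then have "n ^ 2 = 2 * k ^ 2" using eq by (simp add: power_mult_distrib)
  then have "even (n ^ 2)" by simp
  then have "even n" by simp
  then show False using coprime_common_divisor[OF mn(3) \<open>even m\<close>] by simp
qed

text \<open>As \<surd>2 and 1 are independent over the rationals, values prescribed on them extend
  linearly along a rational basis of the reals. Such a \<delta> cannot be monotone, since a monotone
  additive function vanishing at 1 is zero.\<close>

lemma additive_separating_sqrt_2: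
  "\<exists>\<delta> :: real \<Rightarrow> real. (\<forall>x y. \<delta> (x + y) = \<delta> x + \<delta> y) \<and> \<delta> 1 = 0 \<and> \<delta> (sqrt 2) = 1"
proof -
  define sc where "sc = (\<lambda>(q::rat) (x::real). of_rat q * x)"
  interpret V: vector_space sc
    by unfold_locales (auto simp: sc_def algebra_simps of_rat_add of_rat_mult)
  interpret VV: vector_space_pair sc sc by unfold_locales
  have "V.independent {sqrt 2, 1}"
  proof -
    have "sqrt 2 \<notin> V.span {1}"
    proof
      assume "sqrt 2 \<in> V.span {1}"
      then obtain q where "sqrt 2 - sc q 1 \<in> V.span {}" using V.span_breakdown_eq[of "sqrt 2" 1 "{}"] by blast
      then have "sqrt 2 - sc q 1 = 0" unfolding V.span_empty by blast
      then have "sqrt 2 = of_rat q" unfolding sc_def by simp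
      then show False using sqrt_2_irrational by simp
    qed
    then show ?thesis by (simp add: V.independent_insert)
  qed
  then obtain g where g: "Vector_Spaces.linear sc sc g" "\<forall>x\<in>{sqrt 2, 1}. g x = (if x = 1 then 0 else 1)"
    using VV.linear_independent_extend[of "{sqrt 2, 1}" "\<lambda>x. if x = 1 then 0 else 1"] by blast
  interpret g: Vector_Spaces.linear sc sc g by (rule g(1))
  show ?thesis using g.add g(2) by (intro exI[of _ g]) auto
qed

section \<open>Invariants of formal sums\<close>

definition ten_val :: "(m1 \<times> m1) list \<Rightarrow> ennreal" where
  "ten_val x = (\<Sum>p\<leftarrow>x. m1_val (fst p \<odot>\<^bsub>M1\<^esub> snd p))"

definition ten_soft :: "(m1 \<times> m1) list \<Rightarrow> bool" where
  "ten_soft x \<longleftrightarrow> (\<exists>p\<in>set x. \<not> m1_cpt (fst p \<odot>\<^bsub>M1\<^esub> snd p))"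

text \<open>The form \<delta>(x) y is biadditive on finite values. Since \<open>enn2real\<close>
  sends infinity to 0, additivity can fail in the presence of infinite values, which is one reason
  for tracking soft summands separately.\<close>

definition ten_delta :: "(real \<Rightarrow> real) \<Rightarrow> (m1 \<times> m1) list \<Rightarrow> real" where
  "ten_delta \<delta> x = (\<Sum>p\<leftarrow>x. \<delta> (enn2real (m1_val (fst p))) * enn2real (m1_val (snd p)))"

lemma ten_simps:
  "ten_val [] = 0" "ten_val (p # x) = m1_val (fst p) * m1_val (snd p) + ten_val x" "ten_val (x @ y) = ten_val x + ten_val y"
  "ten_soft [] \<longleftrightarrow> False" "ten_soft (p # x) \<longleftrightarrow> \<not> m1_cpt (fst p \<odot>\<^bsub>M1\<^esub> snd p) \<or> ten_soft x"
  "ten_soft (x @ y) \<longleftrightarrow> ten_soft x \<or> ten_soft y"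
  "ten_delta \<delta> [] = 0" "ten_delta \<delta> (x @ y) = ten_delta \<delta> x + ten_delta \<delta> y"
  "ten_delta \<delta> (p # x) = \<delta> (enn2real (m1_val (fst p))) * enn2real (m1_val (snd p)) + ten_delta \<delta> x"
  unfolding ten_val_def ten_soft_def ten_delta_def by (auto simp: M1_val_mult)

text \<open>As \<delta> is not monotone, \<open>ten_delta\<close> cannot respect the pre-order
  unconditionally. The statement is lexicographic: a strict increase in value excuses everything,
  and so does a soft summand on the left. In the remaining case the monotonicity generators keep the
  values of both factors or have products zero, and the others are instances of
  biadditivity.\<close>

lemma tensor_le_M1_invariant:
  assumes \<delta>: "\<And>x y. \<delta> (x + y) = \<delta> x + \<delta> y" and le: "tensor_le M1 M1 x y"
  shows "ten_val x < ten_val y \<or> ten_val x = ten_val y \<and>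
    (ten_soft x \<or> \<not> ten_soft y \<and> ten_delta \<delta> x = ten_delta \<delta> y)"
proof -
  have \<delta>0: "\<delta> 0 = 0" using \<delta>[of 0 0] by simp
  have real_add: "enn2real (a + b) = enn2real a + enn2real b" if "a < top" "b < top" for a b
    using that by (cases a; cases b) (auto simp: ennreal_plus[symmetric] simp del: ennreal_plus)
  have delta_left: "\<delta> (enn2real (m1_val a + m1_val a')) * enn2real (m1_val b) =
      \<delta> (enn2real (m1_val a)) * enn2real (m1_val b) + \<delta> (enn2real (m1_val a')) * enn2real (m1_val b)"
    if "a \<in> carrier M1" "a' \<in> carrier M1" "b \<in> carrier M1" "\<not> ten_soft [(a, b), (a', b)]" for a a' b
  proof (cases "m1_val b = 0")
    case False
    have "m1_val z < top" if "z \<in> carrier M1" "m1_cpt (z \<odot>\<^bsub>M1\<^esub> b)" for z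
      using M1_cpt_mult[OF that(1) \<open>b \<in> carrier M1\<close>] that False by (auto simp: M1_carrier)
    then have "m1_val a < top" "m1_val a' < top" using that by (simp_all add: ten_simps)
    then show ?thesis by (simp add: real_add \<delta> distrib_right)
  qed simp
  have delta_right: "\<delta> (enn2real (m1_val a)) * enn2real (m1_val b + m1_val b') =
      \<delta> (enn2real (m1_val a)) * enn2real (m1_val b) + \<delta> (enn2real (m1_val a)) * enn2real (m1_val b')"
    if "a \<in> carrier M1" "b \<in> carrier M1" "b' \<in> carrier M1" "\<not> ten_soft [(a, b), (a, b')]" for a b b'
  proof (cases "m1_val a = 0")
    case False
    have "m1_val z < top" if "z \<in> carrier M1" "m1_cpt (a \<odot>\<^bsub>M1\<^esub> z)" for z
      using M1_cpt_mult[OF \<open>a \<in> carrier M1\<close> that(1)] that False by (auto simp: M1_carrier)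
    then have "m1_val b < top" "m1_val b' < top" using that by (simp_all add: ten_simps)
    then show ?thesis by (simp add: real_add distrib_left)
  qed (simp add: \<delta>0)
  \<comment> \<open>Compact products are finite, so an infinite total needs a soft summand. This
    settles concatenation where sums cannot be cancelled.\<close>
  have top: "ten_soft x" if "ten_val x = top" "x \<in> formal_sums M1 M1" for x
    using that
  proof (induction x)
    case (Cons p x)
    then have p: "fst p \<in> carrier M1" "snd p \<in> carrier M1" "x \<in> formal_sums M1 M1" by (auto simp: formal_sums_simps)
    show ?case
    proof (cases "ten_val x = top")
      case False
      then have "m1_val (fst p \<odot>\<^bsub>M1\<^esub> snd p) = top" using Cons.prems(1) by (simp add: ten_simps M1_val_mult)
      then show ?thesis using M1_soft_if_top[OF M1_mult_closed[OF p(1,2)]] by (simp add: ten_simps)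
    qed (use Cons p in \<open>simp add: ten_simps\<close>)
  qed (simp add: ten_simps)
  show ?thesis using le
  proof (induction rule: tensor_le.induct)
    case (trans x y z) then show ?case by (auto dest: less_trans)
  next
    case (append x y x' y')
    have fs: "x \<in> formal_sums M1 M1" "x' \<in> formal_sums M1 M1" "y \<in> formal_sums M1 M1" "y' \<in> formal_sums M1 M1"
      using append MM.tle_closed by auto
    have v: "ten_val x \<le> ten_val y" "ten_val x' \<le> ten_val y'" using append.IH by auto
    show ?case
    proof (cases "ten_val x = top \<or> ten_val x' = top")
      case True
      then have "ten_soft (x @ x')" using top fs by (auto simp: ten_simps)
      moreover have "ten_val (x @ x') = top" "ten_val (y @ y') = top"
        using True v by (auto simp: ten_simps top_unique)
      ultimately show ?thesis by simp
    next
      case False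
      then show ?thesis
        using append.IH v ennreal_add_less_mono[of "ten_val x" "ten_val y" "ten_val x'" "ten_val y'"]
          ennreal_add_less_mono[of "ten_val x'" "ten_val y'" "ten_val x" "ten_val y"]
        by (auto simp: ten_simps less_top add.commute)
    qed
  next
    case (mono a a' b b')
    have le: "a \<odot>\<^bsub>M1\<^esub> b \<sqsubseteq>\<^bsub>M1\<^esub> a' \<odot>\<^bsub>M1\<^esub> b'" by (rule M1_mult_mono) (use mono in auto)
    have v: "m1_val a \<le> m1_val a'" "m1_val b \<le> m1_val b'" using mono by (auto simp: M1_le)
    have "\<delta> (enn2real (m1_val a)) * enn2real (m1_val b) = \<delta> (enn2real (m1_val a')) * enn2real (m1_val b')"
      if eq: "m1_val a * m1_val b = m1_val a' * m1_val b'" and cpt: "m1_cpt (a \<odot>\<^bsub>M1\<^esub> b)"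
    proof (cases "m1_val a * m1_val b = 0")
      case True
      then have "m1_val a = 0 \<or> m1_val b = 0" "m1_val a' = 0 \<or> m1_val b' = 0" using eq by auto
      then show ?thesis using \<delta>0 by auto
    next
      case False
      then have "m1_cpt a" "m1_cpt b" using cpt M1_cpt_mult[OF mono(1,3)] by auto
      then have fin: "m1_val a < top" "m1_val b < top" using mono by (auto simp: M1_carrier)
      \<comment> \<open>Monotonicity gives nothing for \<delta>, so equality of the factors is
        needed: nonzero products of finite factors can agree while both factors grow only if neither
        grows.\<close>
      have "m1_val a = m1_val a'" "m1_val b = m1_val b'"
        using eq False fin v ennreal_mult_less_mono[of "m1_val a" "m1_val a'" "m1_val b" "m1_val b'"]
          ennreal_mult_less_mono[of "m1_val b" "m1_val b'" "m1_val a" "m1_val a'"]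
        by (auto simp: le_less zero_less_iff_neq_zero mult.commute)
      then show ?thesis by simp
    qed
    then show ?case using le by (auto simp: ten_simps M1_le M1_val_mult)
  next
    case (swap x y) then show ?case by (auto simp: ten_simps add.commute)
  next
    case (addl1 a a' b) then show ?case using delta_left[of a a' b] by (auto simp: ten_simps M1_add distrib_right M1_distrib_right)
  next
    case (addl2 a a' b) then show ?case using delta_left[of a a' b] by (auto simp: ten_simps M1_add distrib_right M1_distrib_right)
  next
    case (addr1 a b b') then show ?case using delta_right[of a b b'] by (auto simp: ten_simps M1_add distrib_left M1_distrib_left)
  next
    case (addr2 a b b') then show ?case using delta_right[of a b b'] by (auto simp: ten_simps M1_add distrib_left M1_distrib_left)
  qed (auto simp: ten_simps M1_zero \<delta>0 M1_cpt_mult M1_carrier)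
qed

lemma M1_not_solid: "\<not> solid M1"
proof
  assume "solid M1"
  then have inj: "inj_on (mu_map M1) (carrier (tensor M1 M1))" unfolding solid_def cu_iso_def bij_betw_def by simp
  define a b where "a = Cpt (ennreal (sqrt 2))" and "b = Cpt 1"
  have c: "a \<in> carrier M1" "b \<in> carrier M1" unfolding a_def b_def by (simp_all add: M1_carrier)
  have b1: "b = \<one>\<^bsub>M1\<^esub>" unfolding b_def M1_one ..
  have t: "tens M1 M1 x y \<in> carrier (tensor M1 M1)" if "x \<in> carrier M1" "y \<in> carrier M1" for x y
    using MM.tens_cu_bimor that unfolding cu_bimor_def by simp
  have "mu_map M1 (tens M1 M1 a b) = mu_map M1 (tens M1 M1 b a)"
    using c M1.mult_one_left[OF c(1)] M1.mult_one_right[OF c(1)] by (simp add: M1.mu_tens b1)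
  then have eq: "tens M1 M1 a b = tens M1 M1 b a" using inj_onD[OF inj] t c by blast
  \<comment> \<open>Both factors are compact, so the formal sum is below itself for the auxiliary
    relation and lies in its own ideal. Equality of the ideals then gives an inequality of formal
    sums.\<close>
  have "[(a, b)] \<in> tens M1 M1 a b" unfolding tens_def
    using c by (auto intro!: MM.tw_below simp: MM.tw_simps M1_way_below a_def b_def)
  then have le: "tensor_le M1 M1 [(a, b)] [(b, a)]" unfolding eq unfolding tens_def using MM.below_le by blast
  obtain \<delta> :: "real \<Rightarrow> real" where \<delta>: "\<And>x y. \<delta> (x + y) = \<delta> x + \<delta> y" "\<delta> 1 = 0" "\<delta> (sqrt 2) = 1"
    using additive_separating_sqrt_2 by blast
  have "ten_val [(a, b)] = ten_val [(b, a)]" "\<not> ten_soft [(a, b)]"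
    "ten_delta \<delta> [(a, b)] = 1" "ten_delta \<delta> [(b, a)] = 0"
    using \<delta> c by (simp_all add: ten_simps M1_cpt_mult a_def b_def)
  then show False using tensor_le_M1_invariant[OF \<delta>(1) le] by auto
qed

theorem theorem5p22:
  fixes R :: "('a, 'm) cu_sr_scheme"
  shows "(cu_semiring R \<longrightarrow>
            (eval_iso R \<longrightarrow> solid R) \<and>
            (eval_iso R \<longrightarrow> pi_tensor_id_iso R) \<and>
            (pi_iso R \<longrightarrow> pi_tensor_id_iso R) \<and>
            (pi_iso R \<longleftrightarrow> eps_iso R) \<and>
            (solid R \<and> pi_tensor_id_iso R \<longrightarrow> eval_iso R)) \<and>
         (cu_semiring Pbar \<and> solid Pbar \<and> eval_iso Pbar \<and> pi_tensor_id_iso Pbar \<and> \<not> pi_iso Pbar) \<and>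
         (cu_semiring M1 \<and> pi_tensor_id_iso M1 \<and> pi_iso M1 \<and> \<not> solid M1 \<and> \<not> eval_iso M1)"
proof (intro conjI impI; (elim conjE)?)
  assume R: "cu_semiring R"
  show "solid R" if "eval_iso R" by (rule cu_semiring.solid_if_eval_iso[OF R that])
  show "pi_tensor_id_iso R" if "eval_iso R"
    by (rule cu_semiring.pi_tens_iso_if[OF R that cu_semiring.solid_if_eval_iso[OF R that]])
  show "pi_tensor_id_iso R" if "pi_iso R" by (rule cu_semiring.pi_tens_iso_if_pi_iso[OF R that])
  show "pi_iso R \<longleftrightarrow> eps_iso R" by (rule cu_semiring.pi_iso_iff_eps_iso[OF R])
  show "eval_iso R" if "solid R" "pi_tensor_id_iso R" by (rule cu_semiring.eval_iso_if[OF R that])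
next
  show "cu_semiring Pbar" by (rule Pbar_cu_semiring)
  show "eval_iso Pbar" by (rule Pbar_eval_iso)
  then show "solid Pbar" by (rule Pbar.solid_if_eval_iso)
  then show "pi_tensor_id_iso Pbar" by (rule Pbar.pi_tens_iso_if[OF Pbar_eval_iso])
  show "\<not> pi_iso Pbar" using Pbar_not_eps_iso Pbar.pi_iso_iff_eps_iso by simp
next
  show "cu_semiring M1" by (rule M1_cu_semiring)
  show "pi_iso M1" by (rule M1_pi_iso)
  then show "pi_tensor_id_iso M1" by (rule M1.pi_tens_iso_if_pi_iso)
  show "\<not> solid M1" by (rule M1_not_solid)
  then show "\<not> eval_iso M1" using M1.solid_if_eval_iso by blast
qed

end
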